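(* If $\mathcal{C}$ is a type-theoretic fibration category and $I$ is an inverse category that is admissible for $\mathcal{C}$, then the category $(\mathcal{C}^I)_{\mathbf f}$ of Reedy fibrant $I$-diagrams in $\mathcal{C}$, with the Reedy fibrations as its fibrations, is also a type-theoretic fibration category.
   Context: A type-theoretic fibration category is a category $\mathcal{C}$ with the following structure. (1) A terminal object $1$. (2) A subcategory $\mathcal{F}\subset\mathcal{C}$ containing all objects, all isomorphisms, and all morphisms with codomain $1$; morphisms of $\mathcal{F}$ are called fibrations, and a morphism is called an acyclic cofibration if it has the left lifting property with respect to all fibrations. (3) All pullbacks of fibrations (along arbitrary morphisms) exist and are fibrations. (4) For every fibration $g:A\to B$, the pullback functor $g^*:\mathcal{C}/B\to\mathcal{C}/A$ has a partial right adjoint $\Pi_g$, defined at all fibrations over $A$, whose values are fibrations over $B$. (5) Every morphism factors as an acyclic cofibration followed by a fibration. (6) If $A\to C$ and $B\to C$ are fibrations, $A\to B$ is an acyclic cofibration over $C$, and $Z\to C$ is any morphism, then the induced map $Z\times_C A\to Z\times_C B$ is an acyclic cofibration. A homotopy $f\sim g$ between $f,g:A\rightrightarrows B$ is a lift of $(f,g):A\to B\times B$ to a path object of $B$, i.e. to a factorization $B\to PB\to B\times B$ of the diagonal as an acyclic cofibration followed by a fibration. An equivalence (homotopy equivalence) is a morphism having an inverse up to homotopy. An inverse category is a category $I$ such that the relation $y\prec x$, meaning that there is a nonidentity arrow $x\to y$, is well-founded on objects. For $x\in I$, $x/\!\!/I$ is the full subcategory of the co-slice category $x/I$ excluding only the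 identity $\mathrm{id}_x$; it is again an inverse category. The matching object of a diagram $A$ at $x$ is $M_xA=\lim_{x/\!\!/I}A$ (the limit of the composite of $A$ with the forgetful functor), if it exists. A Reedy fibration in $\mathcal{C}^I$ is a map $f:A\to B$ such that $A$ and $B$ have all matching objects, each pullback $M_xA\times_{M_xB}B_x$ exists, and each induced map $A_x\to M_xA\times_{M_xB}B_x$ is a fibration in $\mathcal{C}$. A Reedy acyclic cofibration is a levelwise acyclic cofibration. $A$ is Reedy fibrant if it has all matching objects and each $A_x\to M_xA$ is a fibration; $(\mathcal{C}^I)_{\mathbf f}$ is the full subcategory of $\mathcal{C}^I$ on Reedy fibrant objects. For an inverse category $J$, $\mathcal{C}$ has Reedy $J$-limits if: every Reedy fibrant $A\in\mathcal{C}^J$ has a limit, which is fibrant in $\mathcal{C}$; and for any morphism $f:A\to B$ of Reedy fibrant objects, $\lim f$ is a fibration if $f$ is a Reedy fibration, an equivalence if $f$ is a levelwise equivalence, and an acyclic cofibration if $f$ is a Reedy acyclic cofibration. $I$ is admissible for $\mathcal{C}$ if $\mathcal{C}$ has Reedy $(x/\!\!/I)$-limits for every object $x\in I$. *)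

theory Defs
  imports Main "HOL-Library.FuncSet"
begin

section \<open>Categories and functors\<close>

text \<open>Composition is written in applicative order: \<open>g \<cdot> f\<close> is meaningful when
  \<open>Cod f = Dom g\<close>.\<close>

record ('o, 'a) cat =
  Ob :: "'o set"
  Ar :: "'a set"
  Dom :: "'a \<Rightarrow> 'o"
  Cod :: "'a \<Rightarrow> 'o"
  Ide :: "'o \<Rightarrow> 'a"
  Cmp :: "'a \<Rightarrow> 'a \<Rightarrow> 'a"  (infixl \<open>\<cdot>\<index>\<close> 70)

definition hom :: "('o, 'a) cat \<Rightarrow> 'o \<Rightarrow> 'o \<Rightarrow> 'a set" where
  "hom C x y = {f \<in> Ar C. Dom C f = x \<and> Cod C f = y}"

locale category =
  fixes C :: "('o, 'a) cat" (structure)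
  assumes dom_ob: "f \<in> Ar C \<Longrightarrow> Dom C f \<in> Ob C"
    and cod_ob: "f \<in> Ar C \<Longrightarrow> Cod C f \<in> Ob C"
    and ide_hom: "x \<in> Ob C \<Longrightarrow> Ide C x \<in> hom C x x"
    and cmp_hom: "f \<in> hom C x y \<Longrightarrow> g \<in> hom C y z \<Longrightarrow> g \<cdot> f \<in> hom C x z"
    and cmp_ide_right: "f \<in> hom C x y \<Longrightarrow> f \<cdot> Ide C x = f"
    and cmp_ide_left: "f \<in> hom C x y \<Longrightarrow> Ide C y \<cdot> f = f"
    and cmp_assoc: "f \<in> hom C w x \<Longrightarrow> g \<in> hom C x y \<Longrightarrow> h \<in> hom C y z \<Longrightarrow>
                    h \<cdot> (g \<cdot> f) = (h \<cdot> g) \<cdot> f"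

definition is_iso :: "('o, 'a) cat \<Rightarrow> 'a \<Rightarrow> bool" where
  "is_iso C f \<longleftrightarrow> f \<in> Ar C \<and>
     (\<exists>g \<in> hom C (Cod C f) (Dom C f).
        g \<cdot>\<^bsub>C\<^esub> f = Ide C (Dom C f) \<and> f \<cdot>\<^bsub>C\<^esub> g = Ide C (Cod C f))"

definition is_terminal :: "('o, 'a) cat \<Rightarrow> 'o \<Rightarrow> bool" where
  "is_terminal C t \<longleftrightarrow> t \<in> Ob C \<and> (\<forall>x \<in> Ob C. \<exists>!f. f \<in> hom C x t)"

definition full_subcategory :: "('o, 'a) cat \<Rightarrow> 'o set \<Rightarrow> ('o, 'a) cat" where
  "full_subcategory C S = C\<lparr>Ob := Ob C \<inter> S,
     Ar := {f \<in> Ar C. Dom C f \<in> S \<and> Cod C f \<in> S}\<rparr>"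

text \<open>Functors and natural transformations are required to be extensional, i.e.\ \<open>undefined\<close>
  off the objects and arrows of their source, so that HOL equality of functors and of
  transformations is the intended one.\<close>

record ('i, 'j, 'o, 'a) fnctr =
  Fob :: "'i \<Rightarrow> 'o"
  Far :: "'j \<Rightarrow> 'a"

definition is_functor :: "('i, 'j) cat \<Rightarrow> ('o, 'a) cat \<Rightarrow> ('i, 'j, 'o, 'a) fnctr \<Rightarrow> bool" where
  "is_functor J C A \<longleftrightarrow>
     Fob A \<in> Ob J \<rightarrow>\<^sub>E Ob C \<and> Far A \<in> Ar J \<rightarrow>\<^sub>E Ar C \<and>
     (\<forall>u \<in> Ar J. Far A u \<in> hom C (Fob A (Dom J u)) (Fob A (Cod J u))) \<and>
     (\<forall>j \<in> Ob J. Far A (Ide J j) = Ide C (Fob A j)) \<and>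
     (\<forall>u \<in> Ar J. \<forall>v \<in> Ar J. Cod J u = Dom J v \<longrightarrow>
        Far A (v \<cdot>\<^bsub>J\<^esub> u) = Far A v \<cdot>\<^bsub>C\<^esub> Far A u)"

definition is_nat_trans ::
  "('i, 'j) cat \<Rightarrow> ('o, 'a) cat \<Rightarrow> ('i, 'j, 'o, 'a) fnctr \<Rightarrow> ('i \<Rightarrow> 'a) \<Rightarrow>
   ('i, 'j, 'o, 'a) fnctr \<Rightarrow> bool" where
  "is_nat_trans J C A \<alpha> B \<longleftrightarrow>
     is_functor J C A \<and> is_functor J C B \<and> \<alpha> \<in> extensional (Ob J) \<and>
     (\<forall>j \<in> Ob J. \<alpha> j \<in> hom C (Fob A j) (Fob B j)) \<and>
     (\<forall>u \<in> Ar J. Far B u \<cdot>\<^bsub>C\<^esub> \<alpha> (Dom J u) = \<alpha> (Cod J u) \<cdot>\<^bsub>C\<^esub> Far A u)"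

type_synonym ('i, 'j, 'o, 'a) ntrans =
  "('i, 'j, 'o, 'a) fnctr \<times> ('i \<Rightarrow> 'a) \<times> ('i, 'j, 'o, 'a) fnctr"

text \<open>The category \<open>C\<^sup>J\<close>; an arrow \<open>A \<rightarrow> B\<close> is a triple \<open>(A, \<alpha>, B)\<close>.\<close>

definition functor_cat ::
  "('i, 'j) cat \<Rightarrow> ('o, 'a) cat \<Rightarrow> (('i, 'j, 'o, 'a) fnctr, ('i, 'j, 'o, 'a) ntrans) cat" where
  "functor_cat J C =
     \<lparr>Ob = {A. is_functor J C A},
      Ar = {(A, \<alpha>, B). is_nat_trans J C A \<alpha> B},
      Dom = (\<lambda>(A, \<alpha>, B). A),
      Cod = (\<lambda>(A, \<alpha>, B). B),
      Ide = (\<lambda>A. (A, \<lambda>j \<in> Ob J. Ide C (Fob A j), A)),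
      Cmp = (\<lambda>(B, \<beta>, D) (A, \<alpha>, B'). (A, \<lambda>j \<in> Ob J. \<beta> j \<cdot>\<^bsub>C\<^esub> \<alpha> j, D))\<rparr>"

definition slice :: "('o, 'a) cat \<Rightarrow> 'o \<Rightarrow> ('a, 'a \<times> 'a \<times> 'a) cat" where
  "slice C b =
     \<lparr>Ob = {f \<in> Ar C. Cod C f = b},
      Ar = {(f, k, g). f \<in> Ar C \<and> g \<in> Ar C \<and> Cod C f = b \<and> Cod C g = b \<and>
              k \<in> hom C (Dom C f) (Dom C g) \<and> g \<cdot>\<^bsub>C\<^esub> k = f},
      Dom = (\<lambda>(f, k, g). f),
      Cod = (\<lambda>(f, k, g). g),
      Ide = (\<lambda>f. (f, Ide C (Dom C f), f)),
      Cmp = (\<lambda>(g, l, h) (f, k, g'). (f, l \<cdot>\<^bsub>C\<^esub> k, h))\<rparr>"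

definition coslice :: "('o, 'a) cat \<Rightarrow> 'o \<Rightarrow> ('a, 'a \<times> 'a \<times> 'a) cat" where
  "coslice C x =
     \<lparr>Ob = {f \<in> Ar C. Dom C f = x},
      Ar = {(f, k, g). f \<in> Ar C \<and> g \<in> Ar C \<and> Dom C f = x \<and> Dom C g = x \<and>
              k \<in> hom C (Cod C f) (Cod C g) \<and> k \<cdot>\<^bsub>C\<^esub> f = g},
      Dom = (\<lambda>(f, k, g). f),
      Cod = (\<lambda>(f, k, g). g),
      Ide = (\<lambda>f. (f, Ide C (Cod C f), f)),
      Cmp = (\<lambda>(g, l, h) (f, k, g'). (f, l \<cdot>\<^bsub>C\<^esub> k, h))\<rparr>"


section \<open>Limits\<close>

text \<open>Limits and pullbacks are chosen by \<open>SOME\<close>, and induced maps into them are named by \<open>THE\<close>;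
  these are meaningful only under the corresponding existence predicates \<open>has_limit\<close> and
  \<open>has_pullback\<close>.\<close>

definition is_cone ::
  "('o, 'a) cat \<Rightarrow> ('i, 'j) cat \<Rightarrow> ('i, 'j, 'o, 'a) fnctr \<Rightarrow> 'o \<Rightarrow> ('i \<Rightarrow> 'a) \<Rightarrow> bool" where
  "is_cone C J D L \<pi> \<longleftrightarrow> L \<in> Ob C \<and> (\<forall>j \<in> Ob J. \<pi> j \<in> hom C L (Fob D j)) \<and>
     (\<forall>u \<in> Ar J. Far D u \<cdot>\<^bsub>C\<^esub> \<pi> (Dom J u) = \<pi> (Cod J u))"

definition is_limit ::
  "('o, 'a) cat \<Rightarrow> ('i, 'j) cat \<Rightarrow> ('i, 'j, 'o, 'a) fnctr \<Rightarrow> 'o \<Rightarrow> ('i \<Rightarrow> 'a) \<Rightarrow> bool" where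
  "is_limit C J D L \<pi> \<longleftrightarrow> is_cone C J D L \<pi> \<and>
     (\<forall>K \<kappa>. is_cone C J D K \<kappa> \<longrightarrow>
        (\<exists>!h. h \<in> hom C K L \<and> (\<forall>j \<in> Ob J. \<pi> j \<cdot>\<^bsub>C\<^esub> h = \<kappa> j)))"

definition has_limit ::
  "('o, 'a) cat \<Rightarrow> ('i, 'j) cat \<Rightarrow> ('i, 'j, 'o, 'a) fnctr \<Rightarrow> bool" where
  "has_limit C J D \<longleftrightarrow> (\<exists>L \<pi>. is_limit C J D L \<pi>)"

definition lim_cone ::
  "('o, 'a) cat \<Rightarrow> ('i, 'j) cat \<Rightarrow> ('i, 'j, 'o, 'a) fnctr \<Rightarrow> 'o \<times> ('i \<Rightarrow> 'a)" where
  "lim_cone C J D = (SOME (L, \<pi>). is_limit C J D L \<pi>)"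

definition lim_ob :: "('o, 'a) cat \<Rightarrow> ('i, 'j) cat \<Rightarrow> ('i, 'j, 'o, 'a) fnctr \<Rightarrow> 'o" where
  "lim_ob C J D = fst (lim_cone C J D)"

definition lim_proj :: "('o, 'a) cat \<Rightarrow> ('i, 'j) cat \<Rightarrow> ('i, 'j, 'o, 'a) fnctr \<Rightarrow> 'i \<Rightarrow> 'a" where
  "lim_proj C J D = snd (lim_cone C J D)"

definition lim_induced ::
  "('o, 'a) cat \<Rightarrow> ('i, 'j) cat \<Rightarrow> ('i, 'j, 'o, 'a) fnctr \<Rightarrow> 'o \<Rightarrow> ('i \<Rightarrow> 'a) \<Rightarrow> 'a" where
  "lim_induced C J D K \<kappa> =
     (THE h. h \<in> hom C K (lim_ob C J D) \<and> (\<forall>j \<in> Ob J. lim_proj C J D j \<cdot>\<^bsub>C\<^esub> h = \<kappa> j))"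

definition lim_map :: "('o, 'a) cat \<Rightarrow> ('i, 'j) cat \<Rightarrow> ('i, 'j, 'o, 'a) ntrans \<Rightarrow> 'a" where
  "lim_map C J = (\<lambda>(A, \<alpha>, B).
     lim_induced C J B (lim_ob C J A) (\<lambda>j. \<alpha> j \<cdot>\<^bsub>C\<^esub> lim_proj C J A j))"

definition is_pullback :: "('o, 'a) cat \<Rightarrow> 'a \<Rightarrow> 'a \<Rightarrow> 'a \<Rightarrow> 'a \<Rightarrow> bool" where
  "is_pullback C f g p q \<longleftrightarrow>
     f \<in> Ar C \<and> g \<in> Ar C \<and> Cod C f = Cod C g \<and>
     p \<in> Ar C \<and> q \<in> Ar C \<and> Dom C p = Dom C q \<and> Cod C p = Dom C f \<and> Cod C q = Dom C g \<and>
     f \<cdot>\<^bsub>C\<^esub> p = g \<cdot>\<^bsub>C\<^esub> q \<and>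
     (\<forall>z. \<forall>u \<in> hom C z (Dom C f). \<forall>v \<in> hom C z (Dom C g). f \<cdot>\<^bsub>C\<^esub> u = g \<cdot>\<^bsub>C\<^esub> v \<longrightarrow>
        (\<exists>!h. h \<in> hom C z (Dom C p) \<and> p \<cdot>\<^bsub>C\<^esub> h = u \<and> q \<cdot>\<^bsub>C\<^esub> h = v))"

definition has_pullback :: "('o, 'a) cat \<Rightarrow> 'a \<Rightarrow> 'a \<Rightarrow> bool" where
  "has_pullback C f g \<longleftrightarrow> (\<exists>p q. is_pullback C f g p q)"

definition pb_cone :: "('o, 'a) cat \<Rightarrow> 'a \<Rightarrow> 'a \<Rightarrow> 'a \<times> 'a" where
  "pb_cone C f g = (SOME (p, q). is_pullback C f g p q)"

definition pb_fst :: "('o, 'a) cat \<Rightarrow> 'a \<Rightarrow> 'a \<Rightarrow> 'a" where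
  "pb_fst C f g = fst (pb_cone C f g)"

definition pb_snd :: "('o, 'a) cat \<Rightarrow> 'a \<Rightarrow> 'a \<Rightarrow> 'a" where
  "pb_snd C f g = snd (pb_cone C f g)"

definition pb_induced :: "('o, 'a) cat \<Rightarrow> 'a \<Rightarrow> 'a \<Rightarrow> 'a \<Rightarrow> 'a \<Rightarrow> 'a" where
  "pb_induced C f g u v =
     (THE h. h \<in> hom C (Dom C u) (Dom C (pb_fst C f g)) \<and>
             pb_fst C f g \<cdot>\<^bsub>C\<^esub> h = u \<and> pb_snd C f g \<cdot>\<^bsub>C\<^esub> h = v)"

definition is_binary_product :: "('o, 'a) cat \<Rightarrow> 'o \<Rightarrow> 'o \<Rightarrow> 'a \<Rightarrow> 'a \<Rightarrow> bool" where
  "is_binary_product C a b p q \<longleftrightarrow>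
     p \<in> Ar C \<and> q \<in> Ar C \<and> Dom C p = Dom C q \<and> Cod C p = a \<and> Cod C q = b \<and>
     (\<forall>z. \<forall>u \<in> hom C z a. \<forall>v \<in> hom C z b.
        \<exists>!h. h \<in> hom C z (Dom C p) \<and> p \<cdot>\<^bsub>C\<^esub> h = u \<and> q \<cdot>\<^bsub>C\<^esub> h = v)"


section \<open>Partial right adjoints\<close>

text \<open>The pullback functor \<open>g\<^sup>* : C/B \<rightarrow> C/A\<close> along \<open>g : A \<rightarrow> B\<close>.\<close>

definition pullback_functor ::
  "('o, 'a) cat \<Rightarrow> 'a \<Rightarrow> ('a, 'a \<times> 'a \<times> 'a, 'a, 'a \<times> 'a \<times> 'a) fnctr" where
  "pullback_functor C g =
     \<lparr>Fob = (\<lambda>z \<in> Ob (slice C (Cod C g)). pb_fst C g z),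
      Far = (\<lambda>(z, k, z') \<in> Ar (slice C (Cod C g)).
               (pb_fst C g z,
                pb_induced C g z' (pb_fst C g z) (k \<cdot>\<^bsub>C\<^esub> pb_snd C g z),
                pb_fst C g z'))\<rparr>"

text \<open>A partial right adjoint of \<open>G : D \<rightarrow> E\<close> is defined at those \<open>x\<close> for which the presheaf
  \<open>E(G -, x)\<close> on \<open>D\<close> is representable, and its value there is a representing object.  Its action
  on arrows between such objects is then determined by the Yoneda lemma.\<close>

definition partial_right_adjoint ::
  "('o, 'a) cat \<Rightarrow> ('p, 'b) cat \<Rightarrow> ('o, 'a, 'p, 'b) fnctr \<Rightarrow> 'p set \<Rightarrow> ('p \<Rightarrow> 'o) \<Rightarrow> bool" where
  "partial_right_adjoint D E G S R \<longleftrightarrow>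
     (\<forall>x \<in> S. R x \<in> Ob D \<and>
        (\<exists>\<phi>. (\<forall>d \<in> Ob D. bij_betw (\<phi> d) (hom D d (R x)) (hom E (Fob G d) x)) \<and>
             (\<forall>d \<in> Ob D. \<forall>d' \<in> Ob D. \<forall>u \<in> hom D d' d. \<forall>k \<in> hom D d (R x).
                \<phi> d' (k \<cdot>\<^bsub>D\<^esub> u) = \<phi> d k \<cdot>\<^bsub>E\<^esub> Far G u)))"


section \<open>Type-theoretic fibration categories\<close>

definition acyclic_cofibration :: "('o, 'a) cat \<Rightarrow> 'a set \<Rightarrow> 'a \<Rightarrow> bool" where
  "acyclic_cofibration C F i \<longleftrightarrow> i \<in> Ar C \<and>
     (\<forall>p \<in> F. \<forall>u \<in> hom C (Dom C i) (Dom C p). \<forall>v \<in> hom C (Cod C i) (Cod C p).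
        p \<cdot>\<^bsub>C\<^esub> u = v \<cdot>\<^bsub>C\<^esub> i \<longrightarrow>
        (\<exists>h \<in> hom C (Cod C i) (Dom C p). h \<cdot>\<^bsub>C\<^esub> i = u \<and> p \<cdot>\<^bsub>C\<^esub> h = v))"

locale type_theoretic_fibration_category = category C
  for C :: "('o, 'a) cat" (structure) +
  fixes F :: "'a set"
  assumes fib_arrow: "F \<subseteq> Ar C"
    and fib_cmp: "f \<in> F \<Longrightarrow> g \<in> F \<Longrightarrow> Cod C f = Dom C g \<Longrightarrow> g \<cdot> f \<in> F"
    and fib_ide: "x \<in> Ob C \<Longrightarrow> Ide C x \<in> F"
    and fib_iso: "is_iso C f \<Longrightarrow> f \<in> F"
    and fib_terminal: "\<exists>t. is_terminal C t \<and> (\<forall>f \<in> Ar C. Cod C f = t \<longrightarrow> f \<in> F)"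
    and fib_pullback_ex: "g \<in> F \<Longrightarrow> f \<in> Ar C \<Longrightarrow> Cod C f = Cod C g \<Longrightarrow> has_pullback C f g"
    and fib_pullback: "g \<in> F \<Longrightarrow> is_pullback C f g p q \<Longrightarrow> p \<in> F"
    and fib_Pi: "g \<in> F \<Longrightarrow>
       \<exists>R. partial_right_adjoint (slice C (Cod C g)) (slice C (Dom C g)) (pullback_functor C g)
             {p \<in> F. Cod C p = Dom C g} R \<and>
           (\<forall>p \<in> F. Cod C p = Dom C g \<longrightarrow> R p \<in> F)"
    and factorization: "f \<in> Ar C \<Longrightarrow>
       \<exists>i p. acyclic_cofibration C F i \<and> p \<in> F \<and> Cod C i = Dom C p \<and> p \<cdot> i = f"
    and acof_pullback: "a \<in> F \<Longrightarrow> b \<in> F \<Longrightarrow> Cod C a = Cod C b \<Longrightarrow>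
       acyclic_cofibration C F i \<Longrightarrow> i \<in> hom C (Dom C a) (Dom C b) \<Longrightarrow> b \<cdot> i = a \<Longrightarrow>
       z \<in> Ar C \<Longrightarrow> Cod C z = Cod C a \<Longrightarrow>
       acyclic_cofibration C F (pb_induced C z b (pb_fst C z a) (i \<cdot> pb_snd C z a))"

definition fibrant :: "('o, 'a) cat \<Rightarrow> 'a set \<Rightarrow> 'o \<Rightarrow> bool" where
  "fibrant C F x \<longleftrightarrow> (\<exists>t. is_terminal C t \<and> (\<exists>f \<in> hom C x t. f \<in> F))"

text \<open>A path object of \<open>b\<close>: \<open>p\<close>, \<open>q\<close> exhibit a product \<open>b \<times> b\<close>, and \<open>e \<cdot> r\<close> is a factorization
  of the diagonal \<open>b \<rightarrow> b \<times> b\<close>.\<close>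

definition is_path_object ::
  "('o, 'a) cat \<Rightarrow> 'a set \<Rightarrow> 'o \<Rightarrow> 'a \<Rightarrow> 'a \<Rightarrow> 'a \<Rightarrow> 'a \<Rightarrow> bool" where
  "is_path_object C F b p q r e \<longleftrightarrow>
     is_binary_product C b b p q \<and>
     acyclic_cofibration C F r \<and> e \<in> F \<and>
     Dom C r = b \<and> Cod C r = Dom C e \<and> Cod C e = Dom C p \<and>
     p \<cdot>\<^bsub>C\<^esub> (e \<cdot>\<^bsub>C\<^esub> r) = Ide C b \<and> q \<cdot>\<^bsub>C\<^esub> (e \<cdot>\<^bsub>C\<^esub> r) = Ide C b"

definition homotopic :: "('o, 'a) cat \<Rightarrow> 'a set \<Rightarrow> 'a \<Rightarrow> 'a \<Rightarrow> bool" where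
  "homotopic C F f g \<longleftrightarrow>
     f \<in> Ar C \<and> g \<in> Ar C \<and> Dom C f = Dom C g \<and> Cod C f = Cod C g \<and>
     (\<exists>p q r e. is_path_object C F (Cod C f) p q r e \<and>
        (\<exists>h \<in> hom C (Dom C f) (Dom C e). p \<cdot>\<^bsub>C\<^esub> (e \<cdot>\<^bsub>C\<^esub> h) = f \<and> q \<cdot>\<^bsub>C\<^esub> (e \<cdot>\<^bsub>C\<^esub> h) = g))"

definition is_equivalence :: "('o, 'a) cat \<Rightarrow> 'a set \<Rightarrow> 'a \<Rightarrow> bool" where
  "is_equivalence C F f \<longleftrightarrow> f \<in> Ar C \<and>
     (\<exists>g \<in> hom C (Cod C f) (Dom C f).
        homotopic C F (g \<cdot>\<^bsub>C\<^esub> f) (Ide C (Dom C f)) \<and>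
        homotopic C F (f \<cdot>\<^bsub>C\<^esub> g) (Ide C (Cod C f)))"


section \<open>Inverse categories and Reedy fibrations\<close>

definition inverse_category :: "('i, 'j) cat \<Rightarrow> bool" where
  "inverse_category I \<longleftrightarrow> category I \<and>
     wf {(y, x). x \<in> Ob I \<and> y \<in> Ob I \<and> (\<exists>f \<in> hom I x y. \<forall>z \<in> Ob I. f \<noteq> Ide I z)}"

definition strict_coslice :: "('i, 'j) cat \<Rightarrow> 'i \<Rightarrow> ('j, 'j \<times> 'j \<times> 'j) cat" where
  "strict_coslice I x = full_subcategory (coslice I x) (Ob (coslice I x) - {Ide I x})"

text \<open>The composite of \<open>A\<close> with the forgetful functor \<open>x//I \<rightarrow> I\<close>.\<close>

definition matching_diagram ::
  "('i, 'j) cat \<Rightarrow> ('i, 'j, 'o, 'a) fnctr \<Rightarrow> 'i \<Rightarrow> ('j, 'j \<times> 'j \<times> 'j, 'o, 'a) fnctr" where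
  "matching_diagram I A x =
     \<lparr>Fob = (\<lambda>f \<in> Ob (strict_coslice I x). Fob A (Cod I f)),
      Far = (\<lambda>(f, k, g) \<in> Ar (strict_coslice I x). Far A k)\<rparr>"

definition has_matching_object ::
  "('o, 'a) cat \<Rightarrow> ('i, 'j) cat \<Rightarrow> ('i, 'j, 'o, 'a) fnctr \<Rightarrow> 'i \<Rightarrow> bool" where
  "has_matching_object C I A x \<longleftrightarrow> has_limit C (strict_coslice I x) (matching_diagram I A x)"

definition matching_object ::
  "('o, 'a) cat \<Rightarrow> ('i, 'j) cat \<Rightarrow> ('i, 'j, 'o, 'a) fnctr \<Rightarrow> 'i \<Rightarrow> 'o" where
  "matching_object C I A x = lim_ob C (strict_coslice I x) (matching_diagram I A x)"

text \<open>\<open>matching_map\<close> is the canonical map \<open>A\<^sub>x \<rightarrow> M\<^sub>x A\<close>: the component of its cone at an object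
  \<open>f : x \<rightarrow> y\<close> of \<open>x//I\<close> is \<open>A\<^sub>f\<close>.  \<open>matching_trans\<close> is \<open>M\<^sub>x \<alpha> : M\<^sub>x A \<rightarrow> M\<^sub>x B\<close>.\<close>

definition matching_map ::
  "('o, 'a) cat \<Rightarrow> ('i, 'j) cat \<Rightarrow> ('i, 'j, 'o, 'a) fnctr \<Rightarrow> 'i \<Rightarrow> 'a" where
  "matching_map C I A x =
     lim_induced C (strict_coslice I x) (matching_diagram I A x) (Fob A x) (Far A)"

definition matching_trans ::
  "('o, 'a) cat \<Rightarrow> ('i, 'j) cat \<Rightarrow> ('i, 'j, 'o, 'a) ntrans \<Rightarrow> 'i \<Rightarrow> 'a" where
  "matching_trans C I = (\<lambda>(A, \<alpha>, B) x.
     lim_map C (strict_coslice I x)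
       (matching_diagram I A x, \<lambda>f \<in> Ob (strict_coslice I x). \<alpha> (Cod I f), matching_diagram I B x))"

definition reedy_fibrant ::
  "('o, 'a) cat \<Rightarrow> 'a set \<Rightarrow> ('i, 'j) cat \<Rightarrow> ('i, 'j, 'o, 'a) fnctr \<Rightarrow> bool" where
  "reedy_fibrant C F I A \<longleftrightarrow> A \<in> Ob (functor_cat I C) \<and>
     (\<forall>x \<in> Ob I. has_matching_object C I A x \<and> matching_map C I A x \<in> F)"

definition reedy_fibration ::
  "('o, 'a) cat \<Rightarrow> 'a set \<Rightarrow> ('i, 'j) cat \<Rightarrow> ('i, 'j, 'o, 'a) ntrans \<Rightarrow> bool" where
  "reedy_fibration C F I = (\<lambda>(A, \<alpha>, B). (A, \<alpha>, B) \<in> Ar (functor_cat I C) \<and>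
     (\<forall>x \<in> Ob I.
        has_matching_object C I A x \<and> has_matching_object C I B x \<and>
        has_pullback C (matching_trans C I (A, \<alpha>, B) x) (matching_map C I B x) \<and>
        pb_induced C (matching_trans C I (A, \<alpha>, B) x) (matching_map C I B x)
          (matching_map C I A x) (\<alpha> x) \<in> F))"

definition reedy_acyclic_cofibration ::
  "('o, 'a) cat \<Rightarrow> 'a set \<Rightarrow> ('i, 'j) cat \<Rightarrow> ('i, 'j, 'o, 'a) ntrans \<Rightarrow> bool" where
  "reedy_acyclic_cofibration C F I = (\<lambda>(A, \<alpha>, B). (A, \<alpha>, B) \<in> Ar (functor_cat I C) \<and>
     (\<forall>x \<in> Ob I. acyclic_cofibration C F (\<alpha> x)))"

definition levelwise_equivalence ::
  "('o, 'a) cat \<Rightarrow> 'a set \<Rightarrow> ('i, 'j) cat \<Rightarrow> ('i, 'j, 'o, 'a) ntrans \<Rightarrow> bool" where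
  "levelwise_equivalence C F I = (\<lambda>(A, \<alpha>, B). (A, \<alpha>, B) \<in> Ar (functor_cat I C) \<and>
     (\<forall>x \<in> Ob I. is_equivalence C F (\<alpha> x)))"

text \<open>The category \<open>(C\<^sup>I)\<^sub>f\<close> of Reedy fibrant diagrams.\<close>

definition reedy_cat ::
  "('o, 'a) cat \<Rightarrow> 'a set \<Rightarrow> ('i, 'j) cat \<Rightarrow>
   (('i, 'j, 'o, 'a) fnctr, ('i, 'j, 'o, 'a) ntrans) cat" where
  "reedy_cat C F I = full_subcategory (functor_cat I C) {A. reedy_fibrant C F I A}"

definition reedy_fibrations ::
  "('o, 'a) cat \<Rightarrow> 'a set \<Rightarrow> ('i, 'j) cat \<Rightarrow> ('i, 'j, 'o, 'a) ntrans set" where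
  "reedy_fibrations C F I = {f \<in> Ar (reedy_cat C F I). reedy_fibration C F I f}"

definition has_reedy_limits :: "('o, 'a) cat \<Rightarrow> 'a set \<Rightarrow> ('i, 'j) cat \<Rightarrow> bool" where
  "has_reedy_limits C F J \<longleftrightarrow>
     (\<forall>A. reedy_fibrant C F J A \<longrightarrow> has_limit C J A \<and> fibrant C F (lim_ob C J A)) \<and>
     (\<forall>f \<in> Ar (reedy_cat C F J).
        (reedy_fibration C F J f \<longrightarrow> lim_map C J f \<in> F) \<and>
        (levelwise_equivalence C F J f \<longrightarrow> is_equivalence C F (lim_map C J f)) \<and>
        (reedy_acyclic_cofibration C F J f \<longrightarrow> acyclic_cofibration C F (lim_map C J f)))"

definition admissible :: "('o, 'a) cat \<Rightarrow> 'a set \<Rightarrow> ('i, 'j) cat \<Rightarrow> bool" where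
  "admissible C F I \<longleftrightarrow> (\<forall>x \<in> Ob I. has_reedy_limits C F (strict_coslice I x))"

end

theory Submission
  imports Defs
begin

text \<open>
  Everything is built one object of \<^term>\<open>I\<close> at a time, by well-founded recursion. The key is the
  relative matching object \<open>N = M\<^sub>x A \<times>\<^bsub>M\<^sub>x B\<^esub> B\<^sub>x\<close> of a transformation \<open>A \<rightarrow> B\<close>, handled by its universal
  property: a map into it is a compatible family of maps to \<open>B\<^sub>x\<close> and to the \<open>A\<^sub>y\<close> for nonidentity \<open>x \<rightarrow> y\<close>.
  Restricting a Reedy fibration to \<open>x//I\<close> gives a Reedy fibration, so by admissibility \<open>M\<^sub>x A \<rightarrow> M\<^sub>x B\<close> is a
  fibration; hence \<open>N\<close> exists, \<open>N \<rightarrow> B\<^sub>x\<close> is a fibration, and Reedy fibrations are levelwise fibrations.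

  Pullbacks are levelwise. A factorization is obtained by factoring \<open>A\<^sub>x \<rightarrow> N\<close> at each stage, and lifting a
  levelwise acyclic cofibration against a Reedy fibration is a lifting problem against \<open>X\<^sub>x \<rightarrow> N\<close> at each
  stage; with the retract argument, the acyclic cofibrations are exactly the levelwise ones. For
  fibrations \<open>E \<rightarrow> A \<rightarrow> B\<close>, the dependent product \<open>P\<close> is given at \<open>x\<close> by the dependent product in \<open>C\<close>, along
  the projection \<open>A\<^sub>x \<times>\<^bsub>B\<^sub>x\<^esub> N \<rightarrow> N\<close> for \<open>P \<rightarrow> B\<close>, of a pullback of the map from \<open>E\<^sub>x\<close> to its relative matching object
  over \<open>A\<close>.
\<close>

subsection \<open>Categories and pullbacks\<close>

text \<open>Limits and pullbacks are chosen by \<open>SOME\<close> and induced maps named by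
  \<open>THE\<close>, while a diagram under construction is not yet a functor. Hence the relational
  notions \<open>mlim\<close> and \<open>rlim\<close>, which use only the data of the source diagram
  below \<open>x\<close>, the pointwise forms \<open>good_at\<close> and \<open>nat_at\<close> of
  functoriality and naturality, and lemmas showing independence of the choice of limit or pullback.
  The dependent product is the delicate construction. Its value at \<open>x\<close> can be formed
  only because the evaluation maps below \<open>x\<close> are compatible, and since the values come
  from mere existence statements, their universal property must be recorded at each stage along with
  them. The adjunction is therefore recast as an evaluation map with unique transposes, a form that
  can be stated one object at a time and survives a change of pullbacks. The levelwise description
  of acyclic cofibrations is what reduces their stability under base change to the same axiom of
  \<open>C\<close> at each object.\<close>

context category
begin

lemma homI [intro?]: "f \<in> Ar C \<Longrightarrow> Dom C f = x \<Longrightarrow> Cod C f = y \<Longrightarrow> f \<in> hom C x y"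
  by (simp add: hom_def)

lemma cmp_simps [simp]:
  assumes "f \<in> Ar C" "g \<in> Ar C" "Dom C g = Cod C f"
  shows "g \<cdot> f \<in> Ar C" "Dom C (g \<cdot> f) = Dom C f" "Cod C (g \<cdot> f) = Cod C g"
  using cmp_hom[of f "Dom C f" "Cod C f" g "Cod C g"] assms by (auto simp: hom_def)

lemma ide_simps [simp]:
  assumes "x \<in> Ob C"
  shows "Ide C x \<in> Ar C" "Dom C (Ide C x) = x" "Cod C (Ide C x) = x"
  using ide_hom[OF assms] by (auto simp: hom_def)

lemma dom_ob' [simp]: "f \<in> Ar C \<Longrightarrow> Dom C f \<in> Ob C"
  and cod_ob' [simp]: "f \<in> Ar C \<Longrightarrow> Cod C f \<in> Ob C"
  by (auto intro: dom_ob cod_ob)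

lemma ide_right [simp]: "f \<in> Ar C \<Longrightarrow> Dom C f = x \<Longrightarrow> f \<cdot> Ide C x = f"
  using cmp_ide_right[of f x "Cod C f"] by (auto simp: hom_def)

lemma ide_left [simp]: "f \<in> Ar C \<Longrightarrow> Cod C f = x \<Longrightarrow> Ide C x \<cdot> f = f"
  using cmp_ide_left[of f "Dom C f" x] by (auto simp: hom_def)

lemma assoc [simp]:
  "f \<in> Ar C \<Longrightarrow> g \<in> Ar C \<Longrightarrow> h \<in> Ar C \<Longrightarrow> Dom C g = Cod C f \<Longrightarrow> Dom C h = Cod C g \<Longrightarrow>
   (h \<cdot> g) \<cdot> f = h \<cdot> (g \<cdot> f)"
  using cmp_assoc[of f "Dom C f" "Cod C f" g "Cod C g" h "Cod C h"] by (auto simp: hom_def)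

text \<open>Lets the simplifier use an equation between composites inside a right-nested composite.\<close>

lemma cmp_ext:
  "g \<cdot> f = k \<Longrightarrow> f \<in> Ar C \<Longrightarrow> g \<in> Ar C \<Longrightarrow> Dom C g = Cod C f \<Longrightarrow> w \<in> Ar C \<Longrightarrow> Cod C w = Dom C f \<Longrightarrow>
   g \<cdot> (f \<cdot> w) = k \<cdot> w"
  using assoc by metis

lemma pullbackD:
  assumes "is_pullback C f g p q"
  shows "f \<in> Ar C" "g \<in> Ar C" "p \<in> Ar C" "q \<in> Ar C" "Cod C g = Cod C f"
    "Dom C q = Dom C p" "Cod C p = Dom C f" "Cod C q = Dom C g" "f \<cdot> p = g \<cdot> q"
  using assms unfolding is_pullback_def by auto

lemma pullback_ex1:
  assumes "is_pullback C f g p q" "u \<in> Ar C" "v \<in> Ar C" "Dom C v = Dom C u"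
    "Cod C u = Dom C f" "Cod C v = Dom C g" "f \<cdot> u = g \<cdot> v"
  shows "\<exists>!h. h \<in> hom C (Dom C u) (Dom C p) \<and> p \<cdot> h = u \<and> q \<cdot> h = v"
proof -
  have "\<forall>z. \<forall>u \<in> hom C z (Dom C f). \<forall>v \<in> hom C z (Dom C g). f \<cdot> u = g \<cdot> v \<longrightarrow>
        (\<exists>!h. h \<in> hom C z (Dom C p) \<and> p \<cdot> h = u \<and> q \<cdot> h = v)"
    using assms(1) unfolding is_pullback_def by metis
  from this[rule_format, of u "Dom C u" v] show ?thesis
    using assms by (simp add: hom_def)
qed

lemma pullback_obtain:
  assumes "is_pullback C f g p q" "u \<in> Ar C" "v \<in> Ar C" "Dom C v = Dom C u"
    "Cod C u = Dom C f" "Cod C v = Dom C g" "f \<cdot> u = g \<cdot> v"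
  obtains h where "h \<in> Ar C" "Dom C h = Dom C u" "Cod C h = Dom C p" "p \<cdot> h = u" "q \<cdot> h = v"
proof -
  show thesis using that pullback_ex1[OF assms] by (auto simp: hom_def)
qed

text \<open>Equality of the domains is not assumed: both are read off from the common composite with
  \<open>p\<close>.\<close>

lemma pullback_unique:
  assumes "is_pullback C f g p q" "h \<in> Ar C" "h' \<in> Ar C" "Cod C h = Dom C p" "Cod C h' = Dom C p"
    "p \<cdot> h = p \<cdot> h'" "q \<cdot> h = q \<cdot> h'"
  shows "h = h'"
proof -
  note P = pullbackD[OF assms(1)]
  have d: "Dom C h = Dom C h'"
    using assms(2-6) P(3) cmp_simps(2)[of h p] cmp_simps(2)[of h' p] by metis
  have "f \<cdot> (p \<cdot> h) = g \<cdot> (q \<cdot> h)"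
    using assms P P(9)[THEN cmp_ext] by simp
  moreover have "p \<cdot> h \<in> hom C (Dom C h) (Dom C f)" "q \<cdot> h \<in> hom C (Dom C h) (Dom C g)"
    using assms P d by (auto intro!: homI)
  ultimately have "\<exists>!k. k \<in> hom C (Dom C h) (Dom C p) \<and> p \<cdot> k = p \<cdot> h \<and> q \<cdot> k = q \<cdot> h"
    using assms(1) unfolding is_pullback_def by blast
  then show ?thesis using assms d by (auto simp: hom_def)
qed

lemma pullbackI:
  assumes "f \<in> Ar C" "g \<in> Ar C" "p \<in> Ar C" "q \<in> Ar C" "Cod C g = Cod C f"
    "Dom C q = Dom C p" "Cod C p = Dom C f" "Cod C q = Dom C g" "f \<cdot> p = g \<cdot> q"
    and ex: "\<And>u v. u \<in> Ar C \<Longrightarrow> v \<in> Ar C \<Longrightarrow> Dom C v = Dom C u \<Longrightarrow> Cod C u = Dom C f \<Longrightarrow>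
      Cod C v = Dom C g \<Longrightarrow> f \<cdot> u = g \<cdot> v \<Longrightarrow>
      \<exists>h. h \<in> Ar C \<and> Dom C h = Dom C u \<and> Cod C h = Dom C p \<and> p \<cdot> h = u \<and> q \<cdot> h = v"
    and un: "\<And>h h'. h \<in> Ar C \<Longrightarrow> h' \<in> Ar C \<Longrightarrow> Dom C h = Dom C h' \<Longrightarrow> Cod C h = Dom C p \<Longrightarrow>
      Cod C h' = Dom C p \<Longrightarrow> p \<cdot> h = p \<cdot> h' \<Longrightarrow> q \<cdot> h = q \<cdot> h' \<Longrightarrow> h = h'"
  shows "is_pullback C f g p q"
  unfolding is_pullback_def
proof (intro conjI allI ballI impI)
  fix z u v assume u: "u \<in> hom C z (Dom C f)" and v: "v \<in> hom C z (Dom C g)" and e: "f \<cdot> u = g \<cdot> v"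
  then obtain h where "h \<in> Ar C" "Dom C h = z" "Cod C h = Dom C p" "p \<cdot> h = u" "q \<cdot> h = v"
    using ex[of u v] by (auto simp: hom_def)
  then show "\<exists>!h. h \<in> hom C z (Dom C p) \<and> p \<cdot> h = u \<and> q \<cdot> h = v"
    using un by (intro ex1I[of _ h]) (auto simp: hom_def)
qed (use assms in auto)

lemma pullback_sym:
  assumes P: "is_pullback C f g p q"
  shows "is_pullback C g f q p"
proof (rule pullbackI)
  fix u v assume "u \<in> Ar C" "v \<in> Ar C" "Dom C v = Dom C u" "Cod C u = Dom C g" "Cod C v = Dom C f" "g \<cdot> u = f \<cdot> v"
  then obtain h where "h \<in> Ar C" "Dom C h = Dom C v" "Cod C h = Dom C p" "p \<cdot> h = v" "q \<cdot> h = u"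
    using pullback_obtain[OF P, of v u] by metis
  then show "\<exists>h. h \<in> Ar C \<and> Dom C h = Dom C u \<and> Cod C h = Dom C q \<and> q \<cdot> h = u \<and> p \<cdot> h = v"
    using \<open>Dom C v = Dom C u\<close> pullbackD[OF P] by auto
next
  fix h h' assume "h \<in> Ar C" "h' \<in> Ar C" "Dom C h = Dom C h'" "Cod C h = Dom C q" "Cod C h' = Dom C q"
    "q \<cdot> h = q \<cdot> h'" "p \<cdot> h = p \<cdot> h'"
  then show "h = h'"
    using pullback_unique[OF P, of h h'] pullbackD[OF P] by simp
qed (use pullbackD[OF P] in auto)

lemma pb_is_pullback: "has_pullback C f g \<Longrightarrow> is_pullback C f g (pb_fst C f g) (pb_snd C f g)"
  unfolding has_pullback_def pb_fst_def pb_snd_def pb_cone_def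
  by (rule someI2_ex[where P="\<lambda>(p, q). is_pullback C f g p q"]) auto

lemma pb_induced:
  assumes "has_pullback C f g" "u \<in> Ar C" "v \<in> Ar C" "Dom C v = Dom C u"
    "Cod C u = Dom C f" "Cod C v = Dom C g" "f \<cdot> u = g \<cdot> v"
  shows "pb_induced C f g u v \<in> Ar C" "Dom C (pb_induced C f g u v) = Dom C u"
    "Cod C (pb_induced C f g u v) = Dom C (pb_fst C f g)"
    "pb_fst C f g \<cdot> pb_induced C f g u v = u" "pb_snd C f g \<cdot> pb_induced C f g u v = v"
proof -
  from theI'[OF pullback_ex1[OF pb_is_pullback[OF assms(1)] assms(2-)]] show "pb_induced C f g u v \<in> Ar C" "Dom C (pb_induced C f g u v) = Dom C u"
    "Cod C (pb_induced C f g u v) = Dom C (pb_fst C f g)"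
    "pb_fst C f g \<cdot> pb_induced C f g u v = u" "pb_snd C f g \<cdot> pb_induced C f g u v = v"
    unfolding pb_induced_def[symmetric] by (auto simp: hom_def)
qed

lemma isoI:
  assumes "f \<in> Ar C" "g \<in> Ar C" "Dom C g = Cod C f" "Cod C g = Dom C f"
    "g \<cdot> f = Ide C (Dom C f)" "f \<cdot> g = Ide C (Cod C f)"
  shows "is_iso C f"
  using assms unfolding is_iso_def by (auto simp: hom_def)

lemma iso_obtain:
  assumes "is_iso C f"
  obtains g where "f \<in> Ar C" "g \<in> Ar C" "Dom C g = Cod C f" "Cod C g = Dom C f"
    "g \<cdot> f = Ide C (Dom C f)" "f \<cdot> g = Ide C (Cod C f)" "is_iso C g"
proof -
  from assms obtain g where g: "f \<in> Ar C" "g \<in> Ar C" "Dom C g = Cod C f" "Cod C g = Dom C f"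
    "g \<cdot> f = Ide C (Dom C f)" "f \<cdot> g = Ide C (Cod C f)"
    unfolding is_iso_def by (auto simp: hom_def)
  then have "is_iso C g" by (intro isoI[of g f]) auto
  with g that show thesis by blast
qed

lemma ide_iso: "x \<in> Ob C \<Longrightarrow> is_iso C (Ide C x)"
  by (rule isoI[of _ "Ide C x"]) auto

lemma pullback_iso:
  assumes P: "is_pullback C f g p q" and Q: "is_pullback C f g p' q'"
  obtains i where "is_iso C i" "i \<in> Ar C" "Dom C i = Dom C p" "Cod C i = Dom C p'" "p' \<cdot> i = p" "q' \<cdot> i = q"
proof -
  note p = pullbackD[OF P] and q = pullbackD[OF Q]
  obtain i where i: "i \<in> Ar C" "Dom C i = Dom C p" "Cod C i = Dom C p'" "p' \<cdot> i = p" "q' \<cdot> i = q"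
    using pullback_obtain[OF Q, of p q] p by auto
  obtain j where j: "j \<in> Ar C" "Dom C j = Dom C p'" "Cod C j = Dom C p" "p \<cdot> j = p'" "q \<cdot> j = q'"
    using pullback_obtain[OF P, of p' q'] q by auto
  have "j \<cdot> i = Ide C (Dom C p)"
    by (rule pullback_unique[OF P])
      (use p q i j j(4,5)[THEN cmp_ext] in simp_all)
  moreover have "i \<cdot> j = Ide C (Dom C p')"
    by (rule pullback_unique[OF Q])
      (use p q i j i(4,5)[THEN cmp_ext] in simp_all)
  ultimately have "is_iso C i"
    using i j by (intro isoI[of i j]) auto
  with i that show thesis by blast
qed

lemma pullback_cmp_iso:
  assumes P: "is_pullback C f g p q" and i: "is_iso C i" "Cod C i = Dom C p"
  shows "is_pullback C f g (p \<cdot> i) (q \<cdot> i)"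
proof -
  note p = pullbackD[OF P]
  obtain j where j: "i \<in> Ar C" "j \<in> Ar C" "Dom C j = Cod C i" "Cod C j = Dom C i"
    "j \<cdot> i = Ide C (Dom C i)" "i \<cdot> j = Ide C (Cod C i)"
    using iso_obtain[OF i(1)] .
  show ?thesis
  proof (rule pullbackI)
    fix u v assume u: "u \<in> Ar C" "v \<in> Ar C" "Dom C v = Dom C u" "Cod C u = Dom C f"
      "Cod C v = Dom C g" "f \<cdot> u = g \<cdot> v"
    obtain h where h: "h \<in> Ar C" "Dom C h = Dom C u" "Cod C h = Dom C p" "p \<cdot> h = u" "q \<cdot> h = v"
      using pullback_obtain[OF P u] .
    show "\<exists>h. h \<in> Ar C \<and> Dom C h = Dom C u \<and> Cod C h = Dom C (p \<cdot> i) \<and> (p \<cdot> i) \<cdot> h = u \<and> (q \<cdot> i) \<cdot> h = v"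
      using h j i p j(6)[THEN cmp_ext] by (intro exI[of _ "j \<cdot> h"]) simp
  next
    fix h h' assume h: "h \<in> Ar C" "h' \<in> Ar C" "Dom C h = Dom C h'" "Cod C h = Dom C (p \<cdot> i)"
      "Cod C h' = Dom C (p \<cdot> i)" "(p \<cdot> i) \<cdot> h = (p \<cdot> i) \<cdot> h'" "(q \<cdot> i) \<cdot> h = (q \<cdot> i) \<cdot> h'"
    then have "i \<cdot> h = i \<cdot> h'"
      using i j p by (intro pullback_unique[OF P, of "i \<cdot> h" "i \<cdot> h'"]; simp)
    then have "j \<cdot> (i \<cdot> h) = j \<cdot> (i \<cdot> h')" by simp
    then show "h = h'"
      using h i j p j(5)[THEN cmp_ext] by simp
  qed (use p i j p(9)[THEN cmp_ext] in simp_all)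
qed

end

text \<open>The cancellation half of the pasting law: the outer rectangle and one square are
  pullbacks, hence so is the other square.\<close>

lemma (in category) pullback_paste:
  assumes K: "is_pullback C g b ka kb" and S: "is_pullback C g (b \<cdot> t) sa st"
    and t: "t \<in> Ar C" "Cod C t = Dom C b"
    and k: "k \<in> Ar C" "Dom C k = Dom C sa" "Cod C k = Dom C ka" "ka \<cdot> k = sa" "kb \<cdot> k = t \<cdot> st"
  shows "is_pullback C kb t k st"
proof -
  note K' = pullbackD[OF K] and S' = pullbackD[OF S]
  show ?thesis
  proof (rule pullbackI)
    fix u v assume u: "u \<in> Ar C" "v \<in> Ar C" "Dom C v = Dom C u" "Cod C u = Dom C kb"
      "Cod C v = Dom C t" "kb \<cdot> u = t \<cdot> v"
    have "g \<cdot> (ka \<cdot> u) = (b \<cdot> t) \<cdot> v"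
      using u t K' K'(9)[THEN cmp_ext] by simp
    then obtain h where h: "h \<in> Ar C" "Dom C h = Dom C u" "Cod C h = Dom C sa" "sa \<cdot> h = ka \<cdot> u" "st \<cdot> h = v"
      using pullback_obtain[OF S, of "ka \<cdot> u" v] u t K' by auto
    have "k \<cdot> h = u"
      by (rule pullback_unique[OF K])
        (use h u k K' S' t k(4,5)[THEN cmp_ext] in simp_all)
    then show "\<exists>h. h \<in> Ar C \<and> Dom C h = Dom C u \<and> Cod C h = Dom C k \<and> k \<cdot> h = u \<and> st \<cdot> h = v"
      using h k by auto
  next
    fix h h' assume h: "h \<in> Ar C" "h' \<in> Ar C" "Dom C h = Dom C h'" "Cod C h = Dom C k"
      "Cod C h' = Dom C k" "k \<cdot> h = k \<cdot> h'" "st \<cdot> h = st \<cdot> h'"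
    have "ka \<cdot> (k \<cdot> h) = sa \<cdot> h" "ka \<cdot> (k \<cdot> h') = sa \<cdot> h'"
      by (rule k(4)[THEN cmp_ext]; use h k K' in simp)+
    then have "sa \<cdot> h = sa \<cdot> h'" using h(6) by simp
    then show "h = h'"
      using pullback_unique[OF S, of h h'] h k by simp
  qed (use k t K' S' in simp_all)
qed

subsection \<open>Acyclic cofibrations and dependent products\<close>

lemma (in category) acofI:
  assumes "i \<in> Ar C"
    and "\<And>p u v. p \<in> F \<Longrightarrow> u \<in> Ar C \<Longrightarrow> v \<in> Ar C \<Longrightarrow> Dom C u = Dom C i \<Longrightarrow> Cod C u = Dom C p \<Longrightarrow>
      Dom C v = Cod C i \<Longrightarrow> Cod C v = Cod C p \<Longrightarrow> p \<cdot> u = v \<cdot> i \<Longrightarrow>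
      \<exists>h. h \<in> Ar C \<and> Dom C h = Cod C i \<and> Cod C h = Dom C p \<and> h \<cdot> i = u \<and> p \<cdot> h = v"
  shows "acyclic_cofibration C F i"
  unfolding acyclic_cofibration_def
proof (intro conjI ballI impI)
  fix p u v assume "p \<in> F" "u \<in> hom C (Dom C i) (Dom C p)" "v \<in> hom C (Cod C i) (Cod C p)" "p \<cdot> u = v \<cdot> i"
  then have "\<exists>h. h \<in> Ar C \<and> Dom C h = Cod C i \<and> Cod C h = Dom C p \<and> h \<cdot> i = u \<and> p \<cdot> h = v"
    using assms(2)[of p u v] by (simp add: hom_def)
  then show "\<exists>h\<in>hom C (Cod C i) (Dom C p). h \<cdot> i = u \<and> p \<cdot> h = v"
    by (auto simp: hom_def)
qed fact

lemma acof_Ar: "acyclic_cofibration C F i \<Longrightarrow> i \<in> Ar C"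
  by (simp add: acyclic_cofibration_def)

lemma acof_lift:
  fixes C (structure)
  assumes "acyclic_cofibration C F i" "p \<in> F" "u \<in> Ar C" "v \<in> Ar C" "Dom C u = Dom C i" "Cod C u = Dom C p"
    "Dom C v = Cod C i" "Cod C v = Cod C p" "p \<cdot> u = v \<cdot> i"
  obtains h where "h \<in> Ar C" "Dom C h = Cod C i" "Cod C h = Dom C p" "h \<cdot> i = u" "p \<cdot> h = v"
proof -
  have "\<forall>p\<in>F. \<forall>u\<in>hom C (Dom C i) (Dom C p). \<forall>v\<in>hom C (Cod C i) (Cod C p). p \<cdot> u = v \<cdot> i \<longrightarrow>
        (\<exists>h\<in>hom C (Cod C i) (Dom C p). h \<cdot> i = u \<and> p \<cdot> h = v)"
    using assms(1) unfolding acyclic_cofibration_def by metis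
  from this[rule_format, of p u v] have "\<exists>h\<in>hom C (Cod C i) (Dom C p). h \<cdot> i = u \<and> p \<cdot> h = v"
    using assms(2-) by (simp add: hom_def)
  then show thesis using that by (auto simp: hom_def)
qed

lemma (in category) acof_iso:
  assumes i: "is_iso C i" and F: "F \<subseteq> Ar C"
  shows "acyclic_cofibration C F i"
proof -
  obtain j where j: "i \<in> Ar C" "j \<in> Ar C" "Dom C j = Cod C i" "Cod C j = Dom C i"
    "j \<cdot> i = Ide C (Dom C i)" "i \<cdot> j = Ide C (Cod C i)"
    using iso_obtain[OF i] .
  show ?thesis
  proof (rule acofI)
    fix p u v assume a: "p \<in> F" "u \<in> Ar C" "v \<in> Ar C" "Dom C u = Dom C i" "Cod C u = Dom C p"
      "Dom C v = Cod C i" "Cod C v = Cod C p" "p \<cdot> u = v \<cdot> i"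
    then have "p \<in> Ar C" using F by auto
    then show "\<exists>h. h \<in> Ar C \<and> Dom C h = Cod C i \<and> Cod C h = Dom C p \<and> h \<cdot> i = u \<and> p \<cdot> h = v"
      using a j a(8)[THEN cmp_ext] by (intro exI[of _ "u \<cdot> j"]) simp
  qed fact
qed

lemma (in category) acof_cmp:
  assumes i: "acyclic_cofibration C F i" and j: "acyclic_cofibration C F j" and d: "Dom C j = Cod C i"
    and F: "F \<subseteq> Ar C"
  shows "acyclic_cofibration C F (j \<cdot> i)"
proof (rule acofI)
  note ij = acof_Ar[OF i] acof_Ar[OF j]
  show "j \<cdot> i \<in> Ar C" using ij d by simp
  fix p u v assume a: "p \<in> F" "u \<in> Ar C" "v \<in> Ar C" "Dom C u = Dom C (j \<cdot> i)" "Cod C u = Dom C p"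
      "Dom C v = Cod C (j \<cdot> i)" "Cod C v = Cod C p" "p \<cdot> u = v \<cdot> (j \<cdot> i)"
  have p: "p \<in> Ar C" using a F by auto
  obtain h where h: "h \<in> Ar C" "Dom C h = Cod C i" "Cod C h = Dom C p" "h \<cdot> i = u" "p \<cdot> h = v \<cdot> j"
    using acof_lift[OF i, of p u "v \<cdot> j"] a ij d p by auto
  obtain k where k: "k \<in> Ar C" "Dom C k = Cod C j" "Cod C k = Dom C p" "k \<cdot> j = h" "p \<cdot> k = v"
    using acof_lift[OF j, of p h v] a ij d h p by auto
  show "\<exists>h. h \<in> Ar C \<and> Dom C h = Cod C (j \<cdot> i) \<and> Cod C h = Dom C p \<and> h \<cdot> (j \<cdot> i) = u \<and> p \<cdot> h = v"
    using a ij d h k k(4)[THEN cmp_ext] by (intro exI[of _ k]) simp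
qed

text \<open>Dependent products, with the pullbacks left to choice: \<^term>\<open>qa\<close> and \<^term>\<open>qr\<close> exhibit
  the pullback of \<^term>\<open>r\<close> along \<^term>\<open>g\<close>, and \<^term>\<open>ev\<close> is the evaluation map.\<close>

definition Pi_map :: "('o, 'a) cat \<Rightarrow> 'a \<Rightarrow> 'a \<Rightarrow> 'a \<Rightarrow> 'a \<Rightarrow> 'a \<Rightarrow> 'a \<Rightarrow> 'a \<Rightarrow> 'a \<Rightarrow> 'a \<Rightarrow> bool" where
  "Pi_map C r qa qr ev z sa sz m h \<longleftrightarrow> h \<in> Ar C \<and> Dom C h = Dom C z \<and> Cod C h = Dom C r \<and>
     r \<cdot>\<^bsub>C\<^esub> h = z \<and>
     (\<forall>w \<in> Ar C. Dom C w = Dom C sa \<and> Cod C w = Dom C qa \<and> qa \<cdot>\<^bsub>C\<^esub> w = sa \<and>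
        qr \<cdot>\<^bsub>C\<^esub> w = h \<cdot>\<^bsub>C\<^esub> sz \<longrightarrow> ev \<cdot>\<^bsub>C\<^esub> w = m)"

definition is_Pi :: "('o, 'a) cat \<Rightarrow> 'a \<Rightarrow> 'a \<Rightarrow> 'a \<Rightarrow> 'a \<Rightarrow> 'a \<Rightarrow> 'a \<Rightarrow> bool" where
  "is_Pi C g p r qa qr ev \<longleftrightarrow> is_pullback C g r qa qr \<and>
     ev \<in> Ar C \<and> Dom C ev = Dom C qa \<and> Cod C ev = Dom C p \<and> p \<cdot>\<^bsub>C\<^esub> ev = qa \<and>
     (\<forall>z sa sz m. is_pullback C g z sa sz \<and>
        m \<in> Ar C \<and> Dom C m = Dom C sa \<and> Cod C m = Dom C p \<and> p \<cdot>\<^bsub>C\<^esub> m = sa \<longrightarrow>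
        (\<exists>!h. Pi_map C r qa qr ev z sa sz m h))"

context category
begin

text \<open>The isomorphisms carry test maps for one pair of pullbacks to test maps for the other:
  \<open>w\<close> becomes \<open>i \<cdot> (w \<cdot> j')\<close> with \<open>j'\<close> inverse to
  \<open>j\<close>. So being a transpose does not depend on the pullbacks used to express
  it.\<close>

lemma Pi_map_change:
  assumes g: "is_pullback C g r qa qr" and s: "is_pullback C g z sa sz" and ev: "ev \<in> Ar C" "Dom C ev = Dom C qa"
    and m: "m \<in> Ar C" "Dom C m = Dom C sa"
    and i: "is_iso C i" "Cod C i = Dom C qa" and j: "is_iso C j" "Cod C j = Dom C sa"
    and h: "Pi_map C r qa qr ev z sa sz m h"
  shows "Pi_map C r (qa \<cdot> i) (qr \<cdot> i) (ev \<cdot> i) z (sa \<cdot> j) (sz \<cdot> j) (m \<cdot> j) h"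
proof -
  note G = pullbackD[OF g] and S = pullbackD[OF s]
  obtain i' where i': "i \<in> Ar C" "i' \<in> Ar C" "Dom C i' = Cod C i" "Cod C i' = Dom C i"
    "i' \<cdot> i = Ide C (Dom C i)" "i \<cdot> i' = Ide C (Cod C i)"
    using iso_obtain[OF i(1)] .
  obtain j' where j': "j \<in> Ar C" "j' \<in> Ar C" "Dom C j' = Cod C j" "Cod C j' = Dom C j"
    "j' \<cdot> j = Ide C (Dom C j)" "j \<cdot> j' = Ide C (Cod C j)"
    using iso_obtain[OF j(1)] .
  have h': "h \<in> Ar C" "Dom C h = Dom C z" "Cod C h = Dom C r" "r \<cdot> h = z"
    and H: "\<And>w. w \<in> Ar C \<Longrightarrow> Dom C w = Dom C sa \<Longrightarrow> Cod C w = Dom C qa \<Longrightarrow> qa \<cdot> w = sa \<Longrightarrow>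
        qr \<cdot> w = h \<cdot> sz \<Longrightarrow> ev \<cdot> w = m"
    using h unfolding Pi_map_def by blast+
  have "(ev \<cdot> i) \<cdot> w = m \<cdot> j" if w: "w \<in> Ar C" "Dom C w = Dom C (sa \<cdot> j)" "Cod C w = Dom C (qa \<cdot> i)"
     "(qa \<cdot> i) \<cdot> w = sa \<cdot> j" "(qr \<cdot> i) \<cdot> w = h \<cdot> (sz \<cdot> j)" for w
  proof -
    have w': "qa \<cdot> (i \<cdot> w) = sa \<cdot> j" "qr \<cdot> (i \<cdot> w) = h \<cdot> (sz \<cdot> j)"
      using w G S i i' j j' h' by simp_all
    have 1: "(qa \<cdot> (i \<cdot> w)) \<cdot> j' = (sa \<cdot> j) \<cdot> j'" "(qr \<cdot> (i \<cdot> w)) \<cdot> j' = (h \<cdot> (sz \<cdot> j)) \<cdot> j'"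
      by (simp_all only: w')
    have "ev \<cdot> (i \<cdot> (w \<cdot> j')) = m"
      by (rule H) (use 1 w G S i i' j j' h' in simp_all)
    then have "(ev \<cdot> (i \<cdot> (w \<cdot> j'))) \<cdot> j = m \<cdot> j" by simp
    then show ?thesis using w G S i i' j j' h' ev m by simp
  qed
  moreover have "Dom C (sa \<cdot> j) = Dom C j" "r \<in> Ar C" using j' S j G by simp_all
  ultimately show ?thesis using h' unfolding Pi_map_def by blast
qed

lemma Pi_map_change_iff:
  assumes g: "is_pullback C g r qa qr" and s: "is_pullback C g z sa sz" and ev: "ev \<in> Ar C" "Dom C ev = Dom C qa"
    and m: "m \<in> Ar C" "Dom C m = Dom C sa"
    and i: "is_iso C i" "Cod C i = Dom C qa" and j: "is_iso C j" "Cod C j = Dom C sa"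
  shows "Pi_map C r (qa \<cdot> i) (qr \<cdot> i) (ev \<cdot> i) z (sa \<cdot> j) (sz \<cdot> j) (m \<cdot> j) h \<longleftrightarrow>
    Pi_map C r qa qr ev z sa sz m h"
proof
  note G = pullbackD[OF g] and S = pullbackD[OF s]
  assume h: "Pi_map C r (qa \<cdot> i) (qr \<cdot> i) (ev \<cdot> i) z (sa \<cdot> j) (sz \<cdot> j) (m \<cdot> j) h"
  obtain i' where i': "i \<in> Ar C" "i' \<in> Ar C" "Dom C i' = Cod C i" "Cod C i' = Dom C i"
    "i' \<cdot> i = Ide C (Dom C i)" "i \<cdot> i' = Ide C (Cod C i)" "is_iso C i'"
    using iso_obtain[OF i(1)] .
  obtain j' where j': "j \<in> Ar C" "j' \<in> Ar C" "Dom C j' = Cod C j" "Cod C j' = Dom C j"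
    "j' \<cdot> j = Ide C (Dom C j)" "j \<cdot> j' = Ide C (Cod C j)" "is_iso C j'"
    using iso_obtain[OF j(1)] .
  have "Pi_map C r ((qa \<cdot> i) \<cdot> i') ((qr \<cdot> i) \<cdot> i') ((ev \<cdot> i) \<cdot> i') z ((sa \<cdot> j) \<cdot> j') ((sz \<cdot> j) \<cdot> j') ((m \<cdot> j) \<cdot> j') h"
    by (rule Pi_map_change[OF pullback_cmp_iso[OF g i] pullback_cmp_iso[OF s j]])
      (use h i i' j j' G S ev m in simp_all)
  then show "Pi_map C r qa qr ev z sa sz m h"
    using i i' j j' G S ev m by simp
qed (rule Pi_map_change[OF assms])

text \<open>One pullback of each \<open>z\<close> suffices: any other is isomorphic to it, and
  \<open>Pi_map_change_iff\<close> carries unique existence across.\<close>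

lemma is_PiI:
  assumes g: "is_pullback C g r qa qr" and ev: "ev \<in> Ar C" "Dom C ev = Dom C qa" "Cod C ev = Dom C p" "p \<cdot> ev = qa"
    and p: "p \<in> Ar C"
    and ex: "\<And>z. z \<in> Ar C \<Longrightarrow> Cod C z = Cod C g \<Longrightarrow> \<exists>sa sz. is_pullback C g z sa sz \<and>
      (\<forall>m \<in> Ar C. Dom C m = Dom C sa \<and> Cod C m = Dom C p \<and> p \<cdot> m = sa \<longrightarrow>
        (\<exists>!h. Pi_map C r qa qr ev z sa sz m h))"
  shows "is_Pi C g p r qa qr ev"
  unfolding is_Pi_def
proof (intro conjI allI impI; (elim conjE)?)
  note G = pullbackD[OF g]
  fix z sa sz m
  assume s: "is_pullback C g z sa sz" and m: "m \<in> Ar C" "Dom C m = Dom C sa" "Cod C m = Dom C p" "p \<cdot> m = sa"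
  note S = pullbackD[OF s]
  obtain ta tz where t: "is_pullback C g z ta tz" and
     T: "\<forall>m \<in> Ar C. Dom C m = Dom C ta \<and> Cod C m = Dom C p \<and> p \<cdot> m = ta \<longrightarrow>
        (\<exists>!h. Pi_map C r qa qr ev z ta tz m h)"
    using ex[of z] S by auto
  obtain j where j: "is_iso C j" "j \<in> Ar C" "Dom C j = Dom C ta" "Cod C j = Dom C sa" "sa \<cdot> j = ta" "sz \<cdot> j = tz"
    using pullback_iso[OF t s] .
  have *: "Pi_map C r qa qr ev z sa sz m h \<longleftrightarrow> Pi_map C r qa qr ev z ta tz (m \<cdot> j) h" for h
    using Pi_map_change_iff[OF g s ev(1,2) m(1,2) ide_iso[of "Dom C qa"] _ j(1), of h] j G ev by simp
  show "\<exists>!h. Pi_map C r qa qr ev z sa sz m h"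
    unfolding * by (rule T[rule_format]) (use m j S p m(4)[THEN cmp_ext] in simp_all)
qed (use assms in auto)

lemma is_PiD:
  assumes "is_Pi C g p r qa qr ev"
  shows "is_pullback C g r qa qr" "ev \<in> Ar C" "Dom C ev = Dom C qa" "Cod C ev = Dom C p" "p \<cdot> ev = qa"
    "is_pullback C g z sa sz \<Longrightarrow> m \<in> Ar C \<Longrightarrow> Dom C m = Dom C sa \<Longrightarrow> Cod C m = Dom C p \<Longrightarrow> p \<cdot> m = sa \<Longrightarrow>
      \<exists>!h. Pi_map C r qa qr ev z sa sz m h"
  using assms unfolding is_Pi_def by blast+

text \<open>Only the source of the evaluation map moves, so the new one is the old one after the
  comparison isomorphism.\<close>

lemma is_Pi_change:
  assumes P: "is_Pi C g p r qa qr ev" and Q: "is_pullback C g r qa' qr'" and p: "p \<in> Ar C"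
  obtains ev' where "is_Pi C g p r qa' qr' ev'"
proof -
  note D = is_PiD[OF P] and Q' = pullbackD[OF Q]
  obtain i where i: "is_iso C i" "i \<in> Ar C" "Dom C i = Dom C qa'" "Cod C i = Dom C qa" "qa \<cdot> i = qa'" "qr \<cdot> i = qr'"
    using pullback_iso[OF Q D(1)] .
  have "is_Pi C g p r qa' qr' (ev \<cdot> i)"
    unfolding is_Pi_def
  proof (intro conjI allI impI; (elim conjE)?)
    fix z sa sz m
    assume s: "is_pullback C g z sa sz" and m: "m \<in> Ar C" "Dom C m = Dom C sa" "Cod C m = Dom C p" "p \<cdot> m = sa"
    note S = pullbackD[OF s]
    have "Pi_map C r qa' qr' (ev \<cdot> i) z sa sz m h \<longleftrightarrow> Pi_map C r qa qr ev z sa sz m h" for h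
      using Pi_map_change_iff[OF D(1) s D(2,3) m(1,2) i(1,4) ide_iso[of "Dom C sa"], of h] S i m by simp
    then show "\<exists>!h. Pi_map C r qa' qr' (ev \<cdot> i) z sa sz m h"
      using D(6)[OF s m] by simp
  qed (use Q i D p D(5)[THEN cmp_ext] in simp_all)
  then show thesis by (rule that)
qed

end

section \<open>Dependent products and the partial right adjoint of pullback\<close>

lemma bij_betw_iff_ex1: "bij_betw f A B \<longleftrightarrow> (\<forall>a \<in> A. f a \<in> B) \<and> (\<forall>b \<in> B. \<exists>!a. a \<in> A \<and> f a = b)"
proof
  assume "(\<forall>a \<in> A. f a \<in> B) \<and> (\<forall>b \<in> B. \<exists>!a. a \<in> A \<and> f a = b)"
  then show "bij_betw f A B"
    unfolding bij_betw_def inj_on_def image_def by blast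
qed (auto simp: bij_betw_def inj_on_def)

context category
begin

lemma slice_hom:
  "w \<in> hom (slice C b) z r \<longleftrightarrow> (\<exists>k. w = (z, k, r) \<and> z \<in> Ar C \<and> r \<in> Ar C \<and> Cod C z = b \<and> Cod C r = b \<and>
     k \<in> Ar C \<and> Dom C k = Dom C z \<and> Cod C k = Dom C r \<and> r \<cdot> k = z)"
  by (cases w) (auto simp: slice_def hom_def)

lemma slice_Ob: "z \<in> Ob (slice C b) \<longleftrightarrow> z \<in> Ar C \<and> Cod C z = b"
  by (auto simp: slice_def)

lemma slice_cmp: "(g, l, h) \<cdot>\<^bsub>slice C b\<^esub> (f, k, g') = (f, l \<cdot> k, h)"
  by (simp add: slice_def)

lemma pullback_functor_Ob:
  "z \<in> Ar C \<Longrightarrow> Cod C z = Cod C g \<Longrightarrow> Fob (pullback_functor C g) z = pb_fst C g z"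
  by (simp add: pullback_functor_def slice_def)

lemma pullback_functor_Ar:
  "z \<in> Ar C \<Longrightarrow> r \<in> Ar C \<Longrightarrow> Cod C z = Cod C g \<Longrightarrow> Cod C r = Cod C g \<Longrightarrow> k \<in> Ar C \<Longrightarrow> Dom C k = Dom C z \<Longrightarrow>
   Cod C k = Dom C r \<Longrightarrow> r \<cdot> k = z \<Longrightarrow>
   Far (pullback_functor C g) (z, k, r) =
     (pb_fst C g z, pb_induced C g r (pb_fst C g z) (k \<cdot> pb_snd C g z), pb_fst C g r)"
  by (simp add: pullback_functor_def slice_def hom_def)

lemma pb_map:
  assumes r: "has_pullback C g r" and z: "has_pullback C g z"
    and h: "h \<in> Ar C" "Dom C h = Dom C z" "Cod C h = Dom C r" "r \<cdot> h = z"
  defines "w \<equiv> pb_induced C g r (pb_fst C g z) (h \<cdot> pb_snd C g z)"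
  shows "w \<in> Ar C" "Dom C w = Dom C (pb_fst C g z)" "Cod C w = Dom C (pb_fst C g r)"
    "pb_fst C g r \<cdot> w = pb_fst C g z" "pb_snd C g r \<cdot> w = h \<cdot> pb_snd C g z"
proof -
  note R = pullbackD[OF pb_is_pullback[OF r]] and Z = pullbackD[OF pb_is_pullback[OF z]]
  have "g \<cdot> pb_fst C g z = r \<cdot> (h \<cdot> pb_snd C g z)"
    using R Z h h(4)[THEN cmp_ext] by simp
  with pb_induced[OF r, of "pb_fst C g z" "h \<cdot> pb_snd C g z"] R Z h
  show "w \<in> Ar C" "Dom C w = Dom C (pb_fst C g z)" "Cod C w = Dom C (pb_fst C g r)"
    "pb_fst C g r \<cdot> w = pb_fst C g z" "pb_snd C g r \<cdot> w = h \<cdot> pb_snd C g z"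
    unfolding w_def by simp_all
qed

lemma pb_map_unique:
  assumes r: "has_pullback C g r" and z: "has_pullback C g z"
    and h: "h \<in> Ar C" "Dom C h = Dom C z" "Cod C h = Dom C r" "r \<cdot> h = z"
    and w: "w \<in> Ar C" "Cod C w = Dom C (pb_fst C g r)"
      "pb_fst C g r \<cdot> w = pb_fst C g z" "pb_snd C g r \<cdot> w = h \<cdot> pb_snd C g z"
  shows "w = pb_induced C g r (pb_fst C g z) (h \<cdot> pb_snd C g z)"
  by (rule pullback_unique[OF pb_is_pullback[OF r]]) (use w pb_map[OF r z h] in simp_all)

text \<open>For the chosen pullbacks the test map in \<open>Pi_map\<close> exists and is unique,
  namely \<open>h\<close> pulled back along \<open>g\<close>; the quantified condition collapses to
  a single equation.\<close>

lemma Pi_map_pb: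
  assumes r: "has_pullback C g r" and z: "has_pullback C g z"
  shows "Pi_map C r (pb_fst C g r) (pb_snd C g r) ev z (pb_fst C g z) (pb_snd C g z) m h \<longleftrightarrow>
    h \<in> Ar C \<and> Dom C h = Dom C z \<and> Cod C h = Dom C r \<and> r \<cdot> h = z \<and>
    ev \<cdot> pb_induced C g r (pb_fst C g z) (h \<cdot> pb_snd C g z) = m"
proof (cases "h \<in> Ar C \<and> Dom C h = Dom C z \<and> Cod C h = Dom C r \<and> r \<cdot> h = z")
  case True
  then have h: "h \<in> Ar C" "Dom C h = Dom C z" "Cod C h = Dom C r" "r \<cdot> h = z" by auto
  show ?thesis
    unfolding Pi_map_def using pb_map[OF r z h] pb_map_unique[OF r z h] h by blast
next
  case False
  then show ?thesis unfolding Pi_map_def by blast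
qed

text \<open>Yoneda: \<open>ev\<close> is the image of the identity of \<open>R p\<close>. Naturality
  forces the representation to send \<open>h\<close> to \<open>ev\<close> after the pullback of
  \<open>h\<close>, and its bijectivity is then the universal property.\<close>

lemma Pi_of_partial_right_adjoint:
  assumes adj: "partial_right_adjoint (slice C (Cod C g)) (slice C (Dom C g)) (pullback_functor C g) S R"
    and p: "p \<in> S" "p \<in> Ar C" "Cod C p = Dom C g" and g: "g \<in> Ar C"
    and pb: "\<And>z. z \<in> Ar C \<Longrightarrow> Cod C z = Cod C g \<Longrightarrow> has_pullback C g z"
  obtains ev where "R p \<in> Ar C" "Cod C (R p) = Cod C g"
    "is_Pi C g p (R p) (pb_fst C g (R p)) (pb_snd C g (R p)) ev"
proof -
  let ?r = "R p" and ?D = "slice C (Cod C g)" and ?E = "slice C (Dom C g)" and ?G = "pullback_functor C g"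
  obtain \<phi> where r: "?r \<in> Ob ?D" and bij: "\<forall>d \<in> Ob ?D. bij_betw (\<phi> d) (hom ?D d ?r) (hom ?E (Fob ?G d) p)"
    and nat: "\<forall>d \<in> Ob ?D. \<forall>d' \<in> Ob ?D. \<forall>u \<in> hom ?D d' d. \<forall>k \<in> hom ?D d ?r.
                \<phi> d' (k \<cdot>\<^bsub>?D\<^esub> u) = \<phi> d k \<cdot>\<^bsub>?E\<^esub> Far ?G u"
    using adj p unfolding partial_right_adjoint_def by blast
  have r': "?r \<in> Ar C" "Cod C ?r = Cod C g" using r by (auto simp: slice_Ob)
  note pr = pb[OF r'] and pr' = pullbackD[OF pb_is_pullback[OF pb[OF r']]]
  have idr: "(?r, Ide C (Dom C ?r), ?r) \<in> hom ?D ?r ?r"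
    using r' by (auto simp: slice_hom)
  then have "\<phi> ?r (?r, Ide C (Dom C ?r), ?r) \<in> hom ?E (pb_fst C g ?r) p"
    using bij[rule_format, OF r] r' by (auto simp: bij_betw_def pullback_functor_Ob)
  then obtain ev where ev: "\<phi> ?r (?r, Ide C (Dom C ?r), ?r) = (pb_fst C g ?r, ev, p)"
    "ev \<in> Ar C" "Dom C ev = Dom C (pb_fst C g ?r)" "Cod C ev = Dom C p" "p \<cdot> ev = pb_fst C g ?r"
    by (auto simp: slice_hom)
  have \<phi>: "\<phi> z (z, h, ?r) = (pb_fst C g z, ev \<cdot> pb_induced C g ?r (pb_fst C g z) (h \<cdot> pb_snd C g z), p)"
    if "(z, h, ?r) \<in> hom ?D z ?r" for z h
  proof -
    have z: "z \<in> Ob ?D" and z': "z \<in> Ar C" "Cod C z = Cod C g"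
      "h \<in> Ar C" "Dom C h = Dom C z" "Cod C h = Dom C ?r" "?r \<cdot> h = z"
      using that by (auto simp: slice_hom slice_Ob)
    have "\<phi> z ((?r, Ide C (Dom C ?r), ?r) \<cdot>\<^bsub>?D\<^esub> (z, h, ?r)) =
        \<phi> ?r (?r, Ide C (Dom C ?r), ?r) \<cdot>\<^bsub>?E\<^esub> Far ?G (z, h, ?r)"
      using nat z r that idr by blast
    then show ?thesis
      using z' r' ev(1) by (simp add: slice_cmp pullback_functor_Ar)
  qed
  have "is_Pi C g p ?r (pb_fst C g ?r) (pb_snd C g ?r) ev"
  proof (rule is_PiI[OF pb_is_pullback[OF pr]])
    fix z assume z: "z \<in> Ar C" "Cod C z = Cod C g"
    then have z': "z \<in> Ob ?D" by (simp add: slice_Ob)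
    have b: "bij_betw (\<phi> z) (hom ?D z ?r) (hom ?E (pb_fst C g z) p)"
      using bij[rule_format, OF z'] z by (simp add: pullback_functor_Ob)
    have "\<exists>!h. Pi_map C ?r (pb_fst C g ?r) (pb_snd C g ?r) ev z (pb_fst C g z) (pb_snd C g z) m h"
      if m: "m \<in> Ar C" "Dom C m = Dom C (pb_fst C g z)" "Cod C m = Dom C p" "p \<cdot> m = pb_fst C g z" for m
    proof -
      have "(pb_fst C g z, m, p) \<in> hom ?E (pb_fst C g z) p"
        using m p pullbackD[OF pb_is_pullback[OF pb[OF z]]] by (auto simp: slice_hom)
      then have "\<exists>!k. k \<in> hom ?D z ?r \<and> \<phi> z k = (pb_fst C g z, m, p)"
        by (rule bspec[OF conjunct2[OF b[unfolded bij_betw_iff_ex1]]])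
      then obtain k where k: "k \<in> hom ?D z ?r" "\<phi> z k = (pb_fst C g z, m, p)"
         "\<And>k'. k' \<in> hom ?D z ?r \<Longrightarrow> \<phi> z k' = (pb_fst C g z, m, p) \<Longrightarrow> k' = k"
        by blast
      obtain h where h: "k = (z, h, ?r)" using k(1) by (auto simp: slice_hom)
      have *: "Pi_map C ?r (pb_fst C g ?r) (pb_snd C g ?r) ev z (pb_fst C g z) (pb_snd C g z) m h' \<longleftrightarrow>
        (z, h', ?r) \<in> hom ?D z ?r \<and> \<phi> z (z, h', ?r) = (pb_fst C g z, m, p)" for h'
      proof -
        have "(z, h', ?r) \<in> hom ?D z ?r \<longleftrightarrow> h' \<in> Ar C \<and> Dom C h' = Dom C z \<and> Cod C h' = Dom C ?r \<and> ?r \<cdot> h' = z"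
          using z r' by (simp add: slice_hom)
        then show ?thesis
          unfolding Pi_map_pb[OF pr pb[OF z]] using \<phi>[of z h'] by (metis prod.inject)
      qed
      show ?thesis unfolding * using k(1,2,3) unfolding h by blast
    qed
    then show "\<exists>sa sz. is_pullback C g z sa sz \<and> (\<forall>m \<in> Ar C. Dom C m = Dom C sa \<and> Cod C m = Dom C p \<and> p \<cdot> m = sa \<longrightarrow>
        (\<exists>!h. Pi_map C ?r (pb_fst C g ?r) (pb_snd C g ?r) ev z sa sz m h))"
      using pb_is_pullback[OF pb[OF z]] by blast
  qed (use ev p in auto)
  with r' that show thesis by blast
qed

text \<open>The representation sends an arrow to \<open>ev\<close> after its pullback along
  \<open>g\<close>. Naturality is functoriality of the chosen pullbacks, and bijectivity is the
  existence of unique transposes.\<close>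

lemma partial_right_adjoint_of_Pi:
  assumes g: "g \<in> Ar C" and pb: "\<And>z. z \<in> Ar C \<Longrightarrow> Cod C z = Cod C g \<Longrightarrow> has_pullback C g z"
    and P: "\<And>p. p \<in> S \<Longrightarrow> p \<in> Ar C \<and> Cod C p = Dom C g \<and> R p \<in> Ar C \<and> Cod C (R p) = Cod C g \<and>
      (\<exists>ev. is_Pi C g p (R p) (pb_fst C g (R p)) (pb_snd C g (R p)) ev)"
  shows "partial_right_adjoint (slice C (Cod C g)) (slice C (Dom C g)) (pullback_functor C g) S R"
  unfolding partial_right_adjoint_def
proof (intro ballI conjI)
  let ?D = "slice C (Cod C g)" and ?E = "slice C (Dom C g)" and ?G = "pullback_functor C g"
  fix p assume "p \<in> S"
  let ?r = "R p"
  obtain ev where p: "p \<in> Ar C" "Cod C p = Dom C g" and r: "?r \<in> Ar C" "Cod C ?r = Cod C g"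
    and ev: "is_Pi C g p ?r (pb_fst C g ?r) (pb_snd C g ?r) ev"
    using P[OF \<open>p \<in> S\<close>] by auto
  note E = is_PiD[OF ev]
  show "?r \<in> Ob ?D" using r by (simp add: slice_Ob)
  let ?w = "\<lambda>r z h. pb_induced C g r (pb_fst C g z) (h \<cdot> pb_snd C g z)"
  define \<phi> where "\<phi> = (\<lambda>z (k :: 'a \<times> 'a \<times> 'a). (pb_fst C g z, ev \<cdot> ?w ?r z (fst (snd k)), p))"
  show "\<exists>\<phi>. (\<forall>d\<in>Ob ?D. bij_betw (\<phi> d) (hom ?D d ?r) (hom ?E (Fob ?G d) p)) \<and>
           (\<forall>d\<in>Ob ?D. \<forall>d'\<in>Ob ?D. \<forall>u\<in>hom ?D d' d. \<forall>k\<in>hom ?D d ?r.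
                   \<phi> d' (k \<cdot>\<^bsub>?D\<^esub> u) = \<phi> d k \<cdot>\<^bsub>?E\<^esub> Far ?G u)"
  proof (intro exI[of _ \<phi>] conjI ballI)
    fix z assume "z \<in> Ob ?D"
    then have z: "z \<in> Ar C" "Cod C z = Cod C g" by (auto simp: slice_Ob)
    note Z = pb_is_pullback[OF pb[OF z]]
    have into: "\<phi> z k \<in> hom ?E (pb_fst C g z) p" if k: "k \<in> hom ?D z ?r" for k
    proof -
      obtain h where h: "k = (z, h, ?r)" "h \<in> Ar C" "Dom C h = Dom C z" "Cod C h = Dom C ?r" "?r \<cdot> h = z"
        using k by (auto simp: slice_hom)
      note w = pb_map[OF pb[OF r] pb[OF z] h(2-)]
      show ?thesis
        using w E(2-5) E(5)[THEN cmp_ext] p h pullbackD[OF Z] by (auto simp: slice_hom \<phi>_def)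
    qed
    have ex1: "\<exists>!k. k \<in> hom ?D z ?r \<and> \<phi> z k = l" if l: "l \<in> hom ?E (pb_fst C g z) p" for l
    proof -
      obtain m where m: "l = (pb_fst C g z, m, p)" "m \<in> Ar C" "Dom C m = Dom C (pb_fst C g z)" "Cod C m = Dom C p" "p \<cdot> m = pb_fst C g z"
        using l by (auto simp: slice_hom)
      obtain h where h: "Pi_map C ?r (pb_fst C g ?r) (pb_snd C g ?r) ev z (pb_fst C g z) (pb_snd C g z) m h"
        "\<And>h'. Pi_map C ?r (pb_fst C g ?r) (pb_snd C g ?r) ev z (pb_fst C g z) (pb_snd C g z) m h' \<Longrightarrow> h' = h"
        using E(6)[OF Z m(2-)] by blast
      show ?thesis
      proof (rule ex1I[of _ "(z, h, ?r)"])
        show "(z, h, ?r) \<in> hom ?D z ?r \<and> \<phi> z (z, h, ?r) = l"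
          using h(1) m(1) z r unfolding Pi_map_pb[OF pb[OF r] pb[OF z]] by (simp add: slice_hom \<phi>_def)
      next
        fix k assume k: "k \<in> hom ?D z ?r \<and> \<phi> z k = l"
        then obtain h' where h': "k = (z, h', ?r)" "h' \<in> Ar C" "Dom C h' = Dom C z" "Cod C h' = Dom C ?r" "?r \<cdot> h' = z"
          by (auto simp: slice_hom)
        then have "Pi_map C ?r (pb_fst C g ?r) (pb_snd C g ?r) ev z (pb_fst C g z) (pb_snd C g z) m h'"
          using k m(1) unfolding Pi_map_pb[OF pb[OF r] pb[OF z]] by (simp add: \<phi>_def)
        then show "k = (z, h, ?r)" using h(2) h'(1) by simp
      qed
    qed
    show "bij_betw (\<phi> z) (hom ?D z ?r) (hom ?E (Fob ?G z) p)"
      unfolding bij_betw_iff_ex1 pullback_functor_Ob[OF z] using into ex1 by blast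
  next
    fix z z' u k assume "z \<in> Ob ?D" "z' \<in> Ob ?D" and uk: "u \<in> hom ?D z' z" "k \<in> hom ?D z ?r"
    then have z: "z \<in> Ar C" "Cod C z = Cod C g" "z' \<in> Ar C" "Cod C z' = Cod C g"
      by (auto simp: slice_Ob)
    obtain t where u: "u = (z', t, z)" "t \<in> Ar C" "Dom C t = Dom C z'" "Cod C t = Dom C z" "z \<cdot> t = z'"
      using uk by (auto simp: slice_hom)
    obtain h where k: "k = (z, h, ?r)" "h \<in> Ar C" "Dom C h = Dom C z" "Cod C h = Dom C ?r" "?r \<cdot> h = z"
      using uk by (auto simp: slice_hom)
    note 1 = pb_map[OF pb[OF z(1,2)] pb[OF z(3,4)] u(2-)]
    note 2 = pb_map[OF pb[OF r] pb[OF z(1,2)] k(2-)]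
    note Z = pullbackD[OF pb_is_pullback[OF pb[OF z(1,2)]]] and Z' = pullbackD[OF pb_is_pullback[OF pb[OF z(3,4)]]]
      and R = pullbackD[OF pb_is_pullback[OF pb[OF r]]]
    have "?w ?r z h \<cdot> ?w z z' t = ?w ?r z' (h \<cdot> t)"
    proof (rule pb_map_unique[OF pb[OF r] pb[OF z(3,4)]])
      show "pb_snd C g ?r \<cdot> (?w ?r z h \<cdot> ?w z z' t) = (h \<cdot> t) \<cdot> pb_snd C g z'"
        using 1 2 R Z Z' u k 2(5)[THEN cmp_ext] by simp
    qed (use 1 2 R Z Z' u k 2(4)[THEN cmp_ext] k(5)[THEN cmp_ext] in simp_all)
    then show "\<phi> z' (k \<cdot>\<^bsub>?D\<^esub> u) = \<phi> z k \<cdot>\<^bsub>?E\<^esub> Far ?G u"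
      using u k z 1 2 E(2-4) by (simp add: slice_cmp \<phi>_def pullback_functor_Ar)
  qed
qed

end

section \<open>The axioms freed from chosen pullbacks\<close>

context type_theoretic_fibration_category
begin

lemma fib_Ar [simp]: "f \<in> F \<Longrightarrow> f \<in> Ar C"
  using fib_arrow by blast

lemma fib_has_pullback:
  assumes "g \<in> F" "f \<in> Ar C" "Cod C f = Cod C g"
  shows "has_pullback C f g" "has_pullback C g f"
  using fib_pullback_ex[OF assms] pullback_sym unfolding has_pullback_def by blast+

lemma fib_pullback_sym: "g \<in> F \<Longrightarrow> is_pullback C g f p q \<Longrightarrow> q \<in> F"
  using fib_pullback pullback_sym by blast

lemma Pi_obtain:
  assumes g: "g \<in> F" and p: "p \<in> F" "Cod C p = Dom C g"
  obtains r qa qr ev where "r \<in> F" "Cod C r = Cod C g" "is_Pi C g p r qa qr ev"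
proof -
  obtain R where R: "partial_right_adjoint (slice C (Cod C g)) (slice C (Dom C g)) (pullback_functor C g)
             {p \<in> F. Cod C p = Dom C g} R" "\<forall>p \<in> F. Cod C p = Dom C g \<longrightarrow> R p \<in> F"
    using fib_Pi[OF g] by blast
  have "p \<in> {p \<in> F. Cod C p = Dom C g}" using p by simp
  from Pi_of_partial_right_adjoint[OF R(1) this fib_Ar[OF p(1)] p(2) fib_Ar[OF g] fib_has_pullback(2)[OF g]]
  obtain ev where ev: "Cod C (R p) = Cod C g" "is_Pi C g p (R p) (pb_fst C g (R p)) (pb_snd C g (R p)) ev" .
  show thesis by (rule that[OF _ ev]) (use R(2) p in simp)
qed

text \<open>The comparison map between arbitrary pullbacks is the one between the chosen pullbacks,
  composed on both sides with isomorphisms, which are acyclic cofibrations.\<close>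

lemma acof_pullback':
  assumes ab: "a \<in> F" "b \<in> F" "Cod C a = Cod C b" and i: "acyclic_cofibration C F i"
    "Dom C i = Dom C a" "Cod C i = Dom C b" "b \<cdot> i = a" and z: "z \<in> Ar C" "Cod C z = Cod C a"
    and P: "is_pullback C z a p q" and Q: "is_pullback C z b p' q'"
    and h: "h \<in> Ar C" "Dom C h = Dom C p" "Cod C h = Dom C p'" "p' \<cdot> h = p" "q' \<cdot> h = i \<cdot> q"
  shows "acyclic_cofibration C F h"
proof -
  note i' = acof_Ar[OF i(1)]
  have za: "has_pullback C z a" and zb: "has_pullback C z b"
    using ab z fib_has_pullback by auto
  note A = pb_is_pullback[OF za] and B = pb_is_pullback[OF zb]
  note P' = pullbackD[OF P] and Q' = pullbackD[OF Q] and A' = pullbackD[OF A] and B' = pullbackD[OF B]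
  let ?k = "pb_induced C z b (pb_fst C z a) (i \<cdot> pb_snd C z a)"
  have "z \<cdot> pb_fst C z a = b \<cdot> (i \<cdot> pb_snd C z a)"
    using A' i i' i(4)[THEN cmp_ext] ab by simp
  then have k: "?k \<in> Ar C" "Dom C ?k = Dom C (pb_fst C z a)" "Cod C ?k = Dom C (pb_fst C z b)"
    "pb_fst C z b \<cdot> ?k = pb_fst C z a" "pb_snd C z b \<cdot> ?k = i \<cdot> pb_snd C z a"
    using pb_induced[OF zb, of "pb_fst C z a" "i \<cdot> pb_snd C z a"] A' i i' ab by simp_all
  have ak: "acyclic_cofibration C F ?k"
    using acof_pullback[of a b i z] ab i i' z by (simp add: hom_def)
  obtain j where j: "is_iso C j" "j \<in> Ar C" "Dom C j = Dom C p" "Cod C j = Dom C (pb_fst C z a)"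
    "pb_fst C z a \<cdot> j = p" "pb_snd C z a \<cdot> j = q"
    using pullback_iso[OF P A] .
  obtain l where l: "is_iso C l" "l \<in> Ar C" "Dom C l = Dom C (pb_fst C z b)" "Cod C l = Dom C p'"
    "p' \<cdot> l = pb_fst C z b" "q' \<cdot> l = pb_snd C z b"
    using pullback_iso[OF B Q] .
  have "h = l \<cdot> (?k \<cdot> j)"
    by (rule pullback_unique[OF Q])
      (use h j l k A' B' P' Q' i i' k(4,5)[THEN cmp_ext] l(5,6)[THEN cmp_ext] in simp_all)
  moreover have "acyclic_cofibration C F (l \<cdot> (?k \<cdot> j))"
    using acof_cmp acof_iso[OF l(1) fib_arrow] acof_iso[OF j(1) fib_arrow] ak j k l fib_arrow by simp
  ultimately show ?thesis by simp
qed

end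

subsection \<open>Matching objects\<close>

lemma ex1_eq: "\<exists>!x. P x \<Longrightarrow> P a \<Longrightarrow> P b \<Longrightarrow> a = b"
  by blast

definition nonid :: "('i, 'j) cat \<Rightarrow> 'i \<Rightarrow> 'j set" where
  "nonid K x = {u \<in> Ar K. Dom K u = x \<and> u \<noteq> Ide K x}"

text \<open>Cones over the matching diagram at \<^term>\<open>x\<close>; only the data of \<^term>\<open>A\<close> below \<^term>\<open>x\<close>
  is used, so that these notions make sense while \<^term>\<open>A\<close> is still under construction.\<close>

definition mcone ::
  "('o, 'a) cat \<Rightarrow> ('i, 'j) cat \<Rightarrow> ('i, 'j, 'o, 'a) fnctr \<Rightarrow> 'i \<Rightarrow> 'o \<Rightarrow> ('j \<Rightarrow> 'a) \<Rightarrow> bool" where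
  "mcone C K A x L \<pi> \<longleftrightarrow> L \<in> Ob C \<and>
     (\<forall>u \<in> nonid K x. \<pi> u \<in> Ar C \<and> Dom C (\<pi> u) = L \<and> Cod C (\<pi> u) = Fob A (Cod K u)) \<and>
     (\<forall>u \<in> nonid K x. \<forall>k \<in> Ar K. Dom K k = Cod K u \<longrightarrow> k \<cdot>\<^bsub>K\<^esub> u \<in> nonid K x \<longrightarrow>
        Far A k \<cdot>\<^bsub>C\<^esub> \<pi> u = \<pi> (k \<cdot>\<^bsub>K\<^esub> u))"

definition mlim ::
  "('o, 'a) cat \<Rightarrow> ('i, 'j) cat \<Rightarrow> ('i, 'j, 'o, 'a) fnctr \<Rightarrow> 'i \<Rightarrow> 'o \<Rightarrow> ('j \<Rightarrow> 'a) \<Rightarrow> bool" where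
  "mlim C K A x L \<pi> \<longleftrightarrow> mcone C K A x L \<pi> \<and> (\<forall>L' \<pi>'. mcone C K A x L' \<pi>' \<longrightarrow>
     (\<exists>!h. h \<in> hom C L' L \<and> (\<forall>u \<in> nonid K x. \<pi> u \<cdot>\<^bsub>C\<^esub> h = \<pi>' u)))"

text \<open>The relative matching object \<open>M\<^sub>x A \<times>\<^bsub>M\<^sub>x B\<^esub> B\<^sub>x\<close> of a transformation \<open>\<alpha> : A \<rightarrow> B\<close>, described by
  a single universal property.\<close>

definition rcone ::
  "('o, 'a) cat \<Rightarrow> ('i, 'j) cat \<Rightarrow> ('i, 'j, 'o, 'a) fnctr \<Rightarrow> ('i \<Rightarrow> 'a) \<Rightarrow> ('i, 'j, 'o, 'a) fnctr \<Rightarrow>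
   'i \<Rightarrow> 'o \<Rightarrow> 'a \<Rightarrow> ('j \<Rightarrow> 'a) \<Rightarrow> bool" where
  "rcone C K A \<alpha> B x L b \<pi> \<longleftrightarrow> mcone C K A x L \<pi> \<and>
     b \<in> Ar C \<and> Dom C b = L \<and> Cod C b = Fob B x \<and>
     (\<forall>u \<in> nonid K x. Far B u \<cdot>\<^bsub>C\<^esub> b = \<alpha> (Cod K u) \<cdot>\<^bsub>C\<^esub> \<pi> u)"

definition rlim ::
  "('o, 'a) cat \<Rightarrow> ('i, 'j) cat \<Rightarrow> ('i, 'j, 'o, 'a) fnctr \<Rightarrow> ('i \<Rightarrow> 'a) \<Rightarrow> ('i, 'j, 'o, 'a) fnctr \<Rightarrow>
   'i \<Rightarrow> 'o \<Rightarrow> 'a \<Rightarrow> ('j \<Rightarrow> 'a) \<Rightarrow> bool" where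
  "rlim C K A \<alpha> B x L b \<pi> \<longleftrightarrow> rcone C K A \<alpha> B x L b \<pi> \<and> (\<forall>L' b' \<pi>'. rcone C K A \<alpha> B x L' b' \<pi>' \<longrightarrow>
     (\<exists>!h. h \<in> hom C L' L \<and> b \<cdot>\<^bsub>C\<^esub> h = b' \<and> (\<forall>u \<in> nonid K x. \<pi> u \<cdot>\<^bsub>C\<^esub> h = \<pi>' u)))"

text \<open>The object \<^term>\<open>X\<close> with structure maps \<^term>\<open>a\<close> (and \<^term>\<open>t\<close>) is a fibrant value at
  \<^term>\<open>x\<close> (relative to \<^term>\<open>B\<close>) for the diagram \<^term>\<open>A\<close>.\<close>

definition mstep ::
  "('o, 'a) cat \<Rightarrow> 'a set \<Rightarrow> ('i, 'j) cat \<Rightarrow> ('i, 'j, 'o, 'a) fnctr \<Rightarrow> 'i \<Rightarrow> 'o \<Rightarrow> ('j \<Rightarrow> 'a) \<Rightarrow> bool" where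
  "mstep C F K A x X a \<longleftrightarrow> (\<exists>L \<pi> m. mlim C K A x L \<pi> \<and> m \<in> F \<and> Dom C m = X \<and> Cod C m = L \<and>
     (\<forall>u \<in> nonid K x. \<pi> u \<cdot>\<^bsub>C\<^esub> m = a u))"

definition rstep ::
  "('o, 'a) cat \<Rightarrow> 'a set \<Rightarrow> ('i, 'j) cat \<Rightarrow> ('i, 'j, 'o, 'a) fnctr \<Rightarrow> ('i \<Rightarrow> 'a) \<Rightarrow>
   ('i, 'j, 'o, 'a) fnctr \<Rightarrow> 'i \<Rightarrow> 'o \<Rightarrow> ('j \<Rightarrow> 'a) \<Rightarrow> 'a \<Rightarrow> bool" where
  "rstep C F K A \<alpha> B x X a t \<longleftrightarrow> (\<exists>L b \<pi> m. rlim C K A \<alpha> B x L b \<pi> \<and>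
     m \<in> F \<and> Dom C m = X \<and> Cod C m = L \<and> b \<cdot>\<^bsub>C\<^esub> m = t \<and> (\<forall>u \<in> nonid K x. \<pi> u \<cdot>\<^bsub>C\<^esub> m = a u))"

text \<open>Functoriality restricted to the arrows out of \<open>x\<close>. A functor is good at
  every object, while a diagram built up to some stage is good only at the objects already reached.
  The same holds for \<open>nat_at\<close> and naturality.\<close>

definition good_at :: "('o, 'a) cat \<Rightarrow> ('i, 'j) cat \<Rightarrow> ('i, 'j, 'o, 'a) fnctr \<Rightarrow> 'i \<Rightarrow> bool" where
  "good_at C K A x \<longleftrightarrow> Fob A x \<in> Ob C \<and>
     (\<forall>u \<in> Ar K. Dom K u = x \<longrightarrow> Far A u \<in> Ar C \<and> Dom C (Far A u) = Fob A x \<and>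
        Cod C (Far A u) = Fob A (Cod K u)) \<and>
     Far A (Ide K x) = Ide C (Fob A x) \<and>
     (\<forall>u \<in> Ar K. \<forall>k \<in> Ar K. Dom K u = x \<longrightarrow> Dom K k = Cod K u \<longrightarrow>
        Far A (k \<cdot>\<^bsub>K\<^esub> u) = Far A k \<cdot>\<^bsub>C\<^esub> Far A u)"

definition nat_at ::
  "('o, 'a) cat \<Rightarrow> ('i, 'j) cat \<Rightarrow> ('i, 'j, 'o, 'a) fnctr \<Rightarrow> ('i \<Rightarrow> 'a) \<Rightarrow> ('i, 'j, 'o, 'a) fnctr \<Rightarrow>
   'i \<Rightarrow> bool" where
  "nat_at C K A \<alpha> B x \<longleftrightarrow> \<alpha> x \<in> Ar C \<and> Dom C (\<alpha> x) = Fob A x \<and> Cod C (\<alpha> x) = Fob B x \<and>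
     (\<forall>u \<in> Ar K. Dom K u = x \<longrightarrow> Far B u \<cdot>\<^bsub>C\<^esub> \<alpha> x = \<alpha> (Cod K u) \<cdot>\<^bsub>C\<^esub> Far A u)"

abbreviation fibrant_at where
  "fibrant_at C F K A x \<equiv> mstep C F K A x (Fob A x) (Far A)"

abbreviation rfib_at where
  "rfib_at C F K A \<alpha> B x \<equiv> rstep C F K A \<alpha> B x (Fob A x) (Far A) (\<alpha> x)"

text \<open>\<open>K\<close> is an arbitrary category, so that this layer applies both to the index
  category and to its strict coslices, which are shown below to be categories. Composites of
  nonidentities may then be identities, hence the proviso in \<open>mcone\<close>.\<close>

locale diagrams = type_theoretic_fibration_category C F + K: category K
  for C :: "('o, 'a) cat" (structure) and F :: "'a set" and K :: "('i, 'j) cat"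
begin

abbreviation "N \<equiv> nonid K"
abbreviation "good A x \<equiv> good_at C K A x"
abbreviation "good_below A x \<equiv> \<forall>u \<in> nonid K x. good_at C K A (Cod K u)"
abbreviation "natu A \<alpha> B x \<equiv> nat_at C K A \<alpha> B x"
abbreviation "nat_below A \<alpha> B x \<equiv> \<forall>u \<in> nonid K x. nat_at C K A \<alpha> B (Cod K u)"

lemma nonidD: "u \<in> N x \<Longrightarrow> u \<in> Ar K" "u \<in> N x \<Longrightarrow> Dom K u = x"
  by (auto simp: nonid_def)

lemma goodD:
  assumes "good A x"
  shows "Fob A x \<in> Ob C" "u \<in> Ar K \<Longrightarrow> Dom K u = x \<Longrightarrow> Far A u \<in> Ar C"
    "u \<in> Ar K \<Longrightarrow> Dom K u = x \<Longrightarrow> Dom C (Far A u) = Fob A x"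
    "u \<in> Ar K \<Longrightarrow> Dom K u = x \<Longrightarrow> Cod C (Far A u) = Fob A (Cod K u)"
    "Far A (Ide K x) = Ide C (Fob A x)"
    "u \<in> Ar K \<Longrightarrow> k \<in> Ar K \<Longrightarrow> Dom K u = x \<Longrightarrow> Dom K k = Cod K u \<Longrightarrow> Far A (k \<cdot>\<^bsub>K\<^esub> u) = Far A k \<cdot> Far A u"
  using assms unfolding good_at_def by blast+

lemma good_belowD:
  assumes "good_below A x" "v \<in> N x"
  shows "Fob A (Cod K v) \<in> Ob C" "u \<in> Ar K \<Longrightarrow> Dom K u = Cod K v \<Longrightarrow> Far A u \<in> Ar C"
    "u \<in> Ar K \<Longrightarrow> Dom K u = Cod K v \<Longrightarrow> Dom C (Far A u) = Fob A (Cod K v)"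
    "u \<in> Ar K \<Longrightarrow> Dom K u = Cod K v \<Longrightarrow> Cod C (Far A u) = Fob A (Cod K u)"
  using goodD[of A "Cod K v"] assms by blast+

lemma natD:
  assumes "natu A \<alpha> B x"
  shows "\<alpha> x \<in> Ar C" "Dom C (\<alpha> x) = Fob A x" "Cod C (\<alpha> x) = Fob B x"
    "u \<in> Ar K \<Longrightarrow> Dom K u = x \<Longrightarrow> Far B u \<cdot> \<alpha> x = \<alpha> (Cod K u) \<cdot> Far A u"
  using assms unfolding nat_at_def by blast+

lemma mconeD:
  assumes "mcone C K A x L \<pi>"
  shows "L \<in> Ob C" "u \<in> N x \<Longrightarrow> \<pi> u \<in> Ar C" "u \<in> N x \<Longrightarrow> Dom C (\<pi> u) = L"
    "u \<in> N x \<Longrightarrow> Cod C (\<pi> u) = Fob A (Cod K u)"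
    "u \<in> N x \<Longrightarrow> k \<in> Ar K \<Longrightarrow> Dom K k = Cod K u \<Longrightarrow> k \<cdot>\<^bsub>K\<^esub> u \<in> N x \<Longrightarrow> Far A k \<cdot> \<pi> u = \<pi> (k \<cdot>\<^bsub>K\<^esub> u)"
  using assms unfolding mcone_def by blast+

lemma rconeD:
  assumes "rcone C K A \<alpha> B x L b \<pi>"
  shows "mcone C K A x L \<pi>" "b \<in> Ar C" "Dom C b = L" "Cod C b = Fob B x"
    "u \<in> N x \<Longrightarrow> Far B u \<cdot> b = \<alpha> (Cod K u) \<cdot> \<pi> u"
  using assms unfolding rcone_def by blast+

lemma mcone_cmp:
  assumes A: "good_below A x" and L: "mcone C K A x L \<pi>" and h: "h \<in> Ar C" "Cod C h = L"
  shows "mcone C K A x (Dom C h) (\<lambda>u. \<pi> u \<cdot> h)"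
  unfolding mcone_def
proof (intro conjI ballI impI)
  fix u k assume u: "u \<in> N x" "k \<in> Ar K" "Dom K k = Cod K u" "k \<cdot>\<^bsub>K\<^esub> u \<in> N x"
  show "Far A k \<cdot> (\<pi> u \<cdot> h) = \<pi> (k \<cdot>\<^bsub>K\<^esub> u) \<cdot> h"
    using mconeD[OF L] u h good_belowD[OF A u(1)] by (intro cmp_ext) auto
qed (use mconeD[OF L] h in auto)

lemma mcone_good:
  assumes "good A x"
  shows "mcone C K A x (Fob A x) (Far A)"
  unfolding mcone_def using goodD[OF assms] by (simp add: nonid_def)

text \<open>Families are functions on all arrows, but the value at the identity is irrelevant; a
  later construction sets it freely.\<close>

lemma mcone_cong:
  assumes "\<forall>u \<in> N x. \<pi> u = \<pi>' u"
  shows "mcone C K A x L \<pi> = mcone C K A x L \<pi>'"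
  using assms unfolding mcone_def by simp

lemma rcone_cong:
  assumes "\<forall>u \<in> N x. \<pi> u = \<pi>' u"
  shows "rcone C K A \<alpha> B x L b \<pi> = rcone C K A \<alpha> B x L b \<pi>'"
  using assms mcone_cong[OF assms] unfolding rcone_def by simp

lemma rcone_cmp:
  assumes A: "good_below A x" and B: "good B x" and \<alpha>: "nat_below A \<alpha> B x"
    and L: "rcone C K A \<alpha> B x L b \<pi>" and h: "h \<in> Ar C" "Cod C h = L"
  shows "rcone C K A \<alpha> B x (Dom C h) (b \<cdot> h) (\<lambda>u. \<pi> u \<cdot> h)"
  unfolding rcone_def
proof (intro conjI ballI)
  note R = rconeD[OF L]
  note M = mconeD[OF R(1)]
  show "mcone C K A x (Dom C h) (\<lambda>u. \<pi> u \<cdot> h)" by (rule mcone_cmp[OF A R(1) h])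
  fix u assume u: "u \<in> N x"
  have "Far B u \<cdot> (b \<cdot> h) = (\<alpha> (Cod K u) \<cdot> \<pi> u) \<cdot> h"
    using R u h goodD[OF B] nonidD[OF u] by (intro cmp_ext) auto
  then show "Far B u \<cdot> (b \<cdot> h) = \<alpha> (Cod K u) \<cdot> (\<pi> u \<cdot> h)"
    using M(2-4)[OF u] h natD(1-3)[of A \<alpha> B "Cod K u"] \<alpha> u by simp
qed (use rconeD[OF L] h in auto)

lemma rcone_nat:
  assumes A: "good A x" and \<alpha>: "natu A \<alpha> B x"
  shows "rcone C K A \<alpha> B x (Fob A x) (\<alpha> x) (Far A)"
  unfolding rcone_def using mcone_good[OF A] natD[OF \<alpha>] nonidD by blast

lemma mlim_cone: "mlim C K A x L \<pi> \<Longrightarrow> mcone C K A x L \<pi>"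
  and rlim_cone: "rlim C K A \<alpha> B x L b \<pi> \<Longrightarrow> rcone C K A \<alpha> B x L b \<pi>"
  by (auto simp: mlim_def rlim_def)

lemma mlim_obtain:
  assumes "mlim C K A x L \<pi>" "mcone C K A x L' \<pi>'"
  obtains h where "h \<in> Ar C" "Dom C h = L'" "Cod C h = L" "\<And>u. u \<in> N x \<Longrightarrow> \<pi> u \<cdot> h = \<pi>' u"
proof -
  have "\<exists>!h. h \<in> hom C L' L \<and> (\<forall>u \<in> N x. \<pi> u \<cdot> h = \<pi>' u)"
    using assms unfolding mlim_def by blast
  then show thesis using that by (auto simp: hom_def)
qed

lemma mlim_unique:
  assumes L: "mlim C K A x L \<pi>" and A: "good_below A x" and h: "h \<in> Ar C" "h' \<in> Ar C" "Dom C h = Dom C h'"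
    "Cod C h = L" "Cod C h' = L" "\<And>u. u \<in> N x \<Longrightarrow> \<pi> u \<cdot> h = \<pi> u \<cdot> h'"
  shows "h = h'"
proof -
  have "\<exists>!k. k \<in> hom C (Dom C h) L \<and> (\<forall>u \<in> N x. \<pi> u \<cdot> k = \<pi> u \<cdot> h)"
    using mcone_cmp[OF A mlim_cone[OF L] h(1,4)] L unfolding mlim_def by blast
  then show ?thesis by (rule ex1_eq) (use h in \<open>simp_all add: hom_def\<close>)
qed

lemma rlim_obtain:
  assumes "rlim C K A \<alpha> B x L b \<pi>" "rcone C K A \<alpha> B x L' b' \<pi>'"
  obtains h where "h \<in> Ar C" "Dom C h = L'" "Cod C h = L" "b \<cdot> h = b'" "\<And>u. u \<in> N x \<Longrightarrow> \<pi> u \<cdot> h = \<pi>' u"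
proof -
  have "\<exists>!h. h \<in> hom C L' L \<and> b \<cdot> h = b' \<and> (\<forall>u \<in> N x. \<pi> u \<cdot> h = \<pi>' u)"
    using assms unfolding rlim_def by blast
  then show thesis using that by (auto simp: hom_def)
qed

lemma rlim_unique:
  assumes L: "rlim C K A \<alpha> B x L b \<pi>" and A: "good_below A x" and B: "good B x" and \<alpha>: "nat_below A \<alpha> B x"
    and h: "h \<in> Ar C" "h' \<in> Ar C" "Cod C h = L" "Cod C h' = L" "b \<cdot> h = b \<cdot> h'"
     "\<And>u. u \<in> N x \<Longrightarrow> \<pi> u \<cdot> h = \<pi> u \<cdot> h'"
  shows "h = h'"
proof -
  note R = rconeD[OF rlim_cone[OF L]]
  have d: "Dom C h' = Dom C h" using h R cmp_simps(2)[of h b] cmp_simps(2)[of h' b] by metis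
  have "\<exists>!k. k \<in> hom C (Dom C h) L \<and> b \<cdot> k = b \<cdot> h \<and> (\<forall>u \<in> N x. \<pi> u \<cdot> k = \<pi> u \<cdot> h)"
    using rcone_cmp[OF A B \<alpha> rlim_cone[OF L] h(1,3)] L unfolding rlim_def by blast
  then show ?thesis by (rule ex1_eq) (use h d in \<open>simp_all add: hom_def\<close>)
qed

lemma mlim_iso:
  assumes L: "mlim C K A x L \<pi>" and L': "mlim C K A x L' \<pi>'" and A: "good_below A x"
  obtains i where "is_iso C i" "i \<in> Ar C" "Dom C i = L" "Cod C i = L'" "\<And>u. u \<in> N x \<Longrightarrow> \<pi>' u \<cdot> i = \<pi> u"
proof -
  note M = mconeD[OF mlim_cone[OF L]] and M' = mconeD[OF mlim_cone[OF L']]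
  obtain i where i: "i \<in> Ar C" "Dom C i = L" "Cod C i = L'" "\<And>u. u \<in> N x \<Longrightarrow> \<pi>' u \<cdot> i = \<pi> u"
    using mlim_obtain[OF L' mlim_cone[OF L]] by blast
  obtain j where j: "j \<in> Ar C" "Dom C j = L'" "Cod C j = L" "\<And>u. u \<in> N x \<Longrightarrow> \<pi> u \<cdot> j = \<pi>' u"
    using mlim_obtain[OF L mlim_cone[OF L']] by blast
  have "j \<cdot> i = Ide C L"
    by (rule mlim_unique[OF L A]) (use i j M M' cmp_ext[OF j(4)] in simp_all)
  moreover have "i \<cdot> j = Ide C L'"
    by (rule mlim_unique[OF L' A]) (use i j M M' cmp_ext[OF i(4)] in simp_all)
  ultimately have "is_iso C i" using i j by (intro isoI[of i j]) simp_all
  with i that show thesis by blast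
qed

lemma rlim_iso:
  assumes L: "rlim C K A \<alpha> B x L b \<pi>" and L': "rlim C K A \<alpha> B x L' b' \<pi>'"
    and A: "good_below A x" and B: "good B x" and \<alpha>: "nat_below A \<alpha> B x"
  obtains i where "is_iso C i" "i \<in> Ar C" "Dom C i = L" "Cod C i = L'" "b' \<cdot> i = b" "\<And>u. u \<in> N x \<Longrightarrow> \<pi>' u \<cdot> i = \<pi> u"
proof -
  note R = rconeD[OF rlim_cone[OF L]] and R' = rconeD[OF rlim_cone[OF L']]
  note M = mconeD[OF R(1)] and M' = mconeD[OF R'(1)]
  obtain i where i: "i \<in> Ar C" "Dom C i = L" "Cod C i = L'" "b' \<cdot> i = b" "\<And>u. u \<in> N x \<Longrightarrow> \<pi>' u \<cdot> i = \<pi> u"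
    using rlim_obtain[OF L' rlim_cone[OF L]] by blast
  obtain j where j: "j \<in> Ar C" "Dom C j = L'" "Cod C j = L" "b \<cdot> j = b'" "\<And>u. u \<in> N x \<Longrightarrow> \<pi> u \<cdot> j = \<pi>' u"
    using rlim_obtain[OF L rlim_cone[OF L']] by blast
  have "j \<cdot> i = Ide C L"
    by (rule rlim_unique[OF L A B \<alpha>]) (use i j M(1-4) M'(1-4) R(2-4) R'(2-4) j(4)[THEN cmp_ext] cmp_ext[OF j(5)] in simp_all)
  moreover have "i \<cdot> j = Ide C L'"
    by (rule rlim_unique[OF L' A B \<alpha>]) (use i j M(1-4) M'(1-4) R(2-4) R'(2-4) i(4)[THEN cmp_ext] cmp_ext[OF i(5)] in simp_all)
  ultimately have "is_iso C i" using i j by (intro isoI[of i j]) simp_all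
  with i that show thesis by blast
qed

text \<open>One limit certifies fibrancy, and any other will do: the comparison isomorphism is a
  fibration and can be composed in.\<close>

lemma mstep_any:
  assumes A: "good_below A x" and X: "mstep C F K A x X a" and L: "mlim C K A x L \<pi>"
  obtains m where "m \<in> F" "Dom C m = X" "Cod C m = L" "\<And>u. u \<in> N x \<Longrightarrow> \<pi> u \<cdot> m = a u"
proof -
  obtain L' \<pi>' m where m: "mlim C K A x L' \<pi>'" "m \<in> F" "Dom C m = X" "Cod C m = L'"
     "\<forall>u \<in> N x. \<pi>' u \<cdot> m = a u"
    using X unfolding mstep_def by blast
  obtain i where i: "is_iso C i" "i \<in> Ar C" "Dom C i = L'" "Cod C i = L" "\<And>u. u \<in> N x \<Longrightarrow> \<pi> u \<cdot> i = \<pi>' u"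
    using mlim_iso[OF m(1) L A] by blast
  show thesis
    by (rule that[of "i \<cdot> m"])
      (use m i fib_cmp[of m i] fib_iso[OF i(1)] mconeD[OF mlim_cone[OF L]] cmp_ext[OF i(5)] in simp_all)
qed

lemma rstep_any:
  assumes A: "good_below A x" and B: "good B x" and \<alpha>: "nat_below A \<alpha> B x"
    and X: "rstep C F K A \<alpha> B x X a t" and L: "rlim C K A \<alpha> B x L b \<pi>"
  obtains m where "m \<in> F" "Dom C m = X" "Cod C m = L" "b \<cdot> m = t" "\<And>u. u \<in> N x \<Longrightarrow> \<pi> u \<cdot> m = a u"
proof -
  obtain L' b' \<pi>' m where m: "rlim C K A \<alpha> B x L' b' \<pi>'" "m \<in> F" "Dom C m = X" "Cod C m = L'"
     "b' \<cdot> m = t" "\<forall>u \<in> N x. \<pi>' u \<cdot> m = a u"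
    using X unfolding rstep_def by blast
  obtain i where i: "is_iso C i" "i \<in> Ar C" "Dom C i = L'" "Cod C i = L" "b \<cdot> i = b'" "\<And>u. u \<in> N x \<Longrightarrow> \<pi> u \<cdot> i = \<pi>' u"
    using rlim_iso[OF m(1) L A B \<alpha>] by blast
  note R = rconeD[OF rlim_cone[OF L]]
  show thesis
    by (rule that[of "i \<cdot> m"])
      (use m i fib_cmp[of m i] fib_iso[OF i(1)] R(2-4) mconeD(1-4)[OF R(1)] i(5)[THEN cmp_ext] cmp_ext[OF i(6)] in simp_all)
qed

text \<open>A map into the pullback is a map into \<open>L\<close> and a map into \<open>B\<close>
  at \<open>x\<close> that agree in \<open>L'\<close>. Tested against the projections of
  \<open>L'\<close>, this agreement becomes the compatibility clause of \<open>rcone\<close>, so the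
  two universal properties coincide.\<close>

lemma rlim_of_pullback:
  assumes A: "good_below A x" and B: "good B x" "good_below B x" and \<alpha>: "nat_below A \<alpha> B x"
    and L: "mlim C K A x L \<pi>" and L': "mlim C K B x L' \<pi>'"
    and m: "m \<in> Ar C" "Dom C m = L" "Cod C m = L'" "\<And>u. u \<in> N x \<Longrightarrow> \<pi>' u \<cdot> m = \<alpha> (Cod K u) \<cdot> \<pi> u"
    and n: "n \<in> Ar C" "Dom C n = Fob B x" "Cod C n = L'" "\<And>u. u \<in> N x \<Longrightarrow> \<pi>' u \<cdot> n = Far B u"
    and P: "is_pullback C m n p q"
  shows "rlim C K A \<alpha> B x (Dom C p) q (\<lambda>u. \<pi> u \<cdot> p)"
proof -
  note P' = pullbackD[OF P] and M = mconeD[OF mlim_cone[OF L]] and M' = mconeD[OF mlim_cone[OF L']]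
  have a: "u \<in> N x \<Longrightarrow> \<alpha> (Cod K u) \<in> Ar C" "u \<in> N x \<Longrightarrow> Dom C (\<alpha> (Cod K u)) = Fob A (Cod K u)"
     "u \<in> N x \<Longrightarrow> Cod C (\<alpha> (Cod K u)) = Fob B (Cod K u)" for u
    using \<alpha> natD by blast+
  have e: "Far B u \<cdot> q = \<alpha> (Cod K u) \<cdot> (\<pi> u \<cdot> p)" if u: "u \<in> N x" for u
  proof -
    have "Far B u \<cdot> q = \<pi>' u \<cdot> (n \<cdot> q)" using M'(1-4) u n P' by (intro cmp_ext[symmetric]) simp_all
    also have "\<dots> = \<pi>' u \<cdot> (m \<cdot> p)" using P' by simp
    also have "\<dots> = (\<alpha> (Cod K u) \<cdot> \<pi> u) \<cdot> p"
      using M'(1-4) u m P' by (intro cmp_ext) simp_all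
    finally show ?thesis using a M(1-4) m P' u by simp
  qed
  have cone: "rcone C K A \<alpha> B x (Dom C p) q (\<lambda>u. \<pi> u \<cdot> p)"
    unfolding rcone_def using mcone_cmp[OF A mlim_cone[OF L], of p] P' m n e by simp
  show ?thesis
    unfolding rlim_def
  proof (intro conjI allI impI)
    fix T b \<tau> assume T: "rcone C K A \<alpha> B x T b \<tau>"
    note R = rconeD[OF T] and MT = mconeD[OF rconeD(1)[OF T]]
    obtain t where t: "t \<in> Ar C" "Dom C t = T" "Cod C t = L" "\<And>u. u \<in> N x \<Longrightarrow> \<pi> u \<cdot> t = \<tau> u"
      using mlim_obtain[OF L R(1)] by blast
    have "m \<cdot> t = n \<cdot> b"
    proof (rule mlim_unique[OF L' B(2)])
      fix u assume u: "u \<in> N x"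
      have "\<pi>' u \<cdot> (m \<cdot> t) = (\<alpha> (Cod K u) \<cdot> \<pi> u) \<cdot> t"
        using M'(1-4) u m t by (intro cmp_ext) simp_all
      also have "\<dots> = Far B u \<cdot> b"
        using u a[OF u] M(1-4) m t R(5) by simp
      also have "\<dots> = \<pi>' u \<cdot> (n \<cdot> b)"
        using M'(1-4) u n R(2-4) by (intro cmp_ext[symmetric]) simp_all
      finally show "\<pi>' u \<cdot> (m \<cdot> t) = \<pi>' u \<cdot> (n \<cdot> b)" .
    qed (use m n t R(2-4) in simp_all)
    then obtain h where h: "h \<in> Ar C" "Dom C h = T" "Cod C h = Dom C p" "p \<cdot> h = t" "q \<cdot> h = b"
      using pullback_obtain[OF P, of t b] t R(2-4) m n by auto
    show "\<exists>!h. h \<in> hom C T (Dom C p) \<and> q \<cdot> h = b \<and> (\<forall>u\<in>N x. (\<pi> u \<cdot> p) \<cdot> h = \<tau> u)"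
    proof (rule ex1I[of _ h])
      show "h \<in> hom C T (Dom C p) \<and> q \<cdot> h = b \<and> (\<forall>u\<in>N x. (\<pi> u \<cdot> p) \<cdot> h = \<tau> u)"
        using h t M(1-4) P' m by (simp add: hom_def)
    next
      fix k assume k: "k \<in> hom C T (Dom C p) \<and> q \<cdot> k = b \<and> (\<forall>u\<in>N x. (\<pi> u \<cdot> p) \<cdot> k = \<tau> u)"
      then have k': "k \<in> Ar C" "Dom C k = T" "Cod C k = Dom C p" by (auto simp: hom_def)
      have "p \<cdot> k = t"
        by (rule mlim_unique[OF L A]) (use k k' P' m t M(1-4) in simp_all)
      then show "k = h"
        using k k' h by (intro pullback_unique[OF P, of k h]) simp_all
    qed
  qed (rule cone)
qed

text \<open>Some pullback exists and is an \<open>rlim\<close>. Two objects with the same universal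
  property are isomorphic, so the given one is a pullback too.\<close>

lemma pullback_of_rlim:
  assumes A: "good_below A x" and B: "good B x" "good_below B x" and \<alpha>: "nat_below A \<alpha> B x"
    and L: "mlim C K A x L \<pi>" and L': "mlim C K B x L' \<pi>'"
    and m: "m \<in> Ar C" "Dom C m = L" "Cod C m = L'" "\<And>u. u \<in> N x \<Longrightarrow> \<pi>' u \<cdot> m = \<alpha> (Cod K u) \<cdot> \<pi> u"
    and n: "n \<in> Ar C" "Dom C n = Fob B x" "Cod C n = L'" "\<And>u. u \<in> N x \<Longrightarrow> \<pi>' u \<cdot> n = Far B u"
    and P: "has_pullback C m n" and R: "rlim C K A \<alpha> B x T b \<tau>"
  obtains t where "is_pullback C m n t b" "t \<in> Ar C" "Dom C t = T" "Cod C t = L" "\<And>u. u \<in> N x \<Longrightarrow> \<pi> u \<cdot> t = \<tau> u"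
proof -
  note P1 = pb_is_pullback[OF P]
  let ?p = "pb_fst C m n" and ?q = "pb_snd C m n"
  note P' = pullbackD[OF P1] and M = mconeD[OF mlim_cone[OF L]]
  obtain i where i: "is_iso C i" "i \<in> Ar C" "Dom C i = T" "Cod C i = Dom C ?p" "?q \<cdot> i = b"
     "\<And>u. u \<in> N x \<Longrightarrow> (\<pi> u \<cdot> ?p) \<cdot> i = \<tau> u"
    using rlim_iso[OF R rlim_of_pullback[OF A B \<alpha> L L' m n P1] A B(1) \<alpha>] by blast
  have "is_pullback C m n (?p \<cdot> i) b"
    using pullback_cmp_iso[OF P1 i(1,4)] i(5) by simp
  then show thesis
    by (rule that[of "?p \<cdot> i"]) (use i P' m M(1-4) in simp_all)
qed

end

section \<open>Comparison with the chosen limits of the definitions\<close>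

lemma lim_is_limit: "has_limit C J D \<Longrightarrow> is_limit C J D (lim_ob C J D) (lim_proj C J D)"
  unfolding has_limit_def lim_ob_def lim_proj_def lim_cone_def
  by (rule someI2_ex[where P="\<lambda>(L, \<pi>). is_limit C J D L \<pi>"]) auto

lemma lim_induced:
  assumes "has_limit C J D" "is_cone C J D K \<kappa>"
  shows "lim_induced C J D K \<kappa> \<in> hom C K (lim_ob C J D)"
    "j \<in> Ob J \<Longrightarrow> lim_proj C J D j \<cdot>\<^bsub>C\<^esub> lim_induced C J D K \<kappa> = \<kappa> j"
proof -
  have "\<exists>!h. h \<in> hom C K (lim_ob C J D) \<and> (\<forall>j \<in> Ob J. lim_proj C J D j \<cdot>\<^bsub>C\<^esub> h = \<kappa> j)"
    using lim_is_limit[OF assms(1)] assms(2) unfolding is_limit_def by blast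
  from theI'[OF this] show "lim_induced C J D K \<kappa> \<in> hom C K (lim_ob C J D)"
    "j \<in> Ob J \<Longrightarrow> lim_proj C J D j \<cdot>\<^bsub>C\<^esub> lim_induced C J D K \<kappa> = \<kappa> j"
    unfolding lim_induced_def by blast+
qed

lemma strict_coslice_simps:
  "Ob (strict_coslice K x) = nonid K x"
  "Dom (strict_coslice K x) = (\<lambda>(f, k, g). f)"
  "Cod (strict_coslice K x) = (\<lambda>(f, k, g). g)"
  "Ide (strict_coslice K x) = (\<lambda>f. (f, Ide K (Cod K f), f))"
  "Cmp (strict_coslice K x) = (\<lambda>(g, l, h) (f, k, g'). (f, l \<cdot>\<^bsub>K\<^esub> k, h))"
  by (auto simp: strict_coslice_def full_subcategory_def coslice_def nonid_def)

lemma strict_coslice_Ar: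
  "w \<in> Ar (strict_coslice K x) \<longleftrightarrow> (\<exists>f k g. w = (f, k, g) \<and> f \<in> nonid K x \<and> g \<in> nonid K x \<and> k \<in> Ar K \<and>
     Dom K k = Cod K f \<and> Cod K k = Cod K g \<and> k \<cdot>\<^bsub>K\<^esub> f = g)"
  by (cases w) (auto simp: strict_coslice_def full_subcategory_def coslice_def nonid_def hom_def)

lemma category_strict_coslice:
  assumes "category K"
  shows "category (strict_coslice K x)"
proof -
  interpret K: category K by fact
  have hom: "w \<in> hom (strict_coslice K x) f g \<longleftrightarrow> (\<exists>k. w = (f, k, g) \<and> f \<in> nonid K x \<and> g \<in> nonid K x \<and>
      k \<in> Ar K \<and> Dom K k = Cod K f \<and> Cod K k = Cod K g \<and> k \<cdot>\<^bsub>K\<^esub> f = g)" for w f g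
    by (cases w) (auto simp: hom_def strict_coslice_simps strict_coslice_Ar)
  have N: "f \<in> nonid K x \<Longrightarrow> f \<in> Ar K" for f by (simp add: nonid_def)
  show ?thesis
  proof
    fix f assume "f \<in> Ar (strict_coslice K x)"
    then show "Dom (strict_coslice K x) f \<in> Ob (strict_coslice K x)"
      and "Cod (strict_coslice K x) f \<in> Ob (strict_coslice K x)"
      by (auto simp: strict_coslice_simps strict_coslice_Ar)
  next
    fix y assume "y \<in> Ob (strict_coslice K x)"
    then show "Ide (strict_coslice K x) y \<in> hom (strict_coslice K x) y y"
      using N by (simp add: hom strict_coslice_simps)
  next
    fix f g y z w assume "f \<in> hom (strict_coslice K x) y z" "g \<in> hom (strict_coslice K x) z w"
    then obtain k l where "f = (y, k, z)" "g = (z, l, w)" "y \<in> nonid K x" "z \<in> nonid K x" "w \<in> nonid K x"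
      "k \<in> Ar K" "Dom K k = Cod K y" "Cod K k = Cod K z" "k \<cdot>\<^bsub>K\<^esub> y = z"
      "l \<in> Ar K" "Dom K l = Cod K z" "Cod K l = Cod K w" "l \<cdot>\<^bsub>K\<^esub> z = w"
      unfolding hom by blast
    then show "g \<cdot>\<^bsub>strict_coslice K x\<^esub> f \<in> hom (strict_coslice K x) y w"
      using N by (simp add: hom strict_coslice_simps)
  next
    fix f y z assume "f \<in> hom (strict_coslice K x) y z"
    then show "f \<cdot>\<^bsub>strict_coslice K x\<^esub> Ide (strict_coslice K x) y = f"
      "Ide (strict_coslice K x) z \<cdot>\<^bsub>strict_coslice K x\<^esub> f = f"
      unfolding hom by (elim exE; simp add: strict_coslice_simps)+
  next
    fix f g h w y z v assume "f \<in> hom (strict_coslice K x) w y" "g \<in> hom (strict_coslice K x) y z"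
      "h \<in> hom (strict_coslice K x) z v"
    then show "h \<cdot>\<^bsub>strict_coslice K x\<^esub> (g \<cdot>\<^bsub>strict_coslice K x\<^esub> f) = (h \<cdot>\<^bsub>strict_coslice K x\<^esub> g) \<cdot>\<^bsub>strict_coslice K x\<^esub> f"
      unfolding hom by (elim exE; simp add: strict_coslice_simps)
  qed
qed

lemma functor_iff_good:
  assumes "category K"
  shows "is_functor K C A \<longleftrightarrow> Fob A \<in> extensional (Ob K) \<and> Far A \<in> extensional (Ar K) \<and> (\<forall>x \<in> Ob K. good_at C K A x)"
    (is "?L \<longleftrightarrow> ?R")
proof
  interpret K: category K by fact
  assume ?L
  then show ?R unfolding is_functor_def good_at_def by (auto simp: hom_def PiE_iff)
next
  interpret K: category K by fact
  assume R: ?R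
  then have g: "\<And>x. x \<in> Ob K \<Longrightarrow> good_at C K A x" by blast
  show ?L
    unfolding is_functor_def
  proof (intro conjI ballI impI)
    fix u v assume uv: "u \<in> Ar K" "v \<in> Ar K" "Cod K u = Dom K v"
    show "Far A (v \<cdot>\<^bsub>K\<^esub> u) = Far A v \<cdot>\<^bsub>C\<^esub> Far A u"
      using g[of "Dom K u"] uv unfolding good_at_def by auto
  next
    fix u assume u: "u \<in> Ar K"
    show "Far A u \<in> hom C (Fob A (Dom K u)) (Fob A (Cod K u))"
      using g[of "Dom K u"] u unfolding good_at_def by (auto simp: hom_def)
  next
    show "Fob A \<in> Ob K \<rightarrow>\<^sub>E Ob C" using R unfolding good_at_def by (auto simp: PiE_iff)
    have "Far A u \<in> Ar C" if "u \<in> Ar K" for u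
      using g[of "Dom K u"] that unfolding good_at_def by auto
    then show "Far A \<in> Ar K \<rightarrow>\<^sub>E Ar C" using R by (auto simp: PiE_iff)
  next
    fix j assume "j \<in> Ob K" then show "Far A (Ide K j) = Ide C (Fob A j)"
      using g[of j] unfolding good_at_def by auto
  qed
qed

lemma nat_trans_iff_nat:
  assumes "category K"
  shows "is_nat_trans K C A \<alpha> B \<longleftrightarrow> is_functor K C A \<and> is_functor K C B \<and> \<alpha> \<in> extensional (Ob K) \<and>
    (\<forall>x \<in> Ob K. nat_at C K A \<alpha> B x)" (is "?L \<longleftrightarrow> ?R")
proof
  interpret K: category K by fact
  assume ?L
  then show ?R unfolding is_nat_trans_def nat_at_def by (auto simp: hom_def)
next
  interpret K: category K by fact
  assume R: ?R
  have "Far B u \<cdot>\<^bsub>C\<^esub> \<alpha> (Dom K u) = \<alpha> (Cod K u) \<cdot>\<^bsub>C\<^esub> Far A u" if u: "u \<in> Ar K" for u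
  proof -
    have "nat_at C K A \<alpha> B (Dom K u)" using R u by auto
    then show ?thesis using u unfolding nat_at_def by blast
  qed
  then show ?L
    using R unfolding is_nat_trans_def nat_at_def by (auto simp: hom_def)
qed

context diagrams
begin

text \<open>An arrow of the strict coslice out of \<open>f\<close> is determined by its middle
  component \<open>k\<close>, its target being \<open>k\<close> after \<open>f\<close>; so the
  naturality clauses match one by one.\<close>

lemma is_cone_matching:
  "is_cone C (strict_coslice K x) (matching_diagram K A x) L \<pi> \<longleftrightarrow> mcone C K A x L \<pi>"
  unfolding is_cone_def mcone_def strict_coslice_simps
proof (intro conj_cong refl)
  show "(\<forall>j\<in>N x. \<pi> j \<in> hom C L (Fob (matching_diagram K A x) j)) \<longleftrightarrow>
    (\<forall>u\<in>N x. \<pi> u \<in> Ar C \<and> Dom C (\<pi> u) = L \<and> Cod C (\<pi> u) = Fob A (Cod K u))"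
    by (auto simp: matching_diagram_def strict_coslice_simps hom_def)
  have "(f, k, g) \<in> Ar (strict_coslice K x) \<longleftrightarrow> f \<in> N x \<and> k \<in> Ar K \<and> Dom K k = Cod K f \<and> k \<cdot>\<^bsub>K\<^esub> f \<in> N x \<and> g = k \<cdot>\<^bsub>K\<^esub> f" for f k g
    by (auto simp: strict_coslice_Ar nonid_def)
  then show "(\<forall>w\<in>Ar (strict_coslice K x). Far (matching_diagram K A x) w \<cdot> \<pi> ((\<lambda>(f, k, g). f) w) = \<pi> ((\<lambda>(f, k, g). g) w)) \<longleftrightarrow>
    (\<forall>u\<in>N x. \<forall>k\<in>Ar K. Dom K k = Cod K u \<longrightarrow> k \<cdot>\<^bsub>K\<^esub> u \<in> N x \<longrightarrow> Far A k \<cdot> \<pi> u = \<pi> (k \<cdot>\<^bsub>K\<^esub> u))"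
    unfolding Ball_def split_paired_All by (auto simp: matching_diagram_def)
qed

lemma is_limit_matching:
  "is_limit C (strict_coslice K x) (matching_diagram K A x) L \<pi> \<longleftrightarrow> mlim C K A x L \<pi>"
  unfolding is_limit_def mlim_def is_cone_matching strict_coslice_simps ..

lemma has_matching_object_iff: "has_matching_object C K A x \<longleftrightarrow> (\<exists>L \<pi>. mlim C K A x L \<pi>)"
  unfolding has_matching_object_def has_limit_def is_limit_matching ..

abbreviation "mob A x \<equiv> lim_ob C (strict_coslice K x) (matching_diagram K A x)"
abbreviation "mproj A x \<equiv> lim_proj C (strict_coslice K x) (matching_diagram K A x)"

lemma mlim_mob: "has_matching_object C K A x \<Longrightarrow> mlim C K A x (mob A x) (mproj A x)"
  unfolding has_matching_object_def is_limit_matching[symmetric] by (rule lim_is_limit)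

lemma matching_map:
  assumes "has_matching_object C K A x" "good A x"
  shows "matching_map C K A x \<in> Ar C" "Dom C (matching_map C K A x) = Fob A x"
    "Cod C (matching_map C K A x) = mob A x" "u \<in> N x \<Longrightarrow> mproj A x u \<cdot> matching_map C K A x = Far A u"
  using lim_induced[of C "strict_coslice K x" "matching_diagram K A x" "Fob A x" "Far A"] assms
    mcone_good[OF assms(2)]
  unfolding has_matching_object_def matching_map_def is_cone_matching
  by (auto simp: hom_def strict_coslice_simps)

lemma fibrant_at_iff:
  assumes A: "good A x" "good_below A x"
  shows "has_matching_object C K A x \<and> matching_map C K A x \<in> F \<longleftrightarrow> fibrant_at C F K A x"
proof
  assume "has_matching_object C K A x \<and> matching_map C K A x \<in> F"
  then show "fibrant_at C F K A x"
    using matching_map[of A x] mlim_mob[of A x] A unfolding mstep_def by blast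
next
  assume f: "fibrant_at C F K A x"
  then have h: "has_matching_object C K A x"
    unfolding has_matching_object_iff mstep_def by blast
  note L = mlim_mob[OF h] and M = matching_map[OF h A(1)]
  obtain m where m: "m \<in> F" "Dom C m = Fob A x" "Cod C m = mob A x" "\<And>u. u \<in> N x \<Longrightarrow> mproj A x u \<cdot> m = Far A u"
    using mstep_any[OF A(2) f L] by blast
  have "m = matching_map C K A x"
    by (rule mlim_unique[OF L A(2)]) (use m M in simp_all)
  with h m show "has_matching_object C K A x \<and> matching_map C K A x \<in> F" by blast
qed

lemma mcone_trans:
  assumes A: "good_below A x" and B: "good_below B x" and \<alpha>: "nat_below A \<alpha> B x" and L: "mcone C K A x L \<pi>"
  shows "mcone C K B x L (\<lambda>u. \<alpha> (Cod K u) \<cdot> \<pi> u)"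
  unfolding mcone_def
proof (intro conjI ballI impI)
  note M = mconeD[OF L]
  have a: "u \<in> N x \<Longrightarrow> \<alpha> (Cod K u) \<in> Ar C" "u \<in> N x \<Longrightarrow> Dom C (\<alpha> (Cod K u)) = Fob A (Cod K u)"
     "u \<in> N x \<Longrightarrow> Cod C (\<alpha> (Cod K u)) = Fob B (Cod K u)" for u
    using \<alpha> natD by blast+
  fix u assume u: "u \<in> N x"
  show "\<alpha> (Cod K u) \<cdot> \<pi> u \<in> Ar C" "Dom C (\<alpha> (Cod K u) \<cdot> \<pi> u) = L" "Cod C (\<alpha> (Cod K u) \<cdot> \<pi> u) = Fob B (Cod K u)"
    using a[OF u] M(1-4) u by simp_all
  fix k assume k: "k \<in> Ar K" "Dom K k = Cod K u" "k \<cdot>\<^bsub>K\<^esub> u \<in> N x"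
  have "Far B k \<cdot> (\<alpha> (Cod K u) \<cdot> \<pi> u) = (\<alpha> (Cod K k) \<cdot> Far A k) \<cdot> \<pi> u"
    using natD(4)[of A \<alpha> B "Cod K u" k] \<alpha> k u a[OF u] M(2-4)[OF u] good_belowD(2-4)[OF B u k(1,2)]
    by (intro cmp_ext) auto
  also have "\<dots> = \<alpha> (Cod K k) \<cdot> (Far A k \<cdot> \<pi> u)"
    using k u a[OF k(3)] M(2-4)[OF u] good_belowD(2-4)[OF A u k(1,2)] nonidD[OF u]
    by (intro assoc) auto
  also have "\<dots> = \<alpha> (Cod K (k \<cdot>\<^bsub>K\<^esub> u)) \<cdot> \<pi> (k \<cdot>\<^bsub>K\<^esub> u)"
    using M(5)[OF u k] k nonidD[OF u] by simp
  finally show "Far B k \<cdot> (\<alpha> (Cod K u) \<cdot> \<pi> u) = \<alpha> (Cod K (k \<cdot>\<^bsub>K\<^esub> u)) \<cdot> \<pi> (k \<cdot>\<^bsub>K\<^esub> u)" .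
qed (use mconeD(1)[OF L] in simp)

lemma matching_trans:
  assumes A: "good_below A x" and B: "good_below B x" and \<alpha>: "nat_below A \<alpha> B x"
    and h: "has_matching_object C K A x" "has_matching_object C K B x"
  shows "matching_trans C K (A, \<alpha>, B) x \<in> Ar C" "Dom C (matching_trans C K (A, \<alpha>, B) x) = mob A x"
    "Cod C (matching_trans C K (A, \<alpha>, B) x) = mob B x"
    "u \<in> N x \<Longrightarrow> mproj B x u \<cdot> matching_trans C K (A, \<alpha>, B) x = \<alpha> (Cod K u) \<cdot> mproj A x u"
proof -
  let ?\<kappa> = "\<lambda>j. (\<lambda>f \<in> Ob (strict_coslice K x). \<alpha> (Cod K f)) j \<cdot> mproj A x j"
  have "mcone C K B x (mob A x) ?\<kappa> \<longleftrightarrow> mcone C K B x (mob A x) (\<lambda>u. \<alpha> (Cod K u) \<cdot> mproj A x u)"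
    by (rule mcone_cong) (simp add: strict_coslice_simps)
  then have c: "is_cone C (strict_coslice K x) (matching_diagram K B x) (mob A x) ?\<kappa>"
    using mcone_trans[OF A B \<alpha> mlim_cone[OF mlim_mob[OF h(1)]]] unfolding is_cone_matching by blast
  have e: "matching_trans C K (A, \<alpha>, B) x = lim_induced C (strict_coslice K x) (matching_diagram K B x) (mob A x) ?\<kappa>"
    by (simp add: matching_trans_def lim_map_def)
  note l = lim_induced[OF h(2)[unfolded has_matching_object_def] c, folded e]
  show "matching_trans C K (A, \<alpha>, B) x \<in> Ar C" "Dom C (matching_trans C K (A, \<alpha>, B) x) = mob A x"
    "Cod C (matching_trans C K (A, \<alpha>, B) x) = mob B x"
    using l(1) by (auto simp: hom_def)
  show "mproj B x u \<cdot> matching_trans C K (A, \<alpha>, B) x = \<alpha> (Cod K u) \<cdot> mproj A x u" if "u \<in> N x"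
    using l(2)[of u] that by (simp add: strict_coslice_simps)
qed

text \<open>The chosen pullback of matching objects is an \<open>rlim\<close>, and its induced map
  is the only one with the prescribed composites. The fibration supplied by \<open>rstep\<close>,
  moved to this \<open>rlim\<close>, must therefore be that map.\<close>

lemma rfib_at_iff:
  assumes A: "good A x" "good_below A x" and B: "good B x" "good_below B x"
    and \<alpha>: "natu A \<alpha> B x" "nat_below A \<alpha> B x"
    and hA: "has_matching_object C K A x" and hB: "has_matching_object C K B x" "matching_map C K B x \<in> F"
  shows "has_pullback C (matching_trans C K (A, \<alpha>, B) x) (matching_map C K B x) \<and>
      pb_induced C (matching_trans C K (A, \<alpha>, B) x) (matching_map C K B x) (matching_map C K A x) (\<alpha> x) \<in> F
    \<longleftrightarrow> rfib_at C F K A \<alpha> B x"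
proof -
  let ?m = "matching_trans C K (A, \<alpha>, B) x" and ?n = "matching_map C K B x" and ?a = "matching_map C K A x"
  note m = matching_trans[OF A(2) B(2) \<alpha>(2) hA hB(1)] and n = matching_map[OF hB(1) B(1)] and a = matching_map[OF hA A(1)]
  note LA = mlim_mob[OF hA] and LB = mlim_mob[OF hB(1)]
  note MA = mconeD[OF mlim_cone[OF LA]] and MB = mconeD[OF mlim_cone[OF LB]]
  note al = natD[OF \<alpha>(1)]
  have hp: "has_pullback C ?m ?n" using fib_has_pullback(1)[OF hB(2)] m n by simp
  note P = pb_is_pullback[OF hp]
  note P' = pullbackD[OF P]
  note R = rlim_of_pullback[OF A(2) B \<alpha>(2) LA LB m n P]
  have "?m \<cdot> ?a = ?n \<cdot> \<alpha> x"
  proof (rule mlim_unique[OF LB B(2)])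
    fix u assume u: "u \<in> N x"
    have al': "\<alpha> (Cod K u) \<in> Ar C" "Dom C (\<alpha> (Cod K u)) = Fob A (Cod K u)" using \<alpha>(2) u natD by blast+
    have "mproj B x u \<cdot> (?m \<cdot> ?a) = (\<alpha> (Cod K u) \<cdot> mproj A x u) \<cdot> ?a"
      using MB(1-4) u m a by (intro cmp_ext) simp_all
    also have "\<dots> = \<alpha> (Cod K u) \<cdot> Far A u" using MA(1-4) u a al' by simp
    also have "\<dots> = Far B u \<cdot> \<alpha> x" using al(4) nonidD[OF u] by simp
    also have "\<dots> = mproj B x u \<cdot> (?n \<cdot> \<alpha> x)"
      using MB(1-4) u n al by (intro cmp_ext[symmetric]) simp_all
    finally show "mproj B x u \<cdot> (?m \<cdot> ?a) = mproj B x u \<cdot> (?n \<cdot> \<alpha> x)" .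
  qed (use m n a al in simp_all)
  then have h: "pb_induced C ?m ?n ?a (\<alpha> x) \<in> Ar C" "Dom C (pb_induced C ?m ?n ?a (\<alpha> x)) = Fob A x"
    "Cod C (pb_induced C ?m ?n ?a (\<alpha> x)) = Dom C (pb_fst C ?m ?n)"
    "pb_fst C ?m ?n \<cdot> pb_induced C ?m ?n ?a (\<alpha> x) = ?a" "pb_snd C ?m ?n \<cdot> pb_induced C ?m ?n ?a (\<alpha> x) = \<alpha> x"
    using pb_induced[OF hp, of ?a "\<alpha> x"] m n a al by simp_all
  have hu: "(mproj A x u \<cdot> pb_fst C ?m ?n) \<cdot> pb_induced C ?m ?n ?a (\<alpha> x) = Far A u" if "u \<in> N x" for u
    using h P' MA(1-4) that m a by simp
  show ?thesis
  proof
    assume "has_pullback C ?m ?n \<and> pb_induced C ?m ?n ?a (\<alpha> x) \<in> F"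
    then show "rfib_at C F K A \<alpha> B x"
      using R h hu unfolding rstep_def by blast
  next
    assume f: "rfib_at C F K A \<alpha> B x"
    obtain k where k: "k \<in> F" "Dom C k = Fob A x" "Cod C k = Dom C (pb_fst C ?m ?n)" "pb_snd C ?m ?n \<cdot> k = \<alpha> x"
      "\<And>u. u \<in> N x \<Longrightarrow> (mproj A x u \<cdot> pb_fst C ?m ?n) \<cdot> k = Far A u"
      using rstep_any[OF A(2) B(1) \<alpha>(2) f R] by blast
    have "k = pb_induced C ?m ?n ?a (\<alpha> x)"
      by (rule rlim_unique[OF R A(2) B(1) \<alpha>(2)]) (use k h hu in simp_all)
    then show "has_pullback C ?m ?n \<and> pb_induced C ?m ?n ?a (\<alpha> x) \<in> F"
      using k(1) hp by simp
  qed
qed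

lemma functorD:
  assumes "is_functor K C A"
  shows "x \<in> Ob K \<Longrightarrow> good A x" "good_below A x"
  using assms unfolding functor_iff_good[OF K.category_axioms] by (auto simp: nonid_def)

lemma natural_transD:
  assumes "is_nat_trans K C A \<alpha> B"
  shows "is_functor K C A" "is_functor K C B" "x \<in> Ob K \<Longrightarrow> natu A \<alpha> B x" "nat_below A \<alpha> B x"
  using assms unfolding nat_trans_iff_nat[OF K.category_axioms] by (auto simp: nonid_def)

lemma reedy_fibrant_iff:
  "reedy_fibrant C F K A \<longleftrightarrow> is_functor K C A \<and> (\<forall>x \<in> Ob K. fibrant_at C F K A x)"
proof -
  have "has_matching_object C K A x \<and> matching_map C K A x \<in> F \<longleftrightarrow> fibrant_at C F K A x"
    if "is_functor K C A" "x \<in> Ob K" for x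
    by (rule fibrant_at_iff[OF functorD[OF that(1)]]) (rule that(2))
  then show ?thesis unfolding reedy_fibrant_def functor_cat_def by (auto cong: ball_cong)
qed

lemma reedy_Ob: "A \<in> Ob (reedy_cat C F K) \<longleftrightarrow> reedy_fibrant C F K A"
  by (auto simp: reedy_cat_def full_subcategory_def reedy_fibrant_def)

lemma reedy_Ar: "(A, \<alpha>, B) \<in> Ar (reedy_cat C F K) \<longleftrightarrow>
    reedy_fibrant C F K A \<and> reedy_fibrant C F K B \<and> is_nat_trans K C A \<alpha> B"
  by (auto simp: reedy_cat_def full_subcategory_def functor_cat_def)

lemma reedy_fibration_iff:
  assumes "reedy_fibrant C F K A" "reedy_fibrant C F K B" "is_nat_trans K C A \<alpha> B"
  shows "reedy_fibration C F K (A, \<alpha>, B) \<longleftrightarrow> (\<forall>x \<in> Ob K. rfib_at C F K A \<alpha> B x)"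
proof -
  have 1: "(A, \<alpha>, B) \<in> Ar (functor_cat K C)" using assms(3) by (simp add: functor_cat_def)
  have A: "has_matching_object C K A x" and B: "has_matching_object C K B x" "matching_map C K B x \<in> F"
    if "x \<in> Ob K" for x
    using assms(1,2) that unfolding reedy_fibrant_def by blast+
  note f = natural_transD[OF assms(3)]
  show ?thesis
    unfolding reedy_fibration_def
    using 1 A B rfib_at_iff[OF functorD[OF f(1)] functorD[OF f(2)] f(3,4) A B] by auto
qed

lemma reedy_fibrations_iff:
  "(A, \<alpha>, B) \<in> reedy_fibrations C F K \<longleftrightarrow> reedy_fibrant C F K A \<and> reedy_fibrant C F K B \<and>
     is_nat_trans K C A \<alpha> B \<and> (\<forall>x \<in> Ob K. rfib_at C F K A \<alpha> B x)"
  unfolding reedy_fibrations_def using reedy_Ar reedy_fibration_iff by auto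

end

subsection \<open>Restriction to strict coslices\<close>

locale inverse_diagrams = diagrams C F K
  for C :: "('o, 'a) cat" (structure) and F :: "'a set" and K :: "('i, 'j) cat" +
  assumes inverse: "inverse_category K" and admissible: "admissible C F K"
begin

definition prec :: "('i \<times> 'i) set" where
  "prec = {(y, x). \<exists>u \<in> N x. y = Cod K u}"

lemma wf_prec: "wf prec"
proof -
  have "prec \<subseteq> {(y, x). x \<in> Ob K \<and> y \<in> Ob K \<and> (\<exists>f \<in> hom K x y. \<forall>z \<in> Ob K. f \<noteq> Ide K z)}"
    unfolding prec_def nonid_def by (auto simp: hom_def)
  then show ?thesis using inverse wf_subset unfolding inverse_category_def by blast
qed

lemma prec_induct: "(\<And>x. (\<And>u. u \<in> N x \<Longrightarrow> P (Cod K u)) \<Longrightarrow> P x) \<Longrightarrow> P x"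
  by (rule wf_induct_rule[OF wf_prec, of P]) (auto simp: prec_def)

text \<open>If the composite were an identity, \<open>k\<close> could not be one, so
  \<open>u\<close> and \<open>k\<close> would be nonidentity arrows in opposite directions, a cycle
  in a well-founded relation. Consequently whatever is below an object below \<open>x\<close> is
  itself below \<open>x\<close>.\<close>

lemma nonid_cmp:
  assumes u: "u \<in> N x" and k: "k \<in> Ar K" "Dom K k = Cod K u"
  shows "k \<cdot>\<^bsub>K\<^esub> u \<in> N x"
proof (rule ccontr)
  assume "k \<cdot>\<^bsub>K\<^esub> u \<notin> N x"
  note u' = nonidD[OF u]
  have x: "x \<in> Ob K" using u' K.dom_ob' by blast
  have e: "k \<cdot>\<^bsub>K\<^esub> u = Ide K x"
    using \<open>k \<cdot>\<^bsub>K\<^esub> u \<notin> N x\<close> u' k by (auto simp: nonid_def)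
  have c: "Cod K k = x"
    using arg_cong[OF e, of "Cod K"] u' k x by simp
  have "k \<noteq> Ide K (Cod K u)"
    using e u u' k by (auto simp: nonid_def)
  then have "(x, Cod K u) \<in> prec" using k c by (auto simp: prec_def nonid_def)
  moreover have "(Cod K u, x) \<in> prec" using u by (auto simp: prec_def)
  ultimately show False using wf_asym[OF wf_prec] by blast
qed

lemma mconeD':
  assumes "mcone C K A x L \<pi>"
  shows "u \<in> N x \<Longrightarrow> k \<in> Ar K \<Longrightarrow> Dom K k = Cod K u \<Longrightarrow> Far A k \<cdot> \<pi> u = \<pi> (k \<cdot>\<^bsub>K\<^esub> u)"
  using mconeD(5)[OF assms] nonid_cmp by blast

abbreviation "fibrant_below A x \<equiv> \<forall>u \<in> nonid K x. fibrant_at C F K A (Cod K u)"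
abbreviation "rfib_below A \<alpha> B x \<equiv> \<forall>u \<in> nonid K x. rfib_at C F K A \<alpha> B (Cod K u)"

abbreviation restr :: "('i \<Rightarrow> 'a) \<Rightarrow> 'i \<Rightarrow> 'j \<Rightarrow> 'a" where
  "restr \<alpha> x \<equiv> (\<lambda>f \<in> Ob (strict_coslice K x). \<alpha> (Cod K f))"

context
  fixes x :: 'i and f :: 'j
  assumes f: "f \<in> N x"
begin

interpretation J: diagrams C F "strict_coslice K x"
  using category_strict_coslice[OF K.category_axioms] type_theoretic_fibration_category_axioms
  by (simp add: diagrams_def)

abbreviation "lift k \<equiv> (f, k, k \<cdot>\<^bsub>K\<^esub> f)"

lemma md_Fob: "g \<in> N x \<Longrightarrow> Fob (matching_diagram K A x) g = Fob A (Cod K g)"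
  by (simp add: matching_diagram_def strict_coslice_simps)

lemma md_Far: "(g, k, h) \<in> Ar (strict_coslice K x) \<Longrightarrow> Far (matching_diagram K A x) (g, k, h) = Far A k"
  by (simp add: matching_diagram_def)

lemma coslice_arrows_from:
  assumes g: "g \<in> N x"
  shows "(w \<in> Ar (strict_coslice K x) \<and> Dom (strict_coslice K x) w = g) \<longleftrightarrow>
    (\<exists>k \<in> Ar K. Dom K k = Cod K g \<and> w = (g, k, k \<cdot>\<^bsub>K\<^esub> g))" (is "?L \<longleftrightarrow> ?R")
proof
  assume ?L
  then show ?R by (auto simp: strict_coslice_Ar strict_coslice_simps)
next
  assume ?R
  then obtain k where k: "k \<in> Ar K" "Dom K k = Cod K g" "w = (g, k, k \<cdot>\<^bsub>K\<^esub> g)" by blast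
  then show ?L
    using g nonid_cmp[OF g k(1,2)] nonidD[OF g] by (simp add: strict_coslice_Ar strict_coslice_simps)
qed

lemma lift_Ar: "k \<in> Ar K \<Longrightarrow> Dom K k = Cod K f \<Longrightarrow> lift k \<in> Ar (strict_coslice K x)"
  using coslice_arrows_from[OF f, of "lift k"] by blast

text \<open>The strict coslice of \<open>x//K\<close> at \<open>f\<close> is that of
  \<open>K\<close> at the target of \<open>f\<close>. Matching objects of a restricted diagram are
  therefore matching objects of the original one, which is why restriction preserves the Reedy
  conditions.\<close>

lemma nonid_strict_coslice: "nonid (strict_coslice K x) f = lift ` N (Cod K f)"
proof (intro set_eqI iffI)
  note f' = nonidD[OF f]
  fix w assume w: "w \<in> nonid (strict_coslice K x) f"
  then have "w \<in> Ar (strict_coslice K x) \<and> Dom (strict_coslice K x) w = f" "w \<noteq> (f, Ide K (Cod K f), f)"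
    by (simp_all add: nonid_def strict_coslice_simps)
  then obtain k where k: "k \<in> Ar K" "Dom K k = Cod K f" "w = lift k"
    using coslice_arrows_from[OF f] by blast
  with \<open>w \<noteq> (f, Ide K (Cod K f), f)\<close> have "k \<in> N (Cod K f)" using f' by (auto simp: nonid_def)
  then show "w \<in> lift ` N (Cod K f)" using k by blast
next
  fix w assume "w \<in> lift ` N (Cod K f)"
  then obtain k where k: "k \<in> N (Cod K f)" "w = lift k" by blast
  note k' = nonidD[OF k(1)]
  have "w \<in> Ar (strict_coslice K x) \<and> Dom (strict_coslice K x) w = f"
    using coslice_arrows_from[OF f] k k' by blast
  then show "w \<in> nonid (strict_coslice K x) f"
    using k by (simp add: nonid_def strict_coslice_simps)
qed

lemma mcone_restrict:
  "mcone C (strict_coslice K x) (matching_diagram K A x) f L \<pi> \<longleftrightarrow>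
   mcone C K A (Cod K f) L (\<lambda>k. \<pi> (lift k))"
proof -
  note f' = nonidD[OF f]
  have 1: "Fob (matching_diagram K A x) (Cod (strict_coslice K x) (lift k)) = Fob A (Cod K k)"
    if "k \<in> N (Cod K f)" for k
    using that nonid_cmp[OF f, of k] f' nonidD[OF that] by (simp add: strict_coslice_simps md_Fob)
  have 2: "(\<forall>l\<in>Ar (strict_coslice K x). Dom (strict_coslice K x) l = Cod (strict_coslice K x) (lift k) \<longrightarrow>
      l \<cdot>\<^bsub>strict_coslice K x\<^esub> lift k \<in> nonid (strict_coslice K x) f \<longrightarrow>
      Far (matching_diagram K A x) l \<cdot> \<pi> (lift k) = \<pi> (l \<cdot>\<^bsub>strict_coslice K x\<^esub> lift k)) \<longleftrightarrow>
      (\<forall>l\<in>Ar K. Dom K l = Cod K k \<longrightarrow> l \<cdot>\<^bsub>K\<^esub> k \<in> N (Cod K f) \<longrightarrow> Far A l \<cdot> \<pi> (lift k) = \<pi> (lift (l \<cdot>\<^bsub>K\<^esub> k)))"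
    (is "?L \<longleftrightarrow> ?R") if k: "k \<in> N (Cod K f)" for k
  proof -
    note k' = nonidD[OF k]
    have g: "k \<cdot>\<^bsub>K\<^esub> f \<in> N x" using nonid_cmp[OF f] k' by simp
    have ar: "(k \<cdot>\<^bsub>K\<^esub> f, l, l \<cdot>\<^bsub>K\<^esub> (k \<cdot>\<^bsub>K\<^esub> f)) \<in> Ar (strict_coslice K x)" "lift (l \<cdot>\<^bsub>K\<^esub> k) \<in> nonid (strict_coslice K x) f"
      if "l \<in> Ar K" "Dom K l = Cod K k" for l
      using that g k' f' nonid_cmp[OF g, of l] nonid_cmp[OF k, of l] by (auto simp: strict_coslice_Ar nonid_strict_coslice)
    have "?L \<longleftrightarrow> (\<forall>l \<in> Ar K. Dom K l = Cod K k \<longrightarrow>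
        Far (matching_diagram K A x) (k \<cdot>\<^bsub>K\<^esub> f, l, l \<cdot>\<^bsub>K\<^esub> (k \<cdot>\<^bsub>K\<^esub> f)) \<cdot> \<pi> (lift k) = \<pi> (lift (l \<cdot>\<^bsub>K\<^esub> k)))"
      (is "_ \<longleftrightarrow> ?M")
    proof
      assume L: ?L
      show ?M
      proof (intro ballI impI)
        fix l assume l: "l \<in> Ar K" "Dom K l = Cod K k"
        have e: "(k \<cdot>\<^bsub>K\<^esub> f, l, l \<cdot>\<^bsub>K\<^esub> (k \<cdot>\<^bsub>K\<^esub> f)) \<cdot>\<^bsub>strict_coslice K x\<^esub> lift k = lift (l \<cdot>\<^bsub>K\<^esub> k)"
          using l k' f' by (simp add: strict_coslice_simps)
        show "Far (matching_diagram K A x) (k \<cdot>\<^bsub>K\<^esub> f, l, l \<cdot>\<^bsub>K\<^esub> (k \<cdot>\<^bsub>K\<^esub> f)) \<cdot> \<pi> (lift k) = \<pi> (lift (l \<cdot>\<^bsub>K\<^esub> k))"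
          using L[rule_format, OF ar(1)[OF l]] e ar(2)[OF l] by (simp add: strict_coslice_simps(2,3))
      qed
    next
      assume M: ?M
      show ?L
      proof (intro ballI impI)
        fix w assume w: "w \<in> Ar (strict_coslice K x)" "Dom (strict_coslice K x) w = Cod (strict_coslice K x) (lift k)"
        then obtain l where l: "l \<in> Ar K" "Dom K l = Cod K k" "w = (k \<cdot>\<^bsub>K\<^esub> f, l, l \<cdot>\<^bsub>K\<^esub> (k \<cdot>\<^bsub>K\<^esub> f))"
          using coslice_arrows_from[OF g, of w] k' f' by (auto simp: strict_coslice_simps)
        have e: "w \<cdot>\<^bsub>strict_coslice K x\<^esub> lift k = lift (l \<cdot>\<^bsub>K\<^esub> k)"
          using l k' f' by (simp add: strict_coslice_simps)
        show "Far (matching_diagram K A x) w \<cdot> \<pi> (lift k) = \<pi> (w \<cdot>\<^bsub>strict_coslice K x\<^esub> lift k)"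
          unfolding e using M l by simp
      qed
    qed
    also have "\<dots> \<longleftrightarrow> (\<forall>l \<in> Ar K. Dom K l = Cod K k \<longrightarrow> Far A l \<cdot> \<pi> (lift k) = \<pi> (lift (l \<cdot>\<^bsub>K\<^esub> k)))"
      by (intro ball_cong imp_cong refl) (simp only: md_Far[OF ar(1)])
    also have "\<dots> \<longleftrightarrow> ?R"
      using nonid_cmp[OF k] by blast
    finally show ?thesis .
  qed
  show ?thesis
    unfolding mcone_def nonid_strict_coslice ball_simps(9)
    by (intro conj_cong refl ball_cong) (use 1 2[unfolded nonid_strict_coslice] in simp_all)
qed

text \<open>Arrows of the strict coslice are triples; \<open>fst (snd w)\<close> is the middle
  component, so this reindexes \<open>\<rho>\<close> along the inverse of
  \<open>lift\<close>.\<close>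

lemma mlim_restrict:
  assumes L: "mlim C K A (Cod K f) L \<rho>"
  shows "mlim C (strict_coslice K x) (matching_diagram K A x) f L (\<lambda>w. \<rho> (fst (snd w)))"
  using L unfolding mlim_def mcone_restrict nonid_strict_coslice by simp

lemma rcone_restrict:
  "rcone C (strict_coslice K x) (matching_diagram K A x) (restr \<alpha> x) (matching_diagram K B x) f L b \<pi> \<longleftrightarrow>
   rcone C K A \<alpha> B (Cod K f) L b (\<lambda>k. \<pi> (lift k))"
proof -
  have 1: "Far (matching_diagram K B x) (lift k) = Far B k" "restr \<alpha> x (Cod (strict_coslice K x) (lift k)) = \<alpha> (Cod K k)"
    if "k \<in> N (Cod K f)" for k
    using that nonid_cmp[OF f, of k] lift_Ar[of k] nonidD[OF that] nonidD[OF f] by (simp_all add: strict_coslice_simps md_Far)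
  show ?thesis
    unfolding rcone_def mcone_restrict nonid_strict_coslice ball_simps(9)
    by (intro conj_cong refl ball_cong) (use 1 in \<open>simp_all add: md_Fob[OF f]\<close>)
qed

lemma rlim_restrict:
  assumes L: "rlim C K A \<alpha> B (Cod K f) L b \<rho>"
  shows "rlim C (strict_coslice K x) (matching_diagram K A x) (restr \<alpha> x) (matching_diagram K B x) f L b
    (\<lambda>w. \<rho> (fst (snd w)))"
  using L unfolding rlim_def rcone_restrict nonid_strict_coslice by simp

lemma fibrant_restrict:
  assumes "fibrant_at C F K A (Cod K f)"
  shows "fibrant_at C F (strict_coslice K x) (matching_diagram K A x) f"
proof -
  obtain L \<pi> m where m: "mlim C K A (Cod K f) L \<pi>" "m \<in> F" "Dom C m = Fob A (Cod K f)" "Cod C m = L"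
    "\<forall>u \<in> N (Cod K f). \<pi> u \<cdot> m = Far A u"
    using assms unfolding mstep_def by blast
  have "\<forall>w \<in> nonid (strict_coslice K x) f. \<pi> (fst (snd w)) \<cdot> m = Far (matching_diagram K A x) w"
    unfolding nonid_strict_coslice
    using m(5) by (auto simp: md_Far[OF lift_Ar[OF nonidD(1)[of _ "Cod K f"] nonidD(2)]])
  then show ?thesis
    unfolding mstep_def using mlim_restrict[OF m(1)] m(2-4) md_Fob[OF f, of A] by metis
qed

lemma rfib_restrict:
  assumes "rfib_at C F K A \<alpha> B (Cod K f)"
  shows "rfib_at C F (strict_coslice K x) (matching_diagram K A x) (restr \<alpha> x) (matching_diagram K B x) f"
proof -
  obtain L b \<pi> m where m: "rlim C K A \<alpha> B (Cod K f) L b \<pi>" "m \<in> F" "Dom C m = Fob A (Cod K f)" "Cod C m = L"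
    "b \<cdot> m = \<alpha> (Cod K f)" "\<forall>u \<in> N (Cod K f). \<pi> u \<cdot> m = Far A u"
    using assms unfolding rstep_def by blast
  have "\<forall>w \<in> nonid (strict_coslice K x) f. \<pi> (fst (snd w)) \<cdot> m = Far (matching_diagram K A x) w"
    unfolding nonid_strict_coslice
    using m(6) by (auto simp: md_Far[OF lift_Ar[OF nonidD(1)[of _ "Cod K f"] nonidD(2)]])
  moreover have "restr \<alpha> x f = \<alpha> (Cod K f)" using f by (simp add: strict_coslice_simps)
  ultimately show ?thesis
    unfolding rstep_def using rlim_restrict[OF m(1)] m(2-5) md_Fob[OF f, of A] by metis
qed

lemma good_restrict:
  assumes "good A (Cod K f)"
  shows "good_at C (strict_coslice K x) (matching_diagram K A x) f"
  unfolding good_at_def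
proof (intro conjI ballI impI)
  note f' = nonidD[OF f] and A = goodD[OF assms]
  show "Fob (matching_diagram K A x) f \<in> Ob C" using A by (simp add: md_Fob[OF f])
  show "Far (matching_diagram K A x) (Ide (strict_coslice K x) f) = Ide C (Fob (matching_diagram K A x) f)"
    using A lift_Ar[of "Ide K (Cod K f)"] f' by (simp add: strict_coslice_simps md_Far md_Fob[OF f])
  fix w assume w: "w \<in> Ar (strict_coslice K x)" "Dom (strict_coslice K x) w = f"
  then obtain k where k: "k \<in> Ar K" "Dom K k = Cod K f" "w = lift k"
    using coslice_arrows_from[OF f] by blast
  have kf: "k \<cdot>\<^bsub>K\<^esub> f \<in> N x" using nonid_cmp[OF f] k by simp
  note W = md_Far[OF lift_Ar[OF k(1,2)], of A] md_Fob[OF kf, of A] md_Fob[OF f, of A]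
  show "Far (matching_diagram K A x) w \<in> Ar C"
    "Dom C (Far (matching_diagram K A x) w) = Fob (matching_diagram K A x) f"
    "Cod C (Far (matching_diagram K A x) w) = Fob (matching_diagram K A x) (Cod (strict_coslice K x) w)"
    using W k A(2-4)[of k] f' by (simp_all add: strict_coslice_simps)
  fix v assume v: "v \<in> Ar (strict_coslice K x)" "Dom (strict_coslice K x) v = Cod (strict_coslice K x) w"
  then obtain l where l: "l \<in> Ar K" "Dom K l = Cod K k" "v = (k \<cdot>\<^bsub>K\<^esub> f, l, l \<cdot>\<^bsub>K\<^esub> (k \<cdot>\<^bsub>K\<^esub> f))"
    using coslice_arrows_from[OF kf, of v] k f' by (auto simp: strict_coslice_simps)
  have e: "v \<cdot>\<^bsub>strict_coslice K x\<^esub> w = lift (l \<cdot>\<^bsub>K\<^esub> k)"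
    using l k f' by (simp add: strict_coslice_simps)
  show "Far (matching_diagram K A x) (v \<cdot>\<^bsub>strict_coslice K x\<^esub> w) =
      Far (matching_diagram K A x) v \<cdot> Far (matching_diagram K A x) w"
    unfolding e using A(6)[OF k(1) l(1) k(2) l(2)] lift_Ar[of "l \<cdot>\<^bsub>K\<^esub> k"] W v(1) l k f' by (simp add: md_Far)
qed

lemma nat_restrict:
  assumes "natu A \<alpha> B (Cod K f)"
  shows "nat_at C (strict_coslice K x) (matching_diagram K A x) (restr \<alpha> x) (matching_diagram K B x) f"
  unfolding nat_at_def
proof (intro conjI ballI impI)
  note f' = nonidD[OF f] and a = natD[OF assms]
  have r: "restr \<alpha> x g = \<alpha> (Cod K g)" if "g \<in> N x" for g using that by (simp add: strict_coslice_simps)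
  show "restr \<alpha> x f \<in> Ar C" "Dom C (restr \<alpha> x f) = Fob (matching_diagram K A x) f"
    "Cod C (restr \<alpha> x f) = Fob (matching_diagram K B x) f"
    using a r[OF f] by (simp_all add: md_Fob[OF f])
  fix w assume w: "w \<in> Ar (strict_coslice K x)" "Dom (strict_coslice K x) w = f"
  then obtain k where k: "k \<in> Ar K" "Dom K k = Cod K f" "w = lift k"
    using coslice_arrows_from[OF f] by blast
  have kf: "k \<cdot>\<^bsub>K\<^esub> f \<in> N x" using nonid_cmp[OF f] k by simp
  show "Far (matching_diagram K B x) w \<cdot> restr \<alpha> x f =
      restr \<alpha> x (Cod (strict_coslice K x) w) \<cdot> Far (matching_diagram K A x) w"
    using a(4)[OF k(1,2)] k f' r[OF f] r[OF kf] by (simp add: strict_coslice_simps md_Far[OF lift_Ar[OF k(1,2)]])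
qed

end

text \<open>The restricted diagram sees only the targets of nonidentity arrows out of
  \<open>x\<close>. Nothing is required of \<open>A\<close> at \<open>x\<close> itself, so this can
  be used in the middle of a recursion.\<close>

lemma reedy_fibrant_restrict:
  assumes A: "good_below A x" "fibrant_below A x"
  shows "reedy_fibrant C F (strict_coslice K x) (matching_diagram K A x)"
proof -
  interpret J: diagrams C F "strict_coslice K x"
    using category_strict_coslice[OF K.category_axioms] type_theoretic_fibration_category_axioms
    by (simp add: diagrams_def)
  show ?thesis
    unfolding J.reedy_fibrant_iff functor_iff_good[OF J.K.category_axioms] strict_coslice_simps(1)
    using A good_restrict fibrant_restrict by (auto simp: matching_diagram_def strict_coslice_simps(1))
qed

lemma has_matching_object:
  assumes x: "x \<in> Ob K" and A: "good_below A x" "fibrant_below A x"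
  shows "has_matching_object C K A x"
  using admissible x reedy_fibrant_restrict[OF A]
  unfolding admissible_def has_reedy_limits_def has_matching_object_def by blast

text \<open>Admissibility applies to the restricted transformation, whose limit map is by definition
  the map of matching objects.\<close>

lemma matching_trans_fib:
  assumes x: "x \<in> Ob K" and A: "good_below A x" "fibrant_below A x" and B: "good_below B x" "fibrant_below B x"
    and \<alpha>: "nat_below A \<alpha> B x" "rfib_below A \<alpha> B x"
  shows "matching_trans C K (A, \<alpha>, B) x \<in> F"
proof -
  interpret J: diagrams C F "strict_coslice K x"
    using category_strict_coslice[OF K.category_axioms] type_theoretic_fibration_category_axioms
    by (simp add: diagrams_def)
  note R = reedy_fibrant_restrict[OF A] reedy_fibrant_restrict[OF B]
  have t: "is_nat_trans (strict_coslice K x) C (matching_diagram K A x) (restr \<alpha> x) (matching_diagram K B x)"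
    unfolding nat_trans_iff_nat[OF J.K.category_axioms]
    using R \<alpha> nat_restrict unfolding J.reedy_fibrant_iff by (auto simp: strict_coslice_simps(1))
  have "reedy_fibration C F (strict_coslice K x) (matching_diagram K A x, restr \<alpha> x, matching_diagram K B x)"
    unfolding J.reedy_fibration_iff[OF R t] using rfib_restrict \<alpha> by (simp add: strict_coslice_simps(1))
  moreover have "(matching_diagram K A x, restr \<alpha> x, matching_diagram K B x) \<in> Ar (reedy_cat C F (strict_coslice K x))"
    using R t by (simp add: J.reedy_Ar)
  ultimately show ?thesis
    using admissible x unfolding admissible_def has_reedy_limits_def matching_trans_def by fastforce
qed

context
  fixes x A B \<alpha>
  assumes x: "x \<in> Ob K" and A: "good_below A x" "fibrant_below A x"
    and B: "good_below B x" "fibrant_below B x" "good B x" "fibrant_at C F K B x"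
    and \<alpha>: "nat_below A \<alpha> B x"
begin

text \<open>Both legs come from a pullback square. The map \<open>t\<close> is a pullback of the
  fibration from \<open>B\<close> at \<open>x\<close> to its matching object; \<open>b\<close> is a
  pullback of the map of matching objects, a fibration as soon as the transformation is a Reedy
  fibration below \<open>x\<close>.\<close>

lemma rlim_proj:
  assumes R: "rlim C K A \<alpha> B x L b \<pi>"
  obtains t where "t \<in> F" "Dom C t = L" "Cod C t = mob A x" "\<And>u. u \<in> N x \<Longrightarrow> mproj A x u \<cdot> t = \<pi> u"
    "rfib_below A \<alpha> B x \<Longrightarrow> b \<in> F"
proof -
  note hA = has_matching_object[OF x A] and hB = has_matching_object[OF x B(1,2)]
  have n: "matching_map C K B x \<in> F" using B fibrant_at_iff by blast
  note m' = matching_trans[OF A(1) B(1) \<alpha> hA hB] and n' = matching_map[OF hB B(3)]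
  have "has_pullback C (matching_trans C K (A, \<alpha>, B) x) (matching_map C K B x)"
    using fib_has_pullback(1)[OF n] m' n' by simp
  then obtain t where t: "is_pullback C (matching_trans C K (A, \<alpha>, B) x) (matching_map C K B x) t b" "t \<in> Ar C"
    "Dom C t = L" "Cod C t = mob A x" "\<And>u. u \<in> N x \<Longrightarrow> mproj A x u \<cdot> t = \<pi> u"
    using pullback_of_rlim[OF A(1) B(3,1) \<alpha> mlim_mob[OF hA] mlim_mob[OF hB] m' n' _ R] by blast
  show thesis
    using that[OF fib_pullback[OF n t(1)] t(3-5)] fib_pullback_sym[OF _ t(1)] matching_trans_fib[OF x A B(1,2) \<alpha>]
    by blast
qed

lemma rlim_exists:
  obtains L b \<pi> where "rlim C K A \<alpha> B x L b \<pi>"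
proof -
  note hA = has_matching_object[OF x A] and hB = has_matching_object[OF x B(1,2)]
  have n: "matching_map C K B x \<in> F" using B fibrant_at_iff by blast
  note m' = matching_trans[OF A(1) B(1) \<alpha> hA hB] and n' = matching_map[OF hB B(3)]
  have "has_pullback C (matching_trans C K (A, \<alpha>, B) x) (matching_map C K B x)"
    using fib_has_pullback(1)[OF n] m' n' by simp
  from that[OF rlim_of_pullback[OF A(1) B(3,1) \<alpha> mlim_mob[OF hA] mlim_mob[OF hB] m' n' pb_is_pullback[OF this]]]
  show thesis .
qed

text \<open>Composing with the projection from \<open>rlim_proj\<close> makes a value fibrant over
  \<open>B\<close> fibrant outright. A recursion over a Reedy fibrant \<open>B\<close> therefore
  only has to maintain the relative condition.\<close>

lemma fibrant_of_rstep:
  assumes "rstep C F K A \<alpha> B x X a t"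
  shows "mstep C F K A x X a"
proof -
  obtain L b \<pi> m where m: "rlim C K A \<alpha> B x L b \<pi>" "m \<in> F" "Dom C m = X" "Cod C m = L"
    "b \<cdot> m = t" "\<forall>u \<in> N x. \<pi> u \<cdot> m = a u"
    using assms unfolding rstep_def by blast
  obtain s where s: "s \<in> F" "Dom C s = L" "Cod C s = mob A x" "\<And>u. u \<in> N x \<Longrightarrow> mproj A x u \<cdot> s = \<pi> u"
    using rlim_proj[OF m(1)] by blast
  note L = mlim_mob[OF has_matching_object[OF x A]]
  note M = mconeD[OF mlim_cone[OF L]]
  have "s \<cdot> m \<in> F" using fib_cmp[of m s] m s by simp
  moreover have "\<forall>u \<in> N x. mproj A x u \<cdot> (s \<cdot> m) = a u"
  proof
    fix u assume u: "u \<in> N x"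
    have "mproj A x u \<cdot> (s \<cdot> m) = \<pi> u \<cdot> m"
      by (rule cmp_ext[OF s(4)[OF u]]) (use M(1-4) u s m in simp_all)
    then show "mproj A x u \<cdot> (s \<cdot> m) = a u" using m u by simp
  qed
  ultimately show ?thesis
    unfolding mstep_def using L m s by (intro exI[of _ "mob A x"] exI[of _ "mproj A x"] exI[of _ "s \<cdot> m"]) simp
qed

lemma fib_of_rstep:
  assumes "rstep C F K A \<alpha> B x X a t" "rfib_below A \<alpha> B x"
  shows "t \<in> F"
proof -
  obtain L b \<pi> m where m: "rlim C K A \<alpha> B x L b \<pi>" "m \<in> F" "Dom C m = X" "Cod C m = L"
    "b \<cdot> m = t" "\<forall>u \<in> N x. \<pi> u \<cdot> m = a u"
    using assms unfolding rstep_def by blast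
  have "b \<in> F" using rlim_proj[OF m(1)] assms(2) by blast
  then show ?thesis using fib_cmp[of m b] m rconeD(3)[OF rlim_cone[OF m(1)]] by simp
qed

end

end

subsection \<open>The category of Reedy fibrant diagrams\<close>

context inverse_diagrams
begin

abbreviation "D \<equiv> reedy_cat C F K"
abbreviation "RF \<equiv> reedy_fibrations C F K"
abbreviation "RO A \<equiv> reedy_fibrant C F K A"
abbreviation "RT A \<alpha> B \<equiv> is_nat_trans K C A \<alpha> B"

lemma nonid_Cod: "u \<in> N x \<Longrightarrow> Cod K u \<in> Ob K"
  by (simp add: nonid_def)

lemma ROD:
  assumes "RO A"
  shows "is_functor K C A" "x \<in> Ob K \<Longrightarrow> good A x" "x \<in> Ob K \<Longrightarrow> fibrant_at C F K A x" "good_below A x" "fibrant_below A x"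
  using assms functorD nonid_Cod unfolding reedy_fibrant_iff by blast+

lemma D_simps:
  "Dom D = (\<lambda>(A, \<alpha>, B). A)" "Cod D = (\<lambda>(A, \<alpha>, B). B)"
  "Ide D = (\<lambda>A. (A, \<lambda>j \<in> Ob K. Ide C (Fob A j), A))"
  "Cmp D = (\<lambda>(B, \<beta>, D) (A, \<alpha>, B'). (A, \<lambda>j \<in> Ob K. \<beta> j \<cdot> \<alpha> j, D))"
  by (simp_all add: reedy_cat_def full_subcategory_def functor_cat_def)

lemma D_hom: "w \<in> hom D A B \<longleftrightarrow> (\<exists>\<alpha>. w = (A, \<alpha>, B) \<and> RO A \<and> RO B \<and> RT A \<alpha> B)"
  by (cases w) (auto simp: hom_def D_simps reedy_Ar)

lemma natural_transI:
  assumes "is_functor K C A" "is_functor K C B" "\<alpha> \<in> extensional (Ob K)"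
    "\<And>x. x \<in> Ob K \<Longrightarrow> \<alpha> x \<in> Ar C" "\<And>x. x \<in> Ob K \<Longrightarrow> Dom C (\<alpha> x) = Fob A x" "\<And>x. x \<in> Ob K \<Longrightarrow> Cod C (\<alpha> x) = Fob B x"
    "\<And>u. u \<in> Ar K \<Longrightarrow> Far B u \<cdot> \<alpha> (Dom K u) = \<alpha> (Cod K u) \<cdot> Far A u"
  shows "RT A \<alpha> B"
  using assms unfolding is_nat_trans_def by (simp add: hom_def)

lemma RTD:
  assumes "RT A \<alpha> B"
  shows "x \<in> Ob K \<Longrightarrow> \<alpha> x \<in> Ar C" "x \<in> Ob K \<Longrightarrow> Dom C (\<alpha> x) = Fob A x" "x \<in> Ob K \<Longrightarrow> Cod C (\<alpha> x) = Fob B x"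
    "u \<in> Ar K \<Longrightarrow> Far B u \<cdot> \<alpha> (Dom K u) = \<alpha> (Cod K u) \<cdot> Far A u" "\<alpha> \<in> extensional (Ob K)"
    "is_functor K C A" "is_functor K C B"
  using assms unfolding is_nat_trans_def by (auto simp: hom_def)

lemma functor_simps:
  assumes "is_functor K C A"
  shows "x \<in> Ob K \<Longrightarrow> Fob A x \<in> Ob C" "u \<in> Ar K \<Longrightarrow> Far A u \<in> Ar C"
    "u \<in> Ar K \<Longrightarrow> Dom C (Far A u) = Fob A (Dom K u)" "u \<in> Ar K \<Longrightarrow> Cod C (Far A u) = Fob A (Cod K u)"
    "x \<in> Ob K \<Longrightarrow> Far A (Ide K x) = Ide C (Fob A x)"
    "u \<in> Ar K \<Longrightarrow> v \<in> Ar K \<Longrightarrow> Cod K u = Dom K v \<Longrightarrow> Far A (v \<cdot>\<^bsub>K\<^esub> u) = Far A v \<cdot> Far A u"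
  using assms unfolding is_functor_def by (auto simp: hom_def PiE_iff)

lemma RT_ide: "is_functor K C A \<Longrightarrow> RT A (\<lambda>j \<in> Ob K. Ide C (Fob A j)) A"
  by (rule natural_transI) (simp_all add: functor_simps)

lemma RT_cmp:
  assumes a: "RT A \<alpha> B" and b: "RT B \<beta> E"
  shows "RT A (\<lambda>j \<in> Ob K. \<beta> j \<cdot> \<alpha> j) E"
proof (rule natural_transI)
  note A = functor_simps[OF RTD(6)[OF a]] and B = functor_simps[OF RTD(6)[OF b]] and E = functor_simps[OF RTD(7)[OF b]]
  fix u assume u: "u \<in> Ar K"
  have "Far E u \<cdot> (\<beta> (Dom K u) \<cdot> \<alpha> (Dom K u)) = (\<beta> (Cod K u) \<cdot> Far B u) \<cdot> \<alpha> (Dom K u)"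
    by (rule cmp_ext[OF RTD(4)[OF b u]]) (use u RTD(1-3)[OF a, of "Dom K u"] RTD(1-3)[OF b, of "Dom K u"] E in simp_all)
  also have "\<dots> = \<beta> (Cod K u) \<cdot> (\<alpha> (Cod K u) \<cdot> Far A u)"
    using u RTD(1-4)[OF a] RTD(1-3)[OF b] A B by simp
  finally show "Far E u \<cdot> (\<lambda>j \<in> Ob K. \<beta> j \<cdot> \<alpha> j) (Dom K u) = (\<lambda>j \<in> Ob K. \<beta> j \<cdot> \<alpha> j) (Cod K u) \<cdot> Far A u"
    using u RTD(1-3)[OF a] RTD(1-3)[OF b] A by simp
qed (use RTD[OF a] RTD[OF b] in simp_all)

lemma category_D: "category D"
proof
  fix f assume "f \<in> Ar D"
  then show "Dom D f \<in> Ob D" "Cod D f \<in> Ob D"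
    by (cases f; simp add: D_simps reedy_Ar reedy_Ob)+
next
  fix A assume "A \<in> Ob D"
  then show "Ide D A \<in> hom D A A"
    unfolding D_hom reedy_Ob using ROD(1) RT_ide by (auto simp: D_simps)
next
  fix f g A B E assume "f \<in> hom D A B" "g \<in> hom D B E"
  then show "g \<cdot>\<^bsub>D\<^esub> f \<in> hom D A E"
    unfolding D_hom using RT_cmp by (auto simp: D_simps)
next
  fix f A B assume "f \<in> hom D A B"
  then obtain \<alpha> where f: "f = (A, \<alpha>, B)" and t: "RT A \<alpha> B" unfolding D_hom by blast
  have "(\<lambda>j \<in> Ob K. \<alpha> j \<cdot> (\<lambda>j \<in> Ob K. Ide C (Fob A j)) j) = \<alpha>"
    by (rule extensionalityI[of _ "Ob K"]) (use RTD(1,2,5)[OF t] in simp_all)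
  then show "f \<cdot>\<^bsub>D\<^esub> Ide D A = f" by (simp add: f D_simps)
  have "(\<lambda>j \<in> Ob K. (\<lambda>j \<in> Ob K. Ide C (Fob B j)) j \<cdot> \<alpha> j) = \<alpha>"
    by (rule extensionalityI[of _ "Ob K"]) (use RTD(1,3,5)[OF t] in simp_all)
  then show "Ide D B \<cdot>\<^bsub>D\<^esub> f = f" by (simp add: f D_simps)
next
  fix f g h A B E G assume "f \<in> hom D A B" "g \<in> hom D B E" "h \<in> hom D E G"
  then obtain \<alpha> \<beta> \<gamma> where f: "f = (A, \<alpha>, B)" "g = (B, \<beta>, E)" "h = (E, \<gamma>, G)"
    and t: "RT A \<alpha> B" "RT B \<beta> E" "RT E \<gamma> G" unfolding D_hom by blast
  have "(\<lambda>j \<in> Ob K. \<gamma> j \<cdot> (\<lambda>j \<in> Ob K. \<beta> j \<cdot> \<alpha> j) j) = (\<lambda>j \<in> Ob K. (\<lambda>j \<in> Ob K. \<gamma> j \<cdot> \<beta> j) j \<cdot> \<alpha> j)"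
    by (rule restrict_ext) (use RTD(1-3)[OF t(1)] RTD(1-3)[OF t(2)] RTD(1-3)[OF t(3)] in simp)
  then show "h \<cdot>\<^bsub>D\<^esub> (g \<cdot>\<^bsub>D\<^esub> f) = (h \<cdot>\<^bsub>D\<^esub> g) \<cdot>\<^bsub>D\<^esub> f" by (simp add: f D_simps)
qed

sublocale D: category D
  by (rule category_D)

lemma D_Ar: "w \<in> Ar D \<longleftrightarrow> (\<exists>A \<alpha> B. w = (A, \<alpha>, B) \<and> RO A \<and> RO B \<and> RT A \<alpha> B)"
  by (cases w) (auto simp: reedy_Ar)

lemma D_eqI:
  assumes "RT A \<alpha> B" "RT A \<beta> B" "\<And>x. x \<in> Ob K \<Longrightarrow> \<alpha> x = \<beta> x"
  shows "\<alpha> = \<beta>"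
  using assms RTD(5) by (intro extensionalityI[of _ "Ob K"]) auto

lemma D_cmp_eq:
  assumes "(B, \<beta>, E) \<cdot>\<^bsub>D\<^esub> (A, \<alpha>, B') = (A', \<gamma>, E')" "x \<in> Ob K"
  shows "\<beta> x \<cdot> \<alpha> x = \<gamma> x"
  using assms by (auto simp: D_simps)

lemma D_iso_level:
  assumes "is_iso D (A, \<alpha>, B)"
  shows "RO A" "RO B" "RT A \<alpha> B" "x \<in> Ob K \<Longrightarrow> is_iso C (\<alpha> x)"
proof -
  obtain g where g0: "(A, \<alpha>, B) \<in> Ar D" "g \<in> Ar D" "Dom D g = Cod D (A, \<alpha>, B)" "Cod D g = Dom D (A, \<alpha>, B)"
    "g \<cdot>\<^bsub>D\<^esub> (A, \<alpha>, B) = Ide D (Dom D (A, \<alpha>, B))" "(A, \<alpha>, B) \<cdot>\<^bsub>D\<^esub> g = Ide D (Cod D (A, \<alpha>, B))"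
    using D.iso_obtain[OF assms] .
  have "Dom D (A, \<alpha>, B) = A" "Cod D (A, \<alpha>, B) = B" by (simp_all add: D_simps)
  note g = g0[unfolded this]
  from g(1) have RO: "RO A" "RO B" "RT A \<alpha> B" by (auto simp: reedy_Ar)
  then show "RO A" "RO B" and t: "RT A \<alpha> B" by auto
  obtain \<beta> where b: "g = (B, \<beta>, A)" "RT B \<beta> A" using g by (auto simp: D_Ar D_simps)
  fix x assume x: "x \<in> Ob K"
  have "\<beta> x \<cdot> \<alpha> x = Ide C (Fob A x)" "\<alpha> x \<cdot> \<beta> x = Ide C (Fob B x)"
    using D_cmp_eq[OF g(5)[unfolded b(1) D_simps(3)] x] D_cmp_eq[OF g(6)[unfolded b(1) D_simps(3)] x] x by simp_all
  then show "is_iso C (\<alpha> x)"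
    using x RTD(1-3)[OF t x] RTD(1-3)[OF b(2) x] by (intro isoI[of _ "\<beta> x"]) simp_all
qed

section \<open>The terminal diagram and isomorphisms of diagrams\<close>

lemma terminal_unique:
  assumes "is_terminal C t" "f \<in> Ar C" "g \<in> Ar C" "Dom C f = Dom C g" "Cod C f = t" "Cod C g = t"
  shows "f = g"
proof -
  have "\<exists>!h. h \<in> hom C (Dom C f) t" using assms unfolding is_terminal_def by auto
  then show ?thesis by (rule ex1_eq) (use assms in \<open>simp_all add: hom_def\<close>)
qed

lemma terminal_obtain:
  assumes "is_terminal C t" "x \<in> Ob C"
  obtains f where "f \<in> Ar C" "Dom C f = x" "Cod C f = t"
  using assms unfolding is_terminal_def by (auto simp: hom_def)

lemma D_terminal: "\<exists>T. is_terminal D T \<and> (\<forall>f \<in> Ar D. Cod D f = T \<longrightarrow> f \<in> RF)"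
proof -
  obtain t where t: "is_terminal C t" "\<forall>f \<in> Ar C. Cod C f = t \<longrightarrow> f \<in> F" using fib_terminal by blast
  have tO: "t \<in> Ob C" using t unfolding is_terminal_def by blast
  define T where "T = \<lparr>Fob = (\<lambda>x \<in> Ob K. t), Far = (\<lambda>u \<in> Ar K. Ide C t)\<rparr>"
  have TF: "x \<in> Ob K \<Longrightarrow> Fob T x = t" "u \<in> Ar K \<Longrightarrow> Far T u = Ide C t" for x u
    by (simp_all add: T_def)
  have funT: "is_functor K C T"
    unfolding functor_iff_good[OF K.category_axioms] good_at_def
    using tO by (auto simp: T_def)
  \<comment> \<open>Since \<open>t\<close> is terminal, it is the matching object of the constant
    diagram at every object, also where the index category is empty.\<close>
  have lim: "mlim C K T x t (\<lambda>u. Ide C t)" for x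
    unfolding mlim_def
  proof (intro conjI allI impI)
    show "mcone C K T x t (\<lambda>u. Ide C t)"
      unfolding mcone_def using tO by (auto simp: TF nonid_def)
    fix L \<pi> assume c: "mcone C K T x L \<pi>"
    obtain h where h: "h \<in> Ar C" "Dom C h = L" "Cod C h = t"
      using terminal_obtain[OF t(1) mconeD(1)[OF c]] .
    have "Ide C t \<cdot> h = \<pi> u" if u: "u \<in> N x" for u
      by (rule terminal_unique[OF t(1)]) (use h tO mconeD[OF c] u nonid_Cod[OF u] TF in simp_all)
    then show "\<exists>!h. h \<in> hom C L t \<and> (\<forall>u\<in>N x. Ide C t \<cdot> h = \<pi> u)"
      using h terminal_unique[OF t(1)] by (intro ex1I[of _ h]) (auto simp: hom_def)
  qed
  have RO: "RO T"
    unfolding reedy_fibrant_iff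
  proof (intro conjI funT ballI)
    fix x assume x: "x \<in> Ob K"
    show "fibrant_at C F K T x"
      unfolding mstep_def using lim[of x] fib_ide[OF tO] x tO TF
      by (intro exI[of _ t] exI[of _ "\<lambda>u. Ide C t"] exI[of _ "Ide C t"]) (auto simp: nonid_def)
  qed
  have "\<exists>!f. f \<in> hom D A T" if A: "A \<in> Ob D" for A
  proof -
    have RA: "RO A" and fA: "is_functor K C A" using A ROD(1) by (simp_all add: reedy_Ob)
    have "\<forall>x. \<exists>f. x \<in> Ob K \<longrightarrow> f \<in> Ar C \<and> Dom C f = Fob A x \<and> Cod C f = t"
      using terminal_obtain[OF t(1)] functor_simps(1)[OF fA] by metis
    then obtain a where a: "\<And>x. x \<in> Ob K \<Longrightarrow> a x \<in> Ar C" "\<And>x. x \<in> Ob K \<Longrightarrow> Dom C (a x) = Fob A x"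
      "\<And>x. x \<in> Ob K \<Longrightarrow> Cod C (a x) = t" by metis
    have tr: "RT A (restrict a (Ob K)) T"
    proof (rule natural_transI[OF fA funT])
      fix u assume u: "u \<in> Ar K"
      show "Far T u \<cdot> restrict a (Ob K) (Dom K u) = restrict a (Ob K) (Cod K u) \<cdot> Far A u"
        by (rule terminal_unique[OF t(1)]) (use u a TF tO functor_simps[OF fA] in simp_all)
    qed (use a TF in simp_all)
    show ?thesis
    proof (rule ex1I[of _ "(A, restrict a (Ob K), T)"])
      fix w assume "w \<in> hom D A T"
      then obtain b where w: "w = (A, b, T)" and b: "RT A b T" unfolding D_hom by blast
      have "b = restrict a (Ob K)"
        by (rule D_eqI[OF b tr], rule terminal_unique[OF t(1)]) (use RTD(1-3)[OF b] a TF in simp_all)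
      then show "w = (A, restrict a (Ob K), T)" using w by simp
    qed (use RA RO tr in \<open>simp add: D_hom\<close>)
  qed
  then have "is_terminal D T" unfolding is_terminal_def using RO reedy_Ob by blast
  moreover have "f \<in> RF" if f: "f \<in> Ar D" "Cod D f = T" for f
  proof -
    obtain A \<alpha> where f: "f = (A, \<alpha>, T)" and A: "RO A" and \<alpha>: "RT A \<alpha> T"
      using f by (auto simp: D_Ar D_simps)
    have "rfib_at C F K A \<alpha> T x" if x: "x \<in> Ob K" for x
    proof -
      obtain L \<pi> m where m: "mlim C K A x L \<pi>" "m \<in> F" "Dom C m = Fob A x" "Cod C m = L"
        "\<forall>u \<in> N x. \<pi> u \<cdot> m = Far A u" using ROD(3)[OF A x] unfolding mstep_def by blast
      note M = mconeD[OF mlim_cone[OF m(1)]]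
      obtain b where b: "b \<in> Ar C" "Dom C b = L" "Cod C b = t"
        using terminal_obtain[OF t(1) M(1)] .
      \<comment> \<open>Over the terminal diagram the leg \<open>b\<close> carries no information:
        the relative matching object is the matching object of \<open>A\<close>, and the fibration
        \<open>m\<close> witnessing that \<open>A\<close> is fibrant can be reused.\<close>
      have "rlim C K A \<alpha> T x L b \<pi>"
        unfolding rlim_def
      proof (intro conjI allI impI)
        have "Far T u \<cdot> b = \<alpha> (Cod K u) \<cdot> \<pi> u" if u: "u \<in> N x" for u
          by (rule terminal_unique[OF t(1)])
            (use u b M(2-4) TF tO nonid_Cod[OF u] nonidD[OF u] RTD(1-3)[OF \<alpha>, of "Cod K u"] in simp_all)
        then show "rcone C K A \<alpha> T x L b \<pi>"
          unfolding rcone_def using mlim_cone[OF m(1)] b TF x by simp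
        fix L' b' \<pi>' assume r: "rcone C K A \<alpha> T x L' b' \<pi>'"
        note R = rconeD[OF r]
        have "b \<cdot> h = b'" if "h \<in> hom C L' L" for h
          by (rule terminal_unique[OF t(1)]) (use that b R(2-4) TF x in \<open>simp_all add: hom_def\<close>)
        moreover have "\<exists>!h. h \<in> hom C L' L \<and> (\<forall>u\<in>N x. \<pi> u \<cdot> h = \<pi>' u)"
          using m(1) R(1) unfolding mlim_def by blast
        ultimately show "\<exists>!h. h \<in> hom C L' L \<and> b \<cdot> h = b' \<and> (\<forall>u\<in>N x. \<pi> u \<cdot> h = \<pi>' u)"
          by metis
      qed
      moreover have "b \<cdot> m = \<alpha> x"
        by (rule terminal_unique[OF t(1)]) (use b m TF x RTD(1-3)[OF \<alpha> x] in simp_all)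
      ultimately show ?thesis unfolding rstep_def using m by blast
    qed
    then show ?thesis using f A RO \<alpha> by (simp add: reedy_fibrations_iff)
  qed
  ultimately show ?thesis by blast
qed

lemma D_iso_fib:
  assumes "is_iso D f"
  shows "f \<in> RF"
proof -
  obtain A \<alpha> B where f: "f = (A, \<alpha>, B)" by (cases f)
  note i = D_iso_level[OF assms[unfolded f]]
  note tr = RTD[OF i(3)]
  have "rfib_at C F K A \<alpha> B x" if x: "x \<in> Ob K" for x
  proof -
    obtain j where j: "j \<in> Ar C" "Dom C j = Fob B x" "Cod C j = Fob A x"
      "j \<cdot> \<alpha> x = Ide C (Fob A x)" "\<alpha> x \<cdot> j = Ide C (Fob B x)"
      using iso_obtain[OF i(4)[OF x]] tr(2,3) x by metis
    note A = ROD[OF i(1)] and B = ROD[OF i(2)]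
    note fA = functor_simps[OF A(1)] and fB = functor_simps[OF B(1)]
    note nat = natural_transD(3)[OF i(3)]
    have below: "nat_below A \<alpha> B x" using natural_transD(4)[OF i(3)] .
    \<comment> \<open>For an isomorphism the relative matching object is the value of
      \<open>A\<close> itself: a cone is determined by its leg \<open>b\<close>, lifted along the
      inverse \<open>j\<close>. The required fibration is then an identity.\<close>
    have "rlim C K A \<alpha> B x (Fob A x) (\<alpha> x) (Far A)"
      unfolding rlim_def
    proof (intro conjI allI impI)
      show "rcone C K A \<alpha> B x (Fob A x) (\<alpha> x) (Far A)"
        by (rule rcone_nat[OF A(2)[OF x] nat[OF x]])
      fix L b \<pi> assume "rcone C K A \<alpha> B x L b \<pi>"
      note R = rconeD[OF this]
      note M = mconeD[OF R(1)]
      \<comment> \<open>The two sides agree after \<open>\<alpha>\<close> at the target of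
        \<open>u\<close>, and its inverse \<open>k\<close> cancels.\<close>
      have e: "Far A u \<cdot> (j \<cdot> b) = \<pi> u" if u: "u \<in> N x" for u
      proof -
        note u' = nonidD[OF u] and c = nonid_Cod[OF u]
        obtain k where k: "k \<in> Ar C" "Dom C k = Fob B (Cod K u)" "Cod C k = Fob A (Cod K u)"
          "k \<cdot> \<alpha> (Cod K u) = Ide C (Fob A (Cod K u))"
          using iso_obtain[OF i(4)[OF c]] tr(2,3) c by metis
        have 1: "\<alpha> (Cod K u) \<cdot> (Far A u \<cdot> (j \<cdot> b)) = \<alpha> (Cod K u) \<cdot> \<pi> u"
        proof -
          have "\<alpha> (Cod K u) \<cdot> (Far A u \<cdot> (j \<cdot> b)) = (Far B u \<cdot> \<alpha> x) \<cdot> (j \<cdot> b)"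
            using tr(4)[of u] u' by (intro cmp_ext) (use u' c tr(1-3) fA j R(2-4) x in simp_all)
          also have "\<dots> = Far B u \<cdot> b"
            using u' c tr(1-3) fB j R(2-4) x j(5)[THEN cmp_ext] by simp
          finally show ?thesis using R(5)[OF u] by simp
        qed
        have "k \<cdot> (\<alpha> (Cod K u) \<cdot> (Far A u \<cdot> (j \<cdot> b))) = k \<cdot> (\<alpha> (Cod K u) \<cdot> \<pi> u)" unfolding 1 ..
        then show ?thesis
          using k(4)[THEN cmp_ext] k u u' c tr(1-3) fA j R(2-4) x M(2-4)[OF u] by simp
      qed
      show "\<exists>!h. h \<in> hom C L (Fob A x) \<and> \<alpha> x \<cdot> h = b \<and> (\<forall>u\<in>N x. Far A u \<cdot> h = \<pi> u)"
      proof (rule ex1I[of _ "j \<cdot> b"])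
        show "j \<cdot> b \<in> hom C L (Fob A x) \<and> \<alpha> x \<cdot> (j \<cdot> b) = b \<and> (\<forall>u\<in>N x. Far A u \<cdot> (j \<cdot> b) = \<pi> u)"
          using e j R(2-4) x tr(1-3) j(5)[THEN cmp_ext] by (simp add: hom_def)
      next
        fix h assume "h \<in> hom C L (Fob A x) \<and> \<alpha> x \<cdot> h = b \<and> (\<forall>u\<in>N x. Far A u \<cdot> h = \<pi> u)"
        then have h: "h \<in> Ar C" "Cod C h = Fob A x" "b = \<alpha> x \<cdot> h" by (auto simp: hom_def)
        show "h = j \<cdot> b"
          unfolding h(3) using h(1,2) j x tr(1-3) j(4)[THEN cmp_ext] by simp
      qed
    qed
    then show ?thesis
      unfolding rstep_def using fib_ide[of "Fob A x"] fA x tr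
      by (intro exI[of _ "Fob A x"] exI[of _ "\<alpha> x"] exI[of _ "Far A"] exI[of _ "Ide C (Fob A x)"])
        (auto simp: nonid_def)
  qed
  then show ?thesis using f i(1-3) by (simp add: reedy_fibrations_iff)
qed

end

section \<open>Composites of Reedy fibrations\<close>

context inverse_diagrams
begin

lemma RFD:
  assumes "(A, \<alpha>, B) \<in> RF"
  shows "RO A" "RO B" "RT A \<alpha> B" "x \<in> Ob K \<Longrightarrow> rfib_at C F K A \<alpha> B x" "rfib_below A \<alpha> B x"
  using assms nonid_Cod unfolding reedy_fibrations_iff by blast+

lemma D_cmp: "(B, \<beta>, E) \<cdot>\<^bsub>D\<^esub> (A, \<alpha>, B') = (A, \<lambda>j \<in> Ob K. \<beta> j \<cdot> \<alpha> j, E)"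
  by (simp add: D_simps)

lemma D_cmp_level:
  assumes "(B, \<beta>, E) \<cdot>\<^bsub>D\<^esub> (A, \<alpha>, B') = (Y, \<gamma>, Z) \<cdot>\<^bsub>D\<^esub> (X, \<delta>, Y')" "x \<in> Ob K"
  shows "\<beta> x \<cdot> \<alpha> x = \<gamma> x \<cdot> \<delta> x"
  using D_cmp_eq[OF assms(1)[unfolded D_cmp[of Y]] assms(2)] assms(2) by simp

lemma RF_level:
  assumes f: "(A, \<alpha>, B) \<in> RF" and x: "x \<in> Ob K"
  shows "\<alpha> x \<in> F"
  by (rule fib_of_rstep[OF x ROD(4,5)[OF RFD(1)[OF f]] ROD(4,5)[OF RFD(2)[OF f]] ROD(2,3)[OF RFD(2)[OF f] x]
    natural_transD(4)[OF RFD(3)[OF f]] RFD(4)[OF f x] RFD(5)[OF f]])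

lemma RO_rlim_exists:
  assumes "RO A" "RO B" "RT A \<alpha> B" "x \<in> Ob K"
  obtains L b \<pi> where "rlim C K A \<alpha> B x L b \<pi>"
  using rlim_exists[OF assms(4) ROD(4,5)[OF assms(1)] ROD(4,5)[OF assms(2)] ROD(2,3)[OF assms(2,4)]
    natural_transD(4)[OF assms(3)]] .

lemma rcone_below_typed:
  assumes "rcone C K A \<alpha> B x L b \<pi>" "u \<in> N x"
  shows "\<pi> u \<in> Ar C" "Dom C (\<pi> u) = L" "Cod C (\<pi> u) = Fob A (Cod K u)"
  using mconeD(2-4)[OF rconeD(1)[OF assms(1)] assms(2)] by simp_all

text \<open>The comparison \<^term>\<open>j\<close> between the relative matching objects of \<open>\<alpha>\<close> and \<open>\<beta>\<alpha>\<close> is a pullback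
  of the fibration from \<open>B\<^sub>x\<close> to the relative matching object of \<open>\<beta>\<close>.\<close>

lemma D_fib_cmp_at:
  assumes f: "(A, \<alpha>, B) \<in> RF" and g: "(B, \<beta>, E) \<in> RF" and x: "x \<in> Ob K"
  shows "rfib_at C F K A (\<lambda>j \<in> Ob K. \<beta> j \<cdot> \<alpha> j) E x"
proof -
  note A = ROD[OF RFD(1)[OF f]] and B = ROD[OF RFD(2)[OF f]] and E = ROD[OF RFD(2)[OF g]]
  note fA = functor_simps[OF A(1)] and fB = functor_simps[OF B(1)] and fE = functor_simps[OF E(1)]
  note t\<alpha> = RFD(3)[OF f] and t\<beta> = RFD(3)[OF g]
  note a = RTD[OF t\<alpha>] and b = RTD[OF t\<beta>]
  define \<gamma> where "\<gamma> = (\<lambda>j \<in> Ob K. \<beta> j \<cdot> \<alpha> j)"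
  have t\<gamma>: "RT A \<gamma> E" unfolding \<gamma>_def by (rule RT_cmp[OF t\<alpha> t\<beta>])
  have \<gamma>: "y \<in> Ob K \<Longrightarrow> \<gamma> y = \<beta> y \<cdot> \<alpha> y" for y by (simp add: \<gamma>_def)
  obtain L l \<pi> m where m: "rlim C K A \<alpha> B x L l \<pi>" "m \<in> F" "Dom C m = Fob A x" "Cod C m = L"
    "l \<cdot> m = \<alpha> x" "\<forall>u \<in> N x. \<pi> u \<cdot> m = Far A u" using RFD(4)[OF f x] unfolding rstep_def by blast
  obtain M k \<rho> n where n: "rlim C K B \<beta> E x M k \<rho>" "n \<in> F" "Dom C n = Fob B x" "Cod C n = M"
    "k \<cdot> n = \<beta> x" "\<forall>u \<in> N x. \<rho> u \<cdot> n = Far B u" using RFD(4)[OF g x] unfolding rstep_def by blast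
  obtain P d \<sigma> where P: "rlim C K A \<gamma> E x P d \<sigma>"
    using RO_rlim_exists[OF RFD(1)[OF f] RFD(2)[OF g] t\<gamma> x] .
  note Rl = rconeD[OF rlim_cone[OF m(1)]] and Rk = rconeD[OF rlim_cone[OF n(1)]] and Rd = rconeD[OF rlim_cone[OF P]]
  note Tl = rcone_below_typed[OF rlim_cone[OF m(1)]] and Tk = rcone_below_typed[OF rlim_cone[OF n(1)]]
    and Td = rcone_below_typed[OF rlim_cone[OF P]]
  \<comment> \<open>Pushing the legs of \<open>P\<close> along \<open>\<alpha>\<close> gives a cone
    for \<open>\<beta>\<close>, hence the map \<open>t\<close> from \<open>P\<close> to
    \<open>M\<close>.\<close>
  have c: "rcone C K B \<beta> E x P d (\<lambda>u. \<alpha> (Cod K u) \<cdot> \<sigma> u)"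
    unfolding rcone_def
  proof (intro conjI ballI)
    show "mcone C K B x P (\<lambda>u. \<alpha> (Cod K u) \<cdot> \<sigma> u)"
      by (rule mcone_trans[OF A(4) B(4) natural_transD(4)[OF t\<alpha>] Rd(1)])
    fix u assume u: "u \<in> N x"
    show "Far E u \<cdot> d = \<beta> (Cod K u) \<cdot> (\<alpha> (Cod K u) \<cdot> \<sigma> u)"
      using Rd(5)[OF u] \<gamma> nonid_Cod[OF u] Td[OF u] a(1-3) b(1-3) by simp
  qed (use Rd in simp_all)
  obtain t where t: "t \<in> Ar C" "Dom C t = P" "Cod C t = M" "k \<cdot> t = d" "\<And>u. u \<in> N x \<Longrightarrow> \<rho> u \<cdot> t = \<alpha> (Cod K u) \<cdot> \<sigma> u"
    using rlim_obtain[OF n(1) c] by blast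
  have c: "rcone C K A \<gamma> E x L (\<beta> x \<cdot> l) \<pi>"
    unfolding rcone_def
  proof (intro conjI ballI)
    fix u assume u: "u \<in> N x"
    note u' = nonidD[OF u] and y = nonid_Cod[OF u]
    have "Far E u \<cdot> (\<beta> x \<cdot> l) = (\<beta> (Cod K u) \<cdot> Far B u) \<cdot> l"
      using b(4)[of u] u' by (intro cmp_ext) (use u' y b(1-3) fE Rl(2-4) x in simp_all)
    also have "\<dots> = \<gamma> (Cod K u) \<cdot> \<pi> u"
      using u' y \<gamma> a(1-3) b(1-3) fB Rl(2-5) x Tl[OF u] u by simp
    finally show "Far E u \<cdot> (\<beta> x \<cdot> l) = \<gamma> (Cod K u) \<cdot> \<pi> u" .
  qed (use Rl x b(1-3) in simp_all)
  obtain j where j: "j \<in> Ar C" "Dom C j = L" "Cod C j = P" "d \<cdot> j = \<beta> x \<cdot> l" "\<And>u. u \<in> N x \<Longrightarrow> \<sigma> u \<cdot> j = \<pi> u"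
    using rlim_obtain[OF P c] by blast
  note uP = rlim_unique[OF P A(4) E(2)[OF x] natural_transD(4)[OF t\<gamma>]]
  note uM = rlim_unique[OF n(1) B(4) E(2)[OF x] natural_transD(4)[OF t\<beta>]]
  note uL = rlim_unique[OF m(1) A(4) B(2)[OF x] natural_transD(4)[OF t\<alpha>]]
  have n': "n \<in> Ar C" using n by simp
  have sq: "t \<cdot> j = n \<cdot> l"
  proof (rule uM)
    show "k \<cdot> (t \<cdot> j) = k \<cdot> (n \<cdot> l)"
      using t(4)[THEN cmp_ext] n(5)[THEN cmp_ext] j t n n' Rk(2-4) Rl(2-4) Rd(2-4) by simp
    fix u assume u: "u \<in> N x"
    note y = nonid_Cod[OF u]
    have "\<rho> u \<cdot> (t \<cdot> j) = (\<alpha> (Cod K u) \<cdot> \<sigma> u) \<cdot> j"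
      using t(5)[OF u] by (intro cmp_ext) (use u t j Tk[OF u] in simp_all)
    also have "\<dots> = \<alpha> (Cod K u) \<cdot> \<pi> u" using j(1-3) j(5)[OF u] Td[OF u] a(1-3) y by simp
    also have "\<dots> = Far B u \<cdot> l" using Rl(5)[OF u] by simp
    also have "\<dots> = \<rho> u \<cdot> (n \<cdot> l)"
      using n(6) u by (intro cmp_ext[symmetric]) (use n n' Rl(2-4) Tk[OF u] in simp_all)
    finally show "\<rho> u \<cdot> (t \<cdot> j) = \<rho> u \<cdot> (n \<cdot> l)" .
  qed (use t j n n' Rl in simp_all)
  \<comment> \<open>In a pair that agrees in \<open>M\<close>, \<open>v\<close> supplies the legs
    into \<open>A\<close> and \<open>w\<close> the leg into \<open>B\<close> at \<open>x\<close>;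
    agreement in \<open>M\<close> is what makes them a cone for \<open>\<alpha>\<close>, hence a map
    into \<open>L\<close>.\<close>
  have "is_pullback C t n j l"
  proof (rule pullbackI)
    fix v w assume v: "v \<in> Ar C" "w \<in> Ar C" "Dom C w = Dom C v" "Cod C v = Dom C t"
      "Cod C w = Dom C n" "t \<cdot> v = n \<cdot> w"
    have e: "\<beta> x \<cdot> w = d \<cdot> v"
    proof -
      have "\<beta> x \<cdot> w = k \<cdot> (n \<cdot> w)" using n(5) by (intro cmp_ext[symmetric]) (use n n' v Rk in simp_all)
      also have "\<dots> = k \<cdot> (t \<cdot> v)" using v by simp
      also have "\<dots> = d \<cdot> v" using t(4) by (intro cmp_ext) (use t v Rk in simp_all)
      finally show ?thesis .
    qed
    have c: "rcone C K A \<alpha> B x (Dom C v) w (\<lambda>u. \<sigma> u \<cdot> v)"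
      unfolding rcone_def
    proof (intro conjI ballI)
      show "mcone C K A x (Dom C v) (\<lambda>u. \<sigma> u \<cdot> v)"
        by (rule mcone_cmp[OF A(4) Rd(1) v(1)]) (use v t in simp)
      fix u assume u: "u \<in> N x"
      have "Far B u \<cdot> w = \<rho> u \<cdot> (n \<cdot> w)"
        using n(6) u by (intro cmp_ext[symmetric]) (use n n' v Tk[OF u] in simp_all)
      also have "\<dots> = \<rho> u \<cdot> (t \<cdot> v)" using v by simp
      also have "\<dots> = (\<alpha> (Cod K u) \<cdot> \<sigma> u) \<cdot> v"
        using t(5)[OF u] by (intro cmp_ext) (use t v Tk[OF u] in simp_all)
      finally show "Far B u \<cdot> w = \<alpha> (Cod K u) \<cdot> (\<sigma> u \<cdot> v)"
        using a(1-3) nonid_Cod[OF u] Td[OF u] v t by simp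
    qed (use v n in simp_all)
    obtain h where h: "h \<in> Ar C" "Dom C h = Dom C v" "Cod C h = L" "l \<cdot> h = w" "\<And>u. u \<in> N x \<Longrightarrow> \<pi> u \<cdot> h = \<sigma> u \<cdot> v"
      using rlim_obtain[OF m(1) c] by blast
    have "j \<cdot> h = v"
    proof (rule uP)
      show "d \<cdot> (j \<cdot> h) = d \<cdot> v"
        using j(4)[THEN cmp_ext] h j e b(1-3) x Rl(2-4) Rd(2-4) by simp
      fix u assume u: "u \<in> N x"
      have "\<sigma> u \<cdot> (j \<cdot> h) = \<pi> u \<cdot> h"
        using j(5)[OF u] by (intro cmp_ext) (use h j Td[OF u] in simp_all)
      then show "\<sigma> u \<cdot> (j \<cdot> h) = \<sigma> u \<cdot> v" using h(5)[OF u] by simp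
    qed (use h j v t in simp_all)
    then show "\<exists>h. h \<in> Ar C \<and> Dom C h = Dom C v \<and> Cod C h = Dom C j \<and> j \<cdot> h = v \<and> l \<cdot> h = w"
      using h j by auto
  next
    fix h h' assume h: "h \<in> Ar C" "h' \<in> Ar C" "Dom C h = Dom C h'" "Cod C h = Dom C j" "Cod C h' = Dom C j"
      "j \<cdot> h = j \<cdot> h'" "l \<cdot> h = l \<cdot> h'"
    show "h = h'"
    proof (rule uL)
      fix u assume u: "u \<in> N x"
      have "\<pi> u \<cdot> h = \<sigma> u \<cdot> (j \<cdot> h)" "\<pi> u \<cdot> h' = \<sigma> u \<cdot> (j \<cdot> h')"
        by (rule cmp_ext[symmetric, OF j(5)[OF u]]; use h j Td[OF u] in simp)+
      then show "\<pi> u \<cdot> h = \<pi> u \<cdot> h'" using h(6) by simp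
    qed (use h j in simp_all)
  qed (use sq t j n n' Rl in simp_all)
  then have "j \<in> F" by (rule fib_pullback[OF n(2)])
  then have "j \<cdot> m \<in> F" using fib_cmp[of m j] m j by simp
  moreover have "d \<cdot> (j \<cdot> m) = \<gamma> x"
    using j(4)[THEN cmp_ext] m j Rd(2-4) Rl(2-4) b(1-3) x \<gamma> by simp
  moreover have "\<sigma> u \<cdot> (j \<cdot> m) = Far A u" if u: "u \<in> N x" for u
  proof -
    have "\<sigma> u \<cdot> (j \<cdot> m) = \<pi> u \<cdot> m" using j(5)[OF u] by (intro cmp_ext) (use m j Td[OF u] in simp_all)
    then show ?thesis using m(6) u by simp
  qed
  ultimately show ?thesis
    unfolding \<gamma>_def[symmetric] rstep_def using P m j
    by (intro exI[of _ P] exI[of _ d] exI[of _ \<sigma>] exI[of _ "j \<cdot> m"]) simp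
qed

lemma D_fib_cmp:
  assumes "f \<in> RF" "g \<in> RF" "Cod D f = Dom D g"
  shows "g \<cdot>\<^bsub>D\<^esub> f \<in> RF"
proof -
  obtain A \<alpha> B where f: "f = (A, \<alpha>, B)" by (cases f)
  obtain \<beta> E where g: "g = (B, \<beta>, E)" using assms(3) by (cases g) (auto simp: f D_simps)
  note f' = assms(1)[unfolded f] and g' = assms(2)[unfolded g]
  have "(A, \<lambda>j \<in> Ob K. \<beta> j \<cdot> \<alpha> j, E) \<in> RF"
    unfolding reedy_fibrations_iff
    using RFD(1)[OF f'] RFD(2)[OF g'] RT_cmp[OF RFD(3)[OF f'] RFD(3)[OF g']] D_fib_cmp_at[OF f' g'] by blast
  then show ?thesis by (simp add: f g D_simps)
qed

subsection \<open>Pullbacks\<close>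

context
  fixes Z E B \<phi> \<gamma> p q
  assumes \<phi>: "RT Z \<phi> B" and \<gamma>: "RT E \<gamma> B"
    and pb: "\<And>x. x \<in> Ob K \<Longrightarrow> is_pullback C (\<phi> x) (\<gamma> x) (p x) (q x)"
begin

text \<open>Arrows act by the induced maps of pullbacks. Functoriality is uniqueness of such maps,
  and naturality of the projections is their defining equations.\<close>

lemma pullback_diagram_exists:
  obtains P where "is_functor K C P" "\<And>x. x \<in> Ob K \<Longrightarrow> Fob P x = Dom C (p x)"
    "RT P (restrict p (Ob K)) Z" "RT P (restrict q (Ob K)) E"
proof -
  note f = RTD[OF \<phi>] and g = RTD[OF \<gamma>]
  note fZ = functor_simps[OF f(6)] and fE = functor_simps[OF g(6)] and fB = functor_simps[OF f(7)]
  note P = pullbackD[OF pb]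
  have ex: "\<exists>h. h \<in> Ar C \<and> Dom C h = Dom C (p (Dom K u)) \<and> Cod C h = Dom C (p (Cod K u)) \<and>
     p (Cod K u) \<cdot> h = Far Z u \<cdot> p (Dom K u) \<and> q (Cod K u) \<cdot> h = Far E u \<cdot> q (Dom K u)"
    if u: "u \<in> Ar K" for u
  proof -
    have d: "Dom K u \<in> Ob K" "Cod K u \<in> Ob K" using u by auto
    have "\<phi> (Cod K u) \<cdot> (Far Z u \<cdot> p (Dom K u)) = (Far B u \<cdot> \<phi> (Dom K u)) \<cdot> p (Dom K u)"
      using f(4)[OF u] by (intro cmp_ext) (use u d f(1-3) fZ P in simp_all)
    also have "\<dots> = Far B u \<cdot> (\<gamma> (Dom K u) \<cdot> q (Dom K u))"
      using u d f(1-3) fB P(3-9)[OF d(1)] by simp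
    also have "\<dots> = (\<gamma> (Cod K u) \<cdot> Far E u) \<cdot> q (Dom K u)"
      using g(4)[OF u] by (intro cmp_ext) (use u d g(1-3) fB P(3-9)[OF d(1)] in simp_all)
    also have "\<dots> = \<gamma> (Cod K u) \<cdot> (Far E u \<cdot> q (Dom K u))"
      using u d g(1-3) fE P(3-8)[OF d(1)] by simp
    finally have e: "\<phi> (Cod K u) \<cdot> (Far Z u \<cdot> p (Dom K u)) = \<gamma> (Cod K u) \<cdot> (Far E u \<cdot> q (Dom K u))" .
    have t: "Far Z u \<cdot> p (Dom K u) \<in> Ar C" "Far E u \<cdot> q (Dom K u) \<in> Ar C"
      "Dom C (Far E u \<cdot> q (Dom K u)) = Dom C (Far Z u \<cdot> p (Dom K u))"
      "Cod C (Far Z u \<cdot> p (Dom K u)) = Dom C (\<phi> (Cod K u))" "Cod C (Far E u \<cdot> q (Dom K u)) = Dom C (\<gamma> (Cod K u))"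
      "Dom C (Far Z u \<cdot> p (Dom K u)) = Dom C (p (Dom K u))"
      using u d f(1-3) g(1-3) fZ fE P(3-8)[OF d(1)] by simp_all
    obtain h where "h \<in> Ar C" "Dom C h = Dom C (Far Z u \<cdot> p (Dom K u))" "Cod C h = Dom C (p (Cod K u))"
       "p (Cod K u) \<cdot> h = Far Z u \<cdot> p (Dom K u)" "q (Cod K u) \<cdot> h = Far E u \<cdot> q (Dom K u)"
      using pullback_obtain[OF pb[OF d(2)] t(1-5) e] .
    then show ?thesis using t(6) by auto
  qed
  then obtain h where h: "\<And>u. u \<in> Ar K \<Longrightarrow> h u \<in> Ar C" "\<And>u. u \<in> Ar K \<Longrightarrow> Dom C (h u) = Dom C (p (Dom K u))"
    "\<And>u. u \<in> Ar K \<Longrightarrow> Cod C (h u) = Dom C (p (Cod K u))"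
    "\<And>u. u \<in> Ar K \<Longrightarrow> p (Cod K u) \<cdot> h u = Far Z u \<cdot> p (Dom K u)"
    "\<And>u. u \<in> Ar K \<Longrightarrow> q (Cod K u) \<cdot> h u = Far E u \<cdot> q (Dom K u)"
    by metis
  define P' where "P' = \<lparr>Fob = (\<lambda>x \<in> Ob K. Dom C (p x)), Far = restrict h (Ar K)\<rparr>"
  have P': "x \<in> Ob K \<Longrightarrow> Fob P' x = Dom C (p x)" "u \<in> Ar K \<Longrightarrow> Far P' u = h u" for x u
    by (simp_all add: P'_def)
  have eq: "k = k'" if "x \<in> Ob K" "k \<in> Ar C" "k' \<in> Ar C" "Cod C k = Dom C (p x)" "Cod C k' = Dom C (p x)"
     "p x \<cdot> k = p x \<cdot> k'" "q x \<cdot> k = q x \<cdot> k'" for x k k'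
    using pullback_unique[OF pb] that by blast
  have funP: "is_functor K C P'"
    unfolding functor_iff_good[OF K.category_axioms]
  proof (intro conjI ballI)
    fix x assume x: "x \<in> Ob K"
    note Px = P(3-8)[OF x]
    show "good_at C K P' x"
      unfolding good_at_def
    proof (intro conjI ballI impI)
      have "h (Ide K x) = Ide C (Dom C (p x))"
        by (rule eq[OF x])
          (use x h[of "Ide K x"] Px f(1-3) g(1-3) fZ fE in simp_all)
      then show "Far P' (Ide K x) = Ide C (Fob P' x)" using x P' by simp
      fix u k assume u: "u \<in> Ar K" "Dom K u = x" and k: "k \<in> Ar K" "Dom K k = Cod K u"
      note hu = h[OF u(1)] and hk = h[OF k(1)]
      have y: "Cod K u \<in> Ob K" "Cod K k \<in> Ob K" using u k by auto
      note Py = P(3-8)[OF y(1)] and Pz = P(3-8)[OF y(2)]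
      have "h (k \<cdot>\<^bsub>K\<^esub> u) = h k \<cdot> h u"
      proof (rule eq[OF y(2)])
        show "p (Cod K k) \<cdot> h (k \<cdot>\<^bsub>K\<^esub> u) = p (Cod K k) \<cdot> (h k \<cdot> h u)"
          using u k x y hu hk h[of "k \<cdot>\<^bsub>K\<^esub> u"] hk(4)[THEN cmp_ext] Px Py Pz f(1-3) fZ by simp
        show "q (Cod K k) \<cdot> h (k \<cdot>\<^bsub>K\<^esub> u) = q (Cod K k) \<cdot> (h k \<cdot> h u)"
          using u k x y hu hk h[of "k \<cdot>\<^bsub>K\<^esub> u"] hk(5)[THEN cmp_ext] Px Py Pz g(1-3) fE by simp
      qed (use u k hu hk h[of "k \<cdot>\<^bsub>K\<^esub> u"] in simp_all)
      then show "Far P' (k \<cdot>\<^bsub>K\<^esub> u) = Far P' k \<cdot> Far P' u" using u k P' by simp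
    qed (use x h Px P' in auto)
  qed (simp_all add: P'_def)
  have "RT P' (restrict p (Ob K)) Z"
    by (rule natural_transI[OF funP f(6)]) (use P P' h f g in simp_all)
  moreover have "RT P' (restrict q (Ob K)) E"
    by (rule natural_transI[OF funP g(6)]) (use P P' h f g in simp_all)
  ultimately show thesis using that funP P' by blast
qed

context
  fixes P
  assumes p: "RT P p Z" and q: "RT P q E" and Z: "RO Z" and g: "(E, \<gamma>, B) \<in> RF"
begin

text \<open>The map from \<open>P\<^sub>x\<close> to its relative matching object is a pullback of the one from \<open>E\<^sub>x\<close>.\<close>

lemma pullback_rfib:
  assumes x: "x \<in> Ob K"
  shows "rfib_at C F K P p Z x \<and> fibrant_at C F K P x"
  using x
\<comment> \<open>Both conclusions are carried along, because fibrancy of \<open>P\<close> below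
  \<open>x\<close> is what makes its relative matching object at \<open>x\<close> exist.\<close>
proof (induction x rule: prec_induct)
  case (1 x)
  then have x: "x \<in> Ob K" and below: "rfib_below P p Z x" "fibrant_below P x"
    using nonid_Cod by blast+
  note tf = RTD[OF \<phi>] and tg = RTD[OF \<gamma>] and tp = RTD[OF p] and tq = RTD[OF q]
  note fP = functor_simps[OF tp(6)] and fZ = functor_simps[OF tf(6)] and fE = functor_simps[OF tg(6)] and fB = functor_simps[OF tf(7)]
  note RB = ROD[OF RFD(2)[OF g]] and RE = ROD[OF RFD(1)[OF g]] and RZ = ROD[OF Z]
  note goodP = functorD[OF tp(6)]
  obtain L b \<rho> m where m: "rlim C K E \<gamma> B x L b \<rho>" "m \<in> F" "Dom C m = Fob E x" "Cod C m = L"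
    "b \<cdot> m = \<gamma> x" "\<forall>u \<in> N x. \<rho> u \<cdot> m = Far E u" using RFD(4)[OF g x] unfolding rstep_def by blast
  have m': "m \<in> Ar C" using m by simp
  obtain M z \<sigma> where M: "rlim C K P p Z x M z \<sigma>"
    using rlim_exists[OF x goodP(2) below(2) RZ(4,5) RZ(2,3)[OF x] natural_transD(4)[OF p]] .
  note Rb = rconeD[OF rlim_cone[OF m(1)]] and Rz = rconeD[OF rlim_cone[OF M]]
  note Tb = rcone_below_typed[OF rlim_cone[OF m(1)]] and Tz = rcone_below_typed[OF rlim_cone[OF M]]
  have c: "rcone C K E \<gamma> B x M (\<phi> x \<cdot> z) (\<lambda>u. q (Cod K u) \<cdot> \<sigma> u)"
    unfolding rcone_def
  proof (intro conjI ballI)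
    show "mcone C K E x M (\<lambda>u. q (Cod K u) \<cdot> \<sigma> u)"
      by (rule mcone_trans[OF goodP(2) RE(4) natural_transD(4)[OF q] Rz(1)])
    fix u assume u: "u \<in> N x"
    note u' = nonidD[OF u] and y = nonid_Cod[OF u]
    note Py = pullbackD[OF pb[OF y]]
    have "Far B u \<cdot> (\<phi> x \<cdot> z) = (\<phi> (Cod K u) \<cdot> Far Z u) \<cdot> z"
      using tf(4)[of u] u' by (intro cmp_ext) (use u' y tf(1-3) fB Rz(2-4) x in simp_all)
    also have "\<dots> = \<phi> (Cod K u) \<cdot> (p (Cod K u) \<cdot> \<sigma> u)"
      using u' y tf(1-3) fZ Rz(2-5) u x by simp
    also have "\<dots> = (\<gamma> (Cod K u) \<cdot> q (Cod K u)) \<cdot> \<sigma> u"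
      using Py(9) by (intro cmp_ext) (use Py y tf(1-3) tp(1-3) Tz[OF u] in simp_all)
    finally show "Far B u \<cdot> (\<phi> x \<cdot> z) = \<gamma> (Cod K u) \<cdot> (q (Cod K u) \<cdot> \<sigma> u)"
      using y tg(1-3) tq(1-3) Tz[OF u] by simp
  qed (use Rz(2-4) x tf(1-3) in simp_all)
  obtain t where t: "t \<in> Ar C" "Dom C t = M" "Cod C t = L" "b \<cdot> t = \<phi> x \<cdot> z" "\<And>u. u \<in> N x \<Longrightarrow> \<rho> u \<cdot> t = q (Cod K u) \<cdot> \<sigma> u"
    using rlim_obtain[OF m(1) c] by blast
  obtain n where n: "n \<in> Ar C" "Dom C n = Fob P x" "Cod C n = M" "z \<cdot> n = p x" "\<And>u. u \<in> N x \<Longrightarrow> \<sigma> u \<cdot> n = Far P u"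
    using rlim_obtain[OF M rcone_nat[OF goodP(1)[OF x] natural_transD(3)[OF p x]]] by blast
  note uM = rlim_unique[OF M goodP(2) RZ(2)[OF x] natural_transD(4)[OF p]]
  note uL = rlim_unique[OF m(1) RE(4) RB(2)[OF x] natural_transD(4)[OF \<gamma>]]
  note Px = pullbackD[OF pb[OF x]]
  have sq: "t \<cdot> n = m \<cdot> q x"
  proof (rule uL)
    have "b \<cdot> (t \<cdot> n) = (\<phi> x \<cdot> z) \<cdot> n"
      using t(4) by (intro cmp_ext) (use t n Rb in simp_all)
    also have "\<dots> = \<phi> x \<cdot> p x" using n x tf(1-3) Rz(2-4) by simp
    also have "\<dots> = \<gamma> x \<cdot> q x" using Px by simp
    also have "\<dots> = b \<cdot> (m \<cdot> q x)"
      using m(5) by (intro cmp_ext[symmetric]) (use m m' Rb tq(1-3) x in simp_all)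
    finally show "b \<cdot> (t \<cdot> n) = b \<cdot> (m \<cdot> q x)" .
    fix u assume u: "u \<in> N x"
    note u' = nonidD[OF u] and y = nonid_Cod[OF u]
    have "\<rho> u \<cdot> (t \<cdot> n) = (q (Cod K u) \<cdot> \<sigma> u) \<cdot> n"
      using t(5)[OF u] by (intro cmp_ext) (use u t n Tb[OF u] in simp_all)
    also have "\<dots> = q (Cod K u) \<cdot> Far P u" using n y tq(1-3) Tz[OF u] u by simp
    also have "\<dots> = Far E u \<cdot> q x" using tq(4)[of u] u' by simp
    also have "\<dots> = \<rho> u \<cdot> (m \<cdot> q x)"
      using m(6) u by (intro cmp_ext[symmetric]) (use m m' Tb[OF u] tq(1-3) x in simp_all)
    finally show "\<rho> u \<cdot> (t \<cdot> n) = \<rho> u \<cdot> (m \<cdot> q x)" .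
  qed (use t n m m' tq(1-3) x in simp_all)
  \<comment> \<open>The maps \<open>z \<cdot> v\<close> and \<open>w\<close> agree in
    \<open>B\<close> at \<open>x\<close> and give \<open>h\<close>. That \<open>n \<cdot> h\<close>
    equals \<open>v\<close> is tested leg by leg, through the two projections of each lower
    pullback.\<close>
  have "is_pullback C t m n (q x)"
  proof (rule pullbackI)
    fix v w assume v: "v \<in> Ar C" "w \<in> Ar C" "Dom C w = Dom C v" "Cod C v = Dom C t"
      "Cod C w = Dom C m" "t \<cdot> v = m \<cdot> w"
    have "\<phi> x \<cdot> (z \<cdot> v) = (\<phi> x \<cdot> z) \<cdot> v"
      using t v Rz(2-4) tf(1-3) x by simp
    also have "\<dots> = b \<cdot> (t \<cdot> v)"
      using t(4) by (intro cmp_ext[symmetric]) (use t v Rb in simp_all)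
    also have "\<dots> = b \<cdot> (m \<cdot> w)" using v by simp
    also have "\<dots> = \<gamma> x \<cdot> w" using m(5) by (intro cmp_ext) (use m m' v Rb in simp_all)
    finally obtain h where h: "h \<in> Ar C" "Dom C h = Dom C v" "Cod C h = Dom C (p x)" "p x \<cdot> h = z \<cdot> v" "q x \<cdot> h = w"
      using pullback_obtain[OF pb[OF x], of "z \<cdot> v" w] v t m Rz(2-4) tf(1-3) tg(1-3) x by auto
    have "n \<cdot> h = v"
    proof (rule uM)
      show "z \<cdot> (n \<cdot> h) = z \<cdot> v"
        using n(4)[THEN cmp_ext] h n Rz(2-4) x tp(1-3) by simp
      fix u assume u: "u \<in> N x"
      note u' = nonidD[OF u] and y = nonid_Cod[OF u]
      note Py = pullbackD[OF pb[OF y]]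
      have "\<sigma> u \<cdot> (n \<cdot> h) = Far P u \<cdot> h"
        using n(5)[OF u] by (intro cmp_ext) (use h n x tp(1-3) Tz[OF u] in simp_all)
      also have "\<dots> = \<sigma> u \<cdot> v"
      proof (rule pullback_unique[OF pb[OF y]])
        have "p (Cod K u) \<cdot> (Far P u \<cdot> h) = (Far Z u \<cdot> p x) \<cdot> h"
          using tp(4)[of u] u' by (intro cmp_ext) (use u' y h x tp(1-3) fP in simp_all)
        also have "\<dots> = Far Z u \<cdot> (z \<cdot> v)" using u' h x tp(1-3) fZ by simp
        also have "\<dots> = (p (Cod K u) \<cdot> \<sigma> u) \<cdot> v"
          using Rz(5)[OF u] by (intro cmp_ext) (use u' x v t Rz(2-4) fZ in simp_all)
        finally show "p (Cod K u) \<cdot> (Far P u \<cdot> h) = p (Cod K u) \<cdot> (\<sigma> u \<cdot> v)"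
          using y tp(1-3) v t Tz[OF u] by simp
        have "q (Cod K u) \<cdot> (Far P u \<cdot> h) = (Far E u \<cdot> q x) \<cdot> h"
          using tq(4)[of u] u' by (intro cmp_ext) (use u' y h x tp(1-3) tq(1-3) fP in simp_all)
        also have "\<dots> = Far E u \<cdot> w" using u' h x tp(1-3) tq(1-3) fE by simp
        also have "\<dots> = \<rho> u \<cdot> (m \<cdot> w)"
          using m(6) u by (intro cmp_ext[symmetric]) (use m m' v Tb[OF u] in simp_all)
        also have "\<dots> = \<rho> u \<cdot> (t \<cdot> v)" using v by simp
        also have "\<dots> = (q (Cod K u) \<cdot> \<sigma> u) \<cdot> v"
          using t(5)[OF u] by (intro cmp_ext) (use t v Tb[OF u] in simp_all)
        finally show "q (Cod K u) \<cdot> (Far P u \<cdot> h) = q (Cod K u) \<cdot> (\<sigma> u \<cdot> v)"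
          using y tq(1-3) v t Tz[OF u] by simp
      qed (use u' y h x tp(1-3) fP v t Tz[OF u] in simp_all)
      finally show "\<sigma> u \<cdot> (n \<cdot> h) = \<sigma> u \<cdot> v" .
    qed (use h n v t tp(1-3) x in simp_all)
    then show "\<exists>h. h \<in> Ar C \<and> Dom C h = Dom C v \<and> Cod C h = Dom C n \<and> n \<cdot> h = v \<and> q x \<cdot> h = w"
      using h n tp(2)[OF x] by auto
  next
    fix h h' assume h: "h \<in> Ar C" "h' \<in> Ar C" "Dom C h = Dom C h'" "Cod C h = Dom C n" "Cod C h' = Dom C n"
      "n \<cdot> h = n \<cdot> h'" "q x \<cdot> h = q x \<cdot> h'"
    have "p x \<cdot> h = z \<cdot> (n \<cdot> h)" "p x \<cdot> h' = z \<cdot> (n \<cdot> h')"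
      by (rule cmp_ext[symmetric, OF n(4)]; use h n Rz in simp)+
    then have "p x \<cdot> h = p x \<cdot> h'" using h(6) by simp
    then show "h = h'"
      using pullback_unique[OF pb[OF x], of h h'] h n tp(2)[OF x] by simp
  qed (use sq t n m m' tq(1-3) x in simp_all)
  then have "n \<in> F" by (rule fib_pullback[OF m(2)])
  then have r: "rfib_at C F K P p Z x"
    unfolding rstep_def using M n by blast
  with fibrant_of_rstep[OF x goodP(2) below(2) RZ(4,5) RZ(2,3)[OF x] natural_transD(4)[OF p] r]
  show ?case by blast
qed

lemma pullback_RO: "RO P" and pullback_RF: "(P, p, Z) \<in> RF"
proof -
  show P: "RO P" unfolding reedy_fibrant_iff using RTD(6)[OF p] pullback_rfib by blast
  then show "(P, p, Z) \<in> RF" using Z p pullback_rfib by (simp add: reedy_fibrations_iff)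
qed

lemma pullback_D: "is_pullback D (Z, \<phi>, B) (E, \<gamma>, B) (P, p, Z) (P, q, E)"
proof (rule D.pullbackI)
  note tf = RTD[OF \<phi>] and tg = RTD[OF \<gamma>] and tp = RTD[OF p] and tq = RTD[OF q]
  note fP = functor_simps[OF tp(6)] and fZ = functor_simps[OF tf(6)] and fE = functor_simps[OF tg(6)] and fB = functor_simps[OF tf(7)]
  note RO = RFD(1,2)[OF g] Z pullback_RO
  show "(Z, \<phi>, B) \<in> Ar D" "(E, \<gamma>, B) \<in> Ar D" "(P, p, Z) \<in> Ar D" "(P, q, E) \<in> Ar D"
    using RO \<phi> \<gamma> p q by (simp_all add: reedy_Ar)
  show "(Z, \<phi>, B) \<cdot>\<^bsub>D\<^esub> (P, p, Z) = (E, \<gamma>, B) \<cdot>\<^bsub>D\<^esub> (P, q, E)"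
    using pullbackD(9)[OF pb] by (auto simp: D_simps intro!: restrict_ext)
  {
    fix u v assume "u \<in> Ar D" "v \<in> Ar D" "Dom D v = Dom D u" "Cod D u = Dom D (Z, \<phi>, B)"
      "Cod D v = Dom D (E, \<gamma>, B)" and e: "(Z, \<phi>, B) \<cdot>\<^bsub>D\<^esub> u = (E, \<gamma>, B) \<cdot>\<^bsub>D\<^esub> v"
    then obtain T a b where u: "u = (T, a, Z)" "v = (T, b, E)" and T: "RO T" and a: "RT T a Z" and b: "RT T b E"
      by (auto simp: D_Ar D_simps)
    note ta = RTD[OF a] and tb = RTD[OF b] and fT = functor_simps[OF RTD(6)[OF a]]
    have ab: "\<phi> x \<cdot> a x = \<gamma> x \<cdot> b x" if "x \<in> Ob K" for x
      by (rule D_cmp_level[OF e[unfolded u] that])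
    have "\<exists>h. h \<in> Ar C \<and> Dom C h = Fob T x \<and> Cod C h = Fob P x \<and> p x \<cdot> h = a x \<and> q x \<cdot> h = b x" if x: "x \<in> Ob K" for x
      using pullback_obtain[OF pb[OF x], of "a x" "b x"] ab[OF x] x ta(1-3) tb(1-3) tf(1-3) tg(1-3) tp(1-3) by metis
    then obtain h where h: "\<And>x. x \<in> Ob K \<Longrightarrow> h x \<in> Ar C" "\<And>x. x \<in> Ob K \<Longrightarrow> Dom C (h x) = Fob T x"
      "\<And>x. x \<in> Ob K \<Longrightarrow> Cod C (h x) = Fob P x" "\<And>x. x \<in> Ob K \<Longrightarrow> p x \<cdot> h x = a x" "\<And>x. x \<in> Ob K \<Longrightarrow> q x \<cdot> h x = b x"
      by metis
    have "RT T (restrict h (Ob K)) P"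
    proof (rule natural_transI[OF ta(6) tp(6)])
      fix k assume k: "k \<in> Ar K"
      then have d: "Dom K k \<in> Ob K" "Cod K k \<in> Ob K" by auto
      have "Far P k \<cdot> h (Dom K k) = h (Cod K k) \<cdot> Far T k"
      proof (rule pullback_unique[OF pb[OF d(2)]])
        have "p (Cod K k) \<cdot> (Far P k \<cdot> h (Dom K k)) = (Far Z k \<cdot> p (Dom K k)) \<cdot> h (Dom K k)"
          using tp(4)[OF k] by (intro cmp_ext) (use k d h tp(1-3) fP in simp_all)
        also have "\<dots> = p (Cod K k) \<cdot> (h (Cod K k) \<cdot> Far T k)"
          using k d h tp(1-3) fZ ta(4)[OF k] fT h(4)[OF d(2), THEN cmp_ext] by simp
        finally show "p (Cod K k) \<cdot> (Far P k \<cdot> h (Dom K k)) = p (Cod K k) \<cdot> (h (Cod K k) \<cdot> Far T k)" .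
        have "q (Cod K k) \<cdot> (Far P k \<cdot> h (Dom K k)) = (Far E k \<cdot> q (Dom K k)) \<cdot> h (Dom K k)"
          using tq(4)[OF k] by (intro cmp_ext) (use k d h tq(1-3) fP in simp_all)
        also have "\<dots> = q (Cod K k) \<cdot> (h (Cod K k) \<cdot> Far T k)"
          using k d h tq(1-3) fE tb(4)[OF k] fT h(5)[OF d(2), THEN cmp_ext] by simp
        finally show "q (Cod K k) \<cdot> (Far P k \<cdot> h (Dom K k)) = q (Cod K k) \<cdot> (h (Cod K k) \<cdot> Far T k)" .
      qed (use k d h tp(1-3) fP fT in simp_all)
      then show "Far P k \<cdot> restrict h (Ob K) (Dom K k) = restrict h (Ob K) (Cod K k) \<cdot> Far T k"
        using d by simp
    qed (use h in simp_all)
    moreover have "(\<lambda>j\<in>Ob K. p j \<cdot> restrict h (Ob K) j) = a" "(\<lambda>j\<in>Ob K. q j \<cdot> restrict h (Ob K) j) = b"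
      by (rule extensionalityI[of _ "Ob K"]; use h ta(5) tb(5) in simp)+
    ultimately show "\<exists>h. h \<in> Ar D \<and> Dom D h = Dom D u \<and> Cod D h = Dom D (P, p, Z) \<and> (P, p, Z) \<cdot>\<^bsub>D\<^esub> h = u \<and> (P, q, E) \<cdot>\<^bsub>D\<^esub> h = v"
      using T pullback_RO u by (intro exI[of _ "(T, restrict h (Ob K), P)"]) (simp add: D_simps reedy_Ar)
  }
  fix h h' assume "h \<in> Ar D" "h' \<in> Ar D" "Dom D h = Dom D h'" "Cod D h = Dom D (P, p, Z)"
    "Cod D h' = Dom D (P, p, Z)" and e: "(P, p, Z) \<cdot>\<^bsub>D\<^esub> h = (P, p, Z) \<cdot>\<^bsub>D\<^esub> h'" "(P, q, E) \<cdot>\<^bsub>D\<^esub> h = (P, q, E) \<cdot>\<^bsub>D\<^esub> h'"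
  then obtain T a b where h: "h = (T, a, P)" "h' = (T, b, P)" and T: "RO T" and a: "RT T a P" and b: "RT T b P"
    by (auto simp: D_Ar D_simps)
  have "a = b"
  proof (rule D_eqI[OF a b])
    fix x assume x: "x \<in> Ob K"
    have "p x \<cdot> a x = p x \<cdot> b x" "q x \<cdot> a x = q x \<cdot> b x"
      using D_cmp_level[OF e(1)[unfolded h] x] D_cmp_level[OF e(2)[unfolded h] x] .
    then show "a x = b x"
      using pullback_unique[OF pb[OF x], of "a x" "b x"] x RTD(1-3)[OF a x] RTD(1-3)[OF b x] tp(2)[OF x] by simp
  qed
  then show "h = h'" using h by simp
qed (simp_all add: D_simps)

end

end

end

section \<open>Pullbacks of diagrams are levelwise\<close>

context inverse_diagrams
begin

text \<open>The levelwise pullbacks are prescribed instead of chosen, because the dependent product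
  needs the particular ones on which its evaluation maps are defined.\<close>

lemma D_pullback_construct:
  assumes g: "(E, \<gamma>, B) \<in> RF" and f: "RO Z" "RT Z \<phi> B"
    and pb: "\<And>x. x \<in> Ob K \<Longrightarrow> is_pullback C (\<phi> x) (\<gamma> x) (p x) (q x)"
  obtains P where "(P, restrict p (Ob K), Z) \<in> RF" "RT P (restrict q (Ob K)) E"
    "is_pullback D (Z, \<phi>, B) (E, \<gamma>, B) (P, restrict p (Ob K), Z) (P, restrict q (Ob K), E)"
    "\<And>x. x \<in> Ob K \<Longrightarrow> Fob P x = Dom C (p x)"
proof -
  obtain P where P: "\<And>x. x \<in> Ob K \<Longrightarrow> Fob P x = Dom C (p x)" "RT P (restrict p (Ob K)) Z" "RT P (restrict q (Ob K)) E"
    using pullback_diagram_exists[OF f(2) RFD(3)[OF g] pb] by blast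
  have pb': "is_pullback C (\<phi> x) (\<gamma> x) (restrict p (Ob K) x) (restrict q (Ob K) x)" if "x \<in> Ob K" for x
    using pb that by simp
  show thesis
    by (rule that[OF pullback_RF[OF f(2) RFD(3)[OF g] pb' P(2,3) f(1) g] P(3)
      pullback_D[OF f(2) RFD(3)[OF g] pb' P(2,3) f(1) g] P(1)])
qed

lemma level_has_pullback:
  assumes g: "(E, \<gamma>, B) \<in> RF" and f: "RT Z \<phi> B" and x: "x \<in> Ob K"
  shows "has_pullback C (\<phi> x) (\<gamma> x)"
  using fib_has_pullback(1)[OF RF_level[OF g x]] RTD(1-3)[OF f x] RTD(3)[OF RFD(3)[OF g] x] by simp

lemma D_pullback_exists:
  assumes g: "(E, \<gamma>, B) \<in> RF" and f: "RO Z" "RT Z \<phi> B"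
  obtains P p q where "(P, p, Z) \<in> RF" "RT P q E" "is_pullback D (Z, \<phi>, B) (E, \<gamma>, B) (P, p, Z) (P, q, E)"
    "\<forall>x \<in> Ob K. is_pullback C (\<phi> x) (\<gamma> x) (p x) (q x)"
proof -
  note pb = pb_is_pullback[OF level_has_pullback[OF g f(2)]]
  obtain P where P: "(P, \<lambda>x\<in>Ob K. pb_fst C (\<phi> x) (\<gamma> x), Z) \<in> RF" "RT P (\<lambda>x\<in>Ob K. pb_snd C (\<phi> x) (\<gamma> x)) E"
    "is_pullback D (Z, \<phi>, B) (E, \<gamma>, B) (P, \<lambda>x\<in>Ob K. pb_fst C (\<phi> x) (\<gamma> x), Z) (P, \<lambda>x\<in>Ob K. pb_snd C (\<phi> x) (\<gamma> x), E)"
    using D_pullback_construct[OF g f pb] by blast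
  show thesis by (rule that[OF P]) (simp add: pb)
qed

lemma D_pullback_shape:
  assumes "is_pullback D f g p q"
  obtains Z \<phi> B E \<gamma> P p' q' where "f = (Z, \<phi>, B)" "g = (E, \<gamma>, B)" "p = (P, p', Z)" "q = (P, q', E)"
    "RO Z" "RO B" "RO E" "RO P" "RT Z \<phi> B" "RT E \<gamma> B" "RT P p' Z" "RT P q' E"
proof -
  note P = D.pullbackD[OF assms]
  obtain Z \<phi> B where 1: "f = (Z, \<phi>, B)" "RO Z" "RO B" "RT Z \<phi> B" using P(1) unfolding D_Ar by blast
  obtain E \<gamma> B' where 2: "g = (E, \<gamma>, B')" "RO E" "RT E \<gamma> B'" using P(2) unfolding D_Ar by blast
  obtain Q p' Z' where 3: "p = (Q, p', Z')" "RO Q" "RT Q p' Z'" using P(3) unfolding D_Ar by blast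
  obtain Q' q' E' where 4: "q = (Q', q', E')" "RT Q' q' E'" using P(4) unfolding D_Ar by blast
  have "B' = B" "Z' = Z" "E' = E" "Q' = Q" using P(5-8) 1 2 3 4 by (simp_all add: D_simps)
  with 1 2 3 4 that show thesis by blast
qed

text \<open>The given pullback is isomorphic to one constructed levelwise, and an isomorphism of
  diagrams is an isomorphism at each level.\<close>

lemma D_pullback_level:
  assumes P: "is_pullback D (Z, \<phi>, B) (E, \<gamma>, B) (P, p, Z) (P, q, E)" and g: "(E, \<gamma>, B) \<in> RF" and x: "x \<in> Ob K"
  shows "is_pullback C (\<phi> x) (\<gamma> x) (p x) (q x)"
proof -
  note P' = D.pullbackD[OF P]
  have f: "RO Z" "RT Z \<phi> B" using P'(1) by (simp_all add: reedy_Ar)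
  obtain Q r s where "(Q, r, Z) \<in> RF" "RT Q s E"
    and Q: "is_pullback D (Z, \<phi>, B) (E, \<gamma>, B) (Q, r, Z) (Q, s, E)"
      "\<forall>x \<in> Ob K. is_pullback C (\<phi> x) (\<gamma> x) (r x) (s x)"
    using D_pullback_exists[OF g f] .
  obtain i where i: "is_iso D i" "i \<in> Ar D" "Dom D i = Dom D (P, p, Z)" "Cod D i = Dom D (Q, r, Z)"
    "(Q, r, Z) \<cdot>\<^bsub>D\<^esub> i = (P, p, Z)" "(Q, s, E) \<cdot>\<^bsub>D\<^esub> i = (P, q, E)"
    using D.pullback_iso[OF P Q(1)] .
  obtain \<iota> where \<iota>: "i = (P, \<iota>, Q)" using i(2-4) by (auto simp: D_Ar D_simps)
  note iso = D_iso_level[OF i(1)[unfolded \<iota>]]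
  have "p x = r x \<cdot> \<iota> x" "q x = s x \<cdot> \<iota> x"
    using D_cmp_eq[OF i(5)[unfolded \<iota>] x] D_cmp_eq[OF i(6)[unfolded \<iota>] x] by simp_all
  moreover have "Cod C (\<iota> x) = Dom C (r x)"
    using RTD(3)[OF iso(3) x] D.pullbackD(3)[OF Q(1)] RTD(2)[of Q r Z x] x by (simp add: reedy_Ar)
  ultimately show ?thesis
    using pullback_cmp_iso[OF Q(2)[rule_format, OF x] iso(4)[OF x]] by simp
qed

lemma D_has_pullback:
  assumes "g \<in> RF" "f \<in> Ar D" "Cod D f = Cod D g"
  shows "has_pullback D f g"
proof -
  obtain Z \<phi> B where f: "f = (Z, \<phi>, B)" "RO Z" "RT Z \<phi> B" using assms(2) unfolding D_Ar by blast
  obtain E \<gamma> where g: "g = (E, \<gamma>, B)" using assms(3) f by (cases g) (simp add: D_simps)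
  show ?thesis
    using D_pullback_exists[OF assms(1)[unfolded g] f(2,3)] f g unfolding has_pullback_def by metis
qed

lemma D_fib_pullback:
  assumes g: "g \<in> RF" and P: "is_pullback D f g p q"
  shows "p \<in> RF"
proof -
  obtain Z \<phi> B E \<gamma> P p' q' where e: "f = (Z, \<phi>, B)" "g = (E, \<gamma>, B)" "p = (P, p', Z)" "q = (P, q', E)"
    "RO Z" "RO B" "RO E" "RO P" "RT Z \<phi> B" "RT E \<gamma> B" "RT P p' Z" "RT P q' E"
    using D_pullback_shape[OF assms(2)] .
  show ?thesis
    unfolding e(3)
    by (rule pullback_RF[OF e(9,10) D_pullback_level[OF P[unfolded e(1-4)] g[unfolded e(2)]] e(11,12,5) g[unfolded e(2)]])
qed

subsection \<open>Diagrams built by recursion\<close>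

text \<open>Locality: only the part of the diagram below \<open>x\<close> enters. Well-founded
  choice demands this of the predicate it is applied to.\<close>

lemma mcone_below_cong:
  assumes "\<forall>u \<in> N x. Fob A (Cod K u) = Fob A' (Cod K u)"
    "\<forall>u \<in> N x. \<forall>k \<in> Ar K. Dom K k = Cod K u \<longrightarrow> Far A k = Far A' k"
  shows "mcone C K A x = mcone C K A' x"
  using assms unfolding mcone_def by (intro ext) (auto cong: ball_cong)

lemma rstep_below_cong:
  assumes A: "\<forall>u \<in> N x. Fob A (Cod K u) = Fob A' (Cod K u)"
    "\<forall>u \<in> N x. \<forall>k \<in> Ar K. Dom K k = Cod K u \<longrightarrow> Far A k = Far A' k"
    and \<alpha>: "\<forall>u \<in> N x. \<alpha> (Cod K u) = \<alpha>' (Cod K u)"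
  shows "rstep C F K A \<alpha> B x = rstep C F K A' \<alpha>' B x" "rcone C K A \<alpha> B x = rcone C K A' \<alpha>' B x"
proof -
  have "rcone C K A \<alpha> B x L b \<pi> = rcone C K A' \<alpha>' B x L b \<pi>" for L b \<pi>
    unfolding rcone_def mcone_below_cong[OF A] using \<alpha> by (auto cong: ball_cong)
  then show "rcone C K A \<alpha> B x = rcone C K A' \<alpha>' B x" by (intro ext)
  then show "rstep C F K A \<alpha> B x = rstep C F K A' \<alpha>' B x"
    unfolding rstep_def rlim_def by presburger
qed

text \<open>A value of a diagram under construction: its object, its arrows out of it, the component of a
  transformation to a given diagram, and further data.\<close>

type_synonym ('oo, 'jj, 'aa, 'ee) stage = "'oo \<times> ('jj \<Rightarrow> 'aa) \<times> 'aa \<times> 'ee"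

abbreviation v_ob :: "('o, 'j, 'a, 'e) stage \<Rightarrow> 'o" where "v_ob v \<equiv> fst v"
abbreviation v_ar :: "('o, 'j, 'a, 'e) stage \<Rightarrow> 'j \<Rightarrow> 'a" where "v_ar v \<equiv> fst (snd v)"
abbreviation v_tr :: "('o, 'j, 'a, 'e) stage \<Rightarrow> 'a" where "v_tr v \<equiv> fst (snd (snd v))"
abbreviation v_ex :: "('o, 'j, 'a, 'e) stage \<Rightarrow> 'e" where "v_ex v \<equiv> snd (snd (snd v))"

text \<open>An arrow is stored at its source, so the stage at \<open>x\<close> holds the whole cone
  from the value at \<open>x\<close> to the values below it.\<close>

definition dia :: "('i \<Rightarrow> ('o, 'j, 'a, 'e) stage) \<Rightarrow> ('i, 'j, 'o, 'a) fnctr" where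
  "dia G = \<lparr>Fob = (\<lambda>x \<in> Ob K. v_ob (G x)), Far = (\<lambda>u \<in> Ar K. v_ar (G (Dom K u)) u)\<rparr>"

definition tra :: "('i \<Rightarrow> ('o, 'j, 'a, 'e) stage) \<Rightarrow> 'i \<Rightarrow> 'a" where
  "tra G = (\<lambda>x \<in> Ob K. v_tr (G x))"

text \<open>The cone and identity clauses amount to functoriality out of \<open>x\<close>, the
  typing and commutation clauses to naturality there, and the last clause to the Reedy fibration
  condition. Of \<open>G\<close>, only the stages below \<open>x\<close> are consulted.\<close>

definition fstep ::
  "('i, 'j, 'o, 'a) fnctr \<Rightarrow> ('i \<Rightarrow> ('o, 'j, 'a, 'e) stage) \<Rightarrow> 'i \<Rightarrow> ('o, 'j, 'a, 'e) stage \<Rightarrow> bool" where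
  "fstep B G x v \<longleftrightarrow> mcone C K (dia G) x (v_ob v) (v_ar v) \<and> v_ar v (Ide K x) = Ide C (v_ob v) \<and>
     v_tr v \<in> Ar C \<and> Dom C (v_tr v) = v_ob v \<and> Cod C (v_tr v) = Fob B x \<and>
     (\<forall>u \<in> N x. Far B u \<cdot> v_tr v = tra G (Cod K u) \<cdot> v_ar v u) \<and>
     rstep C F K (dia G) (tra G) B x (v_ob v) (v_ar v) (v_tr v)"

lemma dia_cong:
  assumes "\<forall>u \<in> N x. G (Cod K u) = G' (Cod K u)"
  shows "\<forall>u \<in> N x. Fob (dia G) (Cod K u) = Fob (dia G') (Cod K u)"
    "\<forall>u \<in> N x. \<forall>k \<in> Ar K. Dom K k = Cod K u \<longrightarrow> Far (dia G) k = Far (dia G') k"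
    "\<forall>u \<in> N x. tra G (Cod K u) = tra G' (Cod K u)"
  using assms by (simp_all add: dia_def tra_def nonid_Cod)

lemma fstep_cong:
  assumes "\<forall>u \<in> N x. G (Cod K u) = G' (Cod K u)"
  shows "fstep B G x v = fstep B G' x v"
  unfolding fstep_def mcone_below_cong[OF dia_cong(1,2)[OF assms]] rstep_below_cong(1)[OF dia_cong[OF assms]]
  using dia_cong(3)[OF assms] by (auto cong: ball_cong)

text \<open>An arrow out of \<open>x\<close> is the identity or a nonidentity; for the latter the
  composition law is the cone condition, whose proviso on composites is automatic by
  \<open>nonid_cmp\<close>.\<close>

lemma goodI:
  assumes x: "x \<in> Ob K" and c: "mcone C K A x (Fob A x) (Far A)" and i: "Far A (Ide K x) = Ide C (Fob A x)"
    and A: "\<forall>u \<in> N x. \<forall>k \<in> Ar K. Dom K k = Cod K u \<longrightarrow> Far A k \<in> Ar C"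
  shows "good A x"
proof -
  note M = mconeD(1-4)[OF c] mconeD'[OF c]
  have N: "u \<in> Ar K \<Longrightarrow> Dom K u = x \<Longrightarrow> u = Ide K x \<or> u \<in> N x" for u by (auto simp: nonid_def)
  have t: "Far A u \<in> Ar C \<and> Dom C (Far A u) = Fob A x \<and> Cod C (Far A u) = Fob A (Cod K u)" if u: "u \<in> Ar K" "Dom K u = x" for u
    using N[OF u] M(1-4) i x by auto
  have "Far A (k \<cdot>\<^bsub>K\<^esub> u) = Far A k \<cdot> Far A u" if u: "u \<in> Ar K" "Dom K u = x" and k: "k \<in> Ar K" "Dom K k = Cod K u" for u k
  proof (cases "u \<in> N x")
    case True
    then show ?thesis using M(5)[OF True k] by simp
  next
    case False
    then have "u = Ide K x" using N[OF u] by blast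
    then show ?thesis using k i x t[of k] by simp
  qed
  with t i M(1) show ?thesis unfolding good_at_def by blast
qed

lemma nat_atI:
  assumes x: "x \<in> Ob K" and AB: "good A x" "good B x" and \<alpha>: "\<alpha> x \<in> Ar C" "Dom C (\<alpha> x) = Fob A x" "Cod C (\<alpha> x) = Fob B x"
    "\<forall>u \<in> N x. Far B u \<cdot> \<alpha> x = \<alpha> (Cod K u) \<cdot> Far A u"
  shows "natu A \<alpha> B x"
  unfolding nat_at_def
proof (intro conjI ballI impI)
  fix u assume u: "u \<in> Ar K" "Dom K u = x"
  show "Far B u \<cdot> \<alpha> x = \<alpha> (Cod K u) \<cdot> Far A u"
  proof (cases "u = Ide K x")
    case True
    then show ?thesis using goodD(1,5)[OF AB(1)] goodD(1,5)[OF AB(2)] \<alpha> x by simp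
  next
    case False
    then show ?thesis using \<alpha>(4) u by (simp add: nonid_def)
  qed
qed (use \<alpha> in simp_all)

lemma dia_simps:
  "x \<in> Ob K \<Longrightarrow> Fob (dia G) x = v_ob (G x)" "u \<in> Ar K \<Longrightarrow> Far (dia G) u = v_ar (G (Dom K u)) u"
  "x \<in> Ob K \<Longrightarrow> tra G x = v_tr (G x)"
  by (simp_all add: dia_def tra_def)

text \<open>The hypothesis covers \<open>x\<close> and everything below it, and each lower object
  inherits it because composites stay below \<open>x\<close>. Nothing is assumed elsewhere, since
  the recursion needs the conclusion before it is complete.\<close>

lemma fstep_local:
  assumes B: "RO B" and x: "x \<in> Ob K" "fstep B G x (G x)" "\<forall>u \<in> N x. fstep B G (Cod K u) (G (Cod K u))"
  shows "good (dia G) x \<and> natu (dia G) (tra G) B x \<and> rfib_at C F K (dia G) (tra G) B x \<and> fibrant_at C F K (dia G) x"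
  using x
proof (induction x rule: prec_induct)
  case (1 x)
  note x = 1(2)
  have IH: "good (dia G) (Cod K u) \<and> natu (dia G) (tra G) B (Cod K u) \<and> rfib_at C F K (dia G) (tra G) B (Cod K u) \<and>
      fibrant_at C F K (dia G) (Cod K u)" if u: "u \<in> N x" for u
  proof (rule 1(1)[OF u nonid_Cod[OF u]])
    show "fstep B G (Cod K u) (G (Cod K u))" using 1(4) u by blast
    show "\<forall>k \<in> N (Cod K u). fstep B G (Cod K k) (G (Cod K k))"
    proof
      fix k assume k: "k \<in> N (Cod K u)"
      note k' = nonidD[OF k] and u' = nonidD[OF u]
      have "k \<cdot>\<^bsub>K\<^esub> u \<in> N x" using nonid_cmp[OF u k'] .
      then show "fstep B G (Cod K k) (G (Cod K k))" using 1(4) k' u' by fastforce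
    qed
  qed
  note s = 1(3)[unfolded fstep_def]
  have X: "Fob (dia G) x = v_ob (G x)" "tra G x = v_tr (G x)" using x by (simp_all add: dia_simps)
  have Xa: "Far (dia G) u = v_ar (G x) u" if "u \<in> N x" for u using nonidD[OF that] by (simp add: dia_simps)
  have c: "mcone C K (dia G) x (Fob (dia G) x) (Far (dia G))"
    using s mcone_cong[of x "Far (dia G)" "v_ar (G x)"] Xa X by simp
  have g: "good (dia G) x"
  proof (rule goodI[OF x c])
    show "Far (dia G) (Ide K x) = Ide C (Fob (dia G) x)" using s x by (simp add: dia_simps)
    show "\<forall>u \<in> N x. \<forall>k \<in> Ar K. Dom K k = Cod K u \<longrightarrow> Far (dia G) k \<in> Ar C" using IH goodD(2) by blast
  qed
  have n: "natu (dia G) (tra G) B x"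
    by (rule nat_atI[OF x g ROD(2)[OF B x]]) (use s X Xa in simp_all)
  have r: "rfib_at C F K (dia G) (tra G) B x"
  proof -
    obtain L b \<pi> m where "rlim C K (dia G) (tra G) B x L b \<pi>" "m \<in> F" "Dom C m = v_ob (G x)" "Cod C m = L" "b \<cdot> m = v_tr (G x)"
        "\<forall>u\<in>N x. \<pi> u \<cdot> m = v_ar (G x) u"
      using s unfolding rstep_def by blast
    then show ?thesis using X Xa unfolding rstep_def by (metis (no_types, lifting))
  qed
  have below: "good_below (dia G) x" "fibrant_below (dia G) x" "nat_below (dia G) (tra G) B x" using IH by blast+
  from fibrant_of_rstep[OF x below(1,2) ROD(4,5)[OF B] ROD(2,3)[OF B x] below(3) r] g n r
  show ?case by blast
qed

lemma fstep_all:
  assumes B: "RO B" and G: "\<And>x. x \<in> Ob K \<Longrightarrow> fstep B G x (G x)"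
  shows "RO (dia G)" "RT (dia G) (tra G) B" "(dia G, tra G, B) \<in> RF"
proof -
  have l: "good (dia G) x \<and> natu (dia G) (tra G) B x \<and> rfib_at C F K (dia G) (tra G) B x \<and> fibrant_at C F K (dia G) x"
    if "x \<in> Ob K" for x
    using fstep_local[OF B that] G that nonid_Cod by blast
  have f: "is_functor K C (dia G)"
    unfolding functor_iff_good[OF K.category_axioms] using l by (simp add: dia_def)
  then show 1: "RO (dia G)" unfolding reedy_fibrant_iff using l by blast
  show 2: "RT (dia G) (tra G) B"
    unfolding nat_trans_iff_nat[OF K.category_axioms] using l f ROD(1)[OF B] by (simp add: tra_def)
  show "(dia G, tra G, B) \<in> RF" using 1 2 B l by (simp add: reedy_fibrations_iff)
qed

lemma fstep_below:
  assumes B: "RO B" and x: "x \<in> Ob K" and G: "\<And>u. u \<in> N x \<Longrightarrow> fstep B G (Cod K u) (G (Cod K u))"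
  shows "good_below (dia G) x" "fibrant_below (dia G) x" "nat_below (dia G) (tra G) B x" "rfib_below (dia G) (tra G) B x"
proof -
  have "good (dia G) (Cod K u) \<and> natu (dia G) (tra G) B (Cod K u) \<and> rfib_at C F K (dia G) (tra G) B (Cod K u) \<and>
      fibrant_at C F K (dia G) (Cod K u)" if u: "u \<in> N x" for u
  proof (rule fstep_local[OF B nonid_Cod[OF u] G[OF u]])
    show "\<forall>k \<in> N (Cod K u). fstep B G (Cod K k) (G (Cod K k))"
    proof
      fix k assume k: "k \<in> N (Cod K u)"
      note k' = nonidD[OF k] and u' = nonidD[OF u]
      have "k \<cdot>\<^bsub>K\<^esub> u \<in> N x" using nonid_cmp[OF u k'] .
      then show "fstep B G (Cod K k) (G (Cod K k))" using G[of "k \<cdot>\<^bsub>K\<^esub> u"] k' u' by simp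
    qed
  qed
  then show "good_below (dia G) x" "fibrant_below (dia G) x" "nat_below (dia G) (tra G) B x" "rfib_below (dia G) (tra G) B x"
    by blast+
qed

text \<open>The general extension step: every fibration onto the relative matching object gives a
  legitimate next value, and the constructions differ in which fibration they take. The entry at the
  identity is filled in by hand, as \<open>\<pi>\<close> is unconstrained there.\<close>

lemma fstep_of_fib:
  assumes B: "RO B" and x: "x \<in> Ob K" and G: "\<And>u. u \<in> N x \<Longrightarrow> fstep B G (Cod K u) (G (Cod K u))"
    and L: "rlim C K (dia G) (tra G) B x L b \<pi>" and p: "p \<in> F" "Cod C p = L"
  shows "fstep B G x (Dom C p, \<lambda>u. if u = Ide K x then Ide C (Dom C p) else \<pi> u \<cdot> p, b \<cdot> p, e)"
proof -
  note below = fstep_below[OF B x G]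
  let ?a = "\<lambda>u. if u = Ide K x then Ide C (Dom C p) else \<pi> u \<cdot> p"
  have a: "\<forall>u \<in> N x. ?a u = \<pi> u \<cdot> p" by (simp add: nonid_def)
  have c: "rcone C K (dia G) (tra G) B x (Dom C p) (b \<cdot> p) ?a"
    using rcone_cong[OF a, of "dia G" "tra G" B "Dom C p" "b \<cdot> p"] p
      rcone_cmp[OF below(1) ROD(2)[OF B x] below(3) rlim_cone[OF L], of p] by simp
  note R = rconeD[OF c]
  show ?thesis
    unfolding fstep_def fst_conv snd_conv rstep_def
    using R L p a by (intro conjI exI[of _ L] exI[of _ b] exI[of _ \<pi>] exI[of _ p]) simp_all
qed

end

context inverse_diagrams
begin

text \<open>Well-founded dependent choice. Membership in \<open>Ob K\<close> is moved into the
  predicate, because the choice ranges over the whole type while stages matter only at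
  objects.\<close>

lemma prec_choice:
  fixes P :: "('i \<Rightarrow> 'b) \<Rightarrow> 'i \<Rightarrow> 'b \<Rightarrow> bool"
  assumes cong: "\<And>G G' x v. x \<in> Ob K \<Longrightarrow> (\<forall>u \<in> N x. G (Cod K u) = G' (Cod K u)) \<Longrightarrow> P G x v = P G' x v"
    and step: "\<And>G x. x \<in> Ob K \<Longrightarrow> (\<And>u. u \<in> N x \<Longrightarrow> P G (Cod K u) (G (Cod K u))) \<Longrightarrow> \<exists>v. P G x v"
  obtains G where "\<forall>x \<in> Ob K. P G x (G x)"
proof -
  have "\<exists>G. \<forall>x. x \<in> Ob K \<longrightarrow> P G x (G x)"
  proof (rule dependent_wf_choice[OF wf_prec, of "\<lambda>G x v. x \<in> Ob K \<longrightarrow> P G x v"])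
    fix G G' :: "'i \<Rightarrow> 'b" and x v assume e: "\<And>z. (z, x) \<in> prec \<Longrightarrow> G z = G' z"
    have "\<forall>u \<in> N x. G (Cod K u) = G' (Cod K u)" using e by (auto simp: prec_def)
    then show "(x \<in> Ob K \<longrightarrow> P G x v) = (x \<in> Ob K \<longrightarrow> P G' x v)" using cong[of x G G' v] by blast
  next
    fix x G assume e: "\<And>y. (y, x) \<in> prec \<Longrightarrow> y \<in> Ob K \<longrightarrow> P G y (G y)"
    have "P G (Cod K u) (G (Cod K u))" if "u \<in> N x" for u
      using e[of "Cod K u"] that nonid_Cod[OF that] by (auto simp: prec_def)
    then show "\<exists>v. x \<in> Ob K \<longrightarrow> P G x v" using step[of x G] by blast
  qed
  then show thesis using that by blast
qed

lemma Far_dia: "u \<in> N x \<Longrightarrow> Far (dia G) u = v_ar (G x) u"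
  by (simp add: nonid_def dia_simps)

subsection \<open>Factorizations and lifting\<close>

lemma D_factor:
  assumes A: "RO A" and B: "RO B" and \<phi>: "RT A \<phi> B"
  obtains Y \<iota> \<pi> where "RO Y" "RT A \<iota> Y" "(Y, \<pi>, B) \<in> RF" "\<forall>x \<in> Ob K. acyclic_cofibration C F (\<iota> x)"
    "(Y, \<pi>, B) \<cdot>\<^bsub>D\<^esub> (A, \<iota>, Y) = (A, \<phi>, B)"
proof -
  note fA = functor_simps[OF ROD(1)[OF A]]
  \<comment> \<open>The extra datum of a stage is the component of the acyclic cofibration at that
    object; the last clause is its naturality.\<close>
  define P where "P G x v \<longleftrightarrow> fstep B G x v \<and> acyclic_cofibration C F (v_ex v) \<and> Dom C (v_ex v) = Fob A x \<and>
      Cod C (v_ex v) = v_ob v \<and> v_tr v \<cdot> v_ex v = \<phi> x \<and>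
      (\<forall>u \<in> N x. v_ar v u \<cdot> v_ex v = v_ex (G (Cod K u)) \<cdot> Far A u)"
    for G :: "'i \<Rightarrow> ('o, 'j, 'a, 'a) stage" and x v
  obtain G where G: "\<forall>x \<in> Ob K. P G x (G x)"
  proof (rule prec_choice[of P])
    fix G G' :: "'i \<Rightarrow> ('o, 'j, 'a, 'a) stage" and x v assume e: "\<forall>u \<in> N x. G (Cod K u) = G' (Cod K u)"
    show "P G x v = P G' x v" unfolding P_def fstep_cong[OF e] using e by (auto cong: ball_cong)
  next
    fix G :: "'i \<Rightarrow> ('o, 'j, 'a, 'a) stage" and x assume x: "x \<in> Ob K" and PG: "\<And>u. u \<in> N x \<Longrightarrow> P G (Cod K u) (G (Cod K u))"
    have G: "fstep B G (Cod K u) (G (Cod K u))" "v_ex (G (Cod K u)) \<in> Ar C"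
      "Dom C (v_ex (G (Cod K u))) = Fob A (Cod K u)"
      "Cod C (v_ex (G (Cod K u))) = v_ob (G (Cod K u))" "v_tr (G (Cod K u)) \<cdot> v_ex (G (Cod K u)) = \<phi> (Cod K u)"
      "\<forall>k \<in> N (Cod K u). v_ar (G (Cod K u)) k \<cdot> v_ex (G (Cod K u)) = v_ex (G (Cod K k)) \<cdot> Far A k" if "u \<in> N x" for u
      using PG[OF that, unfolded P_def] acof_Ar[of C F "v_ex (G (Cod K u))"] by simp_all
    note below = fstep_below[OF B x G(1)]
    note RA = ROD[OF A] and RB = ROD[OF B]
    obtain L b \<pi> where L: "rlim C K (dia G) (tra G) B x L b \<pi>"
      using rlim_exists[OF x below(1,2) RB(4,5) RB(2,3)[OF x] below(3)] .
    let ?i = "\<lambda>x. v_ex (G x)"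
    have nat: "nat_below A ?i (dia G) x"
    proof
      fix u assume u: "u \<in> N x"
      note y = nonid_Cod[OF u]
      show "natu A ?i (dia G) (Cod K u)"
      proof (rule nat_atI[OF y RA(2)[OF y]])
        show "good (dia G) (Cod K u)" using below(1) u by blast
        show "\<forall>k\<in>N (Cod K u). Far (dia G) k \<cdot> v_ex (G (Cod K u)) = v_ex (G (Cod K k)) \<cdot> Far A k"
          using G(6)[OF u] by (simp add: Far_dia)
      qed (use G(2-4)[OF u] y in \<open>simp_all add: dia_simps\<close>)
    qed
    \<comment> \<open>The components already built map \<open>A\<close> at \<open>x\<close> to the
      relative matching object: the leg to \<open>B\<close> is \<open>\<phi> x\<close>, and the
      others are arrows of \<open>A\<close> followed by lower components.\<close>
    have c: "rcone C K (dia G) (tra G) B x (Fob A x) (\<phi> x) (\<lambda>u. ?i (Cod K u) \<cdot> Far A u)"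
      unfolding rcone_def
    proof (intro conjI ballI)
      show "mcone C K (dia G) x (Fob A x) (\<lambda>u. ?i (Cod K u) \<cdot> Far A u)"
        by (rule mcone_trans[OF RA(4) below(1) nat mcone_good[OF RA(2)[OF x]]])
      fix u assume u: "u \<in> N x"
      note u' = nonidD[OF u] and y = nonid_Cod[OF u]
      have t: "v_tr (G (Cod K u)) \<in> Ar C" "Dom C (v_tr (G (Cod K u))) = v_ob (G (Cod K u))"
        using G(1)[OF u] unfolding fstep_def by blast+
      have "tra G (Cod K u) \<cdot> (?i (Cod K u) \<cdot> Far A u) = \<phi> (Cod K u) \<cdot> Far A u"
        using G(5)[OF u] t y by (subst cmp_ext) (use u' t y G(2-4)[OF u] fA in \<open>simp_all add: dia_simps\<close>)
      then show "Far B u \<cdot> \<phi> x = tra G (Cod K u) \<cdot> (?i (Cod K u) \<cdot> Far A u)"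
        using RTD(4)[OF \<phi> u'(1)] u' by simp
    qed (use RTD(1-3)[OF \<phi> x] in simp_all)
    obtain w where w: "w \<in> Ar C" "Dom C w = Fob A x" "Cod C w = L" "b \<cdot> w = \<phi> x"
      "\<And>u. u \<in> N x \<Longrightarrow> \<pi> u \<cdot> w = ?i (Cod K u) \<cdot> Far A u"
      using rlim_obtain[OF L c] by blast
    \<comment> \<open>Factoring \<open>w\<close> yields the next value, as the source of
      \<open>p\<close>, and the next component \<open>i\<close> at once.\<close>
    obtain i p where ip: "acyclic_cofibration C F i" "p \<in> F" "Cod C i = Dom C p" "p \<cdot> i = w"
      using factorization[OF w(1)] by blast
    note i = acof_Ar[OF ip(1)]
    note R = rconeD[OF rlim_cone[OF L]]
    have d: "Dom C i = Fob A x" "Cod C p = L"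
      using w(2,3) cmp_simps[of i p] ip i by auto
    have "P G x (Dom C p, \<lambda>u. if u = Ide K x then Ide C (Dom C p) else \<pi> u \<cdot> p, b \<cdot> p, i)"
      unfolding P_def fst_conv snd_conv
    proof (intro conjI ballI)
      show "fstep B G x (Dom C p, \<lambda>u. if u = Ide K x then Ide C (Dom C p) else \<pi> u \<cdot> p, b \<cdot> p, i)"
        by (rule fstep_of_fib[OF B x G(1) L ip(2) d(2)])
      show "(b \<cdot> p) \<cdot> i = \<phi> x" using R(2-4) ip i d w by simp
      fix u assume u: "u \<in> N x"
      have "(\<pi> u \<cdot> p) \<cdot> i = \<pi> u \<cdot> w"
        using rcone_below_typed[OF rlim_cone[OF L] u] ip i d by simp
      then show "(if u = Ide K x then Ide C (Dom C p) else \<pi> u \<cdot> p) \<cdot> i = v_ex (G (Cod K u)) \<cdot> Far A u"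
        using w(5)[OF u] u by (simp add: nonid_def)
    qed (use ip d in simp_all)
    then show "\<exists>v. P G x v" ..
  qed
  have st: "x \<in> Ob K \<Longrightarrow> fstep B G x (G x)" for x using G[rule_format, of x, unfolded P_def] by simp
  have ex: "acyclic_cofibration C F (v_ex (G x))" "Dom C (v_ex (G x)) = Fob A x"
      "Cod C (v_ex (G x)) = v_ob (G x)" "v_tr (G x) \<cdot> v_ex (G x) = \<phi> x"
      "\<forall>u \<in> N x. v_ar (G x) u \<cdot> v_ex (G x) = v_ex (G (Cod K u)) \<cdot> Far A u" if "x \<in> Ob K" for x
    using G[rule_format, OF that, unfolded P_def] by simp_all
  note Y = fstep_all[OF B st]
  let ?\<iota> = "\<lambda>x \<in> Ob K. v_ex (G x)"
  have nat: "natu A ?\<iota> (dia G) x" if x: "x \<in> Ob K" for x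
    by (rule nat_atI[OF x ROD(2)[OF A x] ROD(2)[OF Y(1) x]])
      (use ex[OF x] acof_Ar[OF ex(1)[OF x]] x in \<open>simp_all add: dia_simps Far_dia nonid_Cod\<close>)
  have \<iota>: "RT A ?\<iota> (dia G)"
    unfolding nat_trans_iff_nat[OF K.category_axioms] using nat ROD(1)[OF A] ROD(1)[OF Y(1)] by simp
  have "(\<lambda>j \<in> Ob K. tra G j \<cdot> ?\<iota> j) = \<phi>"
    by (rule extensionalityI[of _ "Ob K"]) (use ex RTD(5)[OF \<phi>] in \<open>simp_all add: dia_simps\<close>)
  then have "(dia G, tra G, B) \<cdot>\<^bsub>D\<^esub> (A, ?\<iota>, dia G) = (A, \<phi>, B)" by (simp add: D_cmp)
  with Y \<iota> ex(1) that show thesis by simp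
qed

lemma D_lift:
  assumes \<iota>: "RO A" "RO B" "RT A \<iota> B" "\<forall>x \<in> Ob K. acyclic_cofibration C F (\<iota> x)"
    and \<pi>: "(X, \<pi>, Y) \<in> RF" and a: "RT A a X" and b: "RT B b Y"
    and e: "\<And>x. x \<in> Ob K \<Longrightarrow> \<pi> x \<cdot> a x = b x \<cdot> \<iota> x"
  obtains h where "RT B h X" "\<And>x. x \<in> Ob K \<Longrightarrow> h x \<cdot> \<iota> x = a x" "\<And>x. x \<in> Ob K \<Longrightarrow> \<pi> x \<cdot> h x = b x"
proof -
  note RA = ROD[OF \<iota>(1)] and RB = ROD[OF \<iota>(2)] and RX = ROD[OF RFD(1)[OF \<pi>]] and RY = ROD[OF RFD(2)[OF \<pi>]]
  note fA = functor_simps[OF RA(1)] and fB = functor_simps[OF RB(1)] and fX = functor_simps[OF RX(1)] and fY = functor_simps[OF RY(1)]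
  note ti = RTD[OF \<iota>(3)] and tp = RTD[OF RFD(3)[OF \<pi>]] and ta = RTD[OF a] and tb = RTD[OF b]
  define P where "P h x v \<longleftrightarrow> v \<in> Ar C \<and> Dom C v = Fob B x \<and> Cod C v = Fob X x \<and> v \<cdot> \<iota> x = a x \<and> \<pi> x \<cdot> v = b x \<and>
      (\<forall>u \<in> N x. Far X u \<cdot> v = h (Cod K u) \<cdot> Far B u)"
    for h :: "'i \<Rightarrow> 'a" and x v
  obtain h where h: "\<forall>x \<in> Ob K. P h x (h x)"
  proof (rule prec_choice[of P])
    fix h h' :: "'i \<Rightarrow> 'a" and x v assume e: "\<forall>u \<in> N x. h (Cod K u) = h' (Cod K u)"
    show "P h x v = P h' x v" unfolding P_def using e by (auto cong: ball_cong)
  next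
    fix h x assume x: "x \<in> Ob K" and Ph: "\<And>u. u \<in> N x \<Longrightarrow> P h (Cod K u) (h (Cod K u))"
    have h: "h (Cod K u) \<in> Ar C" "Dom C (h (Cod K u)) = Fob B (Cod K u)" "Cod C (h (Cod K u)) = Fob X (Cod K u)"
      "h (Cod K u) \<cdot> \<iota> (Cod K u) = a (Cod K u)" "\<pi> (Cod K u) \<cdot> h (Cod K u) = b (Cod K u)"
      "\<forall>k \<in> N (Cod K u). Far X k \<cdot> h (Cod K u) = h (Cod K k) \<cdot> Far B k" if "u \<in> N x" for u
      using Ph[OF that, unfolded P_def] by simp_all
    have nat: "nat_below B h X x"
    proof
      fix u assume u: "u \<in> N x"
      note y = nonid_Cod[OF u]
      show "natu B h X (Cod K u)"
        by (rule nat_atI[OF y RB(2)[OF y] RX(2)[OF y]]) (use h[OF u] in simp_all)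
    qed
    obtain L l \<rho> m where m: "rlim C K X \<pi> Y x L l \<rho>" "m \<in> F" "Dom C m = Fob X x" "Cod C m = L"
      "l \<cdot> m = \<pi> x" "\<forall>u \<in> N x. \<rho> u \<cdot> m = Far X u" using RFD(4)[OF \<pi> x] unfolding rstep_def by blast
    have m': "m \<in> Ar C" using m by simp
    note R = rconeD[OF rlim_cone[OF m(1)]] and T = rcone_below_typed[OF rlim_cone[OF m(1)]]
    \<comment> \<open>The lift below \<open>x\<close> together with \<open>b x\<close> determines
      the bottom edge \<open>s\<close> of the lifting square at \<open>x\<close>. A diagonal over
      \<open>s\<close> is then automatically natural with respect to the lower components and lies
      over \<open>b x\<close>.\<close>
    have c: "rcone C K X \<pi> Y x (Fob B x) (b x) (\<lambda>u. h (Cod K u) \<cdot> Far B u)"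
      unfolding rcone_def
    proof (intro conjI ballI)
      show "mcone C K X x (Fob B x) (\<lambda>u. h (Cod K u) \<cdot> Far B u)"
        by (rule mcone_trans[OF RB(4) RX(4) nat mcone_good[OF RB(2)[OF x]]])
      fix u assume u: "u \<in> N x"
      note u' = nonidD[OF u] and y = nonid_Cod[OF u]
      have "\<pi> (Cod K u) \<cdot> (h (Cod K u) \<cdot> Far B u) = b (Cod K u) \<cdot> Far B u"
        by (rule cmp_ext[OF h(5)[OF u]]) (use u' y tp(1-3) h(1-3)[OF u] fB in simp_all)
      then show "Far Y u \<cdot> b x = \<pi> (Cod K u) \<cdot> (h (Cod K u) \<cdot> Far B u)"
        using tb(4)[OF u'(1)] u' by simp
    qed (use tb(1-3) x in simp_all)
    obtain s where s: "s \<in> Ar C" "Dom C s = Fob B x" "Cod C s = L" "l \<cdot> s = b x" "\<And>u. u \<in> N x \<Longrightarrow> \<rho> u \<cdot> s = h (Cod K u) \<cdot> Far B u"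
      using rlim_obtain[OF m(1) c] by blast
    \<comment> \<open>Commutativity is checked on the legs of the relative matching object, where it
      follows from the lower lifts extending \<open>a\<close>.\<close>
    have "m \<cdot> a x = s \<cdot> \<iota> x"
    proof (rule rlim_unique[OF m(1) RX(4) RY(2)[OF x] natural_transD(4)[OF RFD(3)[OF \<pi>]]])
      show "l \<cdot> (m \<cdot> a x) = l \<cdot> (s \<cdot> \<iota> x)"
        using m(5)[THEN cmp_ext] s(4)[THEN cmp_ext] e[OF x] m m' s R(2-4) ta(1-3) ti(1-3) x by simp
      fix u assume u: "u \<in> N x"
      note u' = nonidD[OF u] and y = nonid_Cod[OF u]
      have "\<rho> u \<cdot> (m \<cdot> a x) = Far X u \<cdot> a x"
        using m(6) u by (intro cmp_ext) (use m m' T[OF u] ta(1-3) x in simp_all)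
      also have "\<dots> = a (Cod K u) \<cdot> Far A u" using ta(4)[OF u'(1)] u' by simp
      also have "\<dots> = h (Cod K u) \<cdot> (\<iota> (Cod K u) \<cdot> Far A u)"
        using h(4)[OF u] by (intro cmp_ext[symmetric]) (use u' y h(1-3)[OF u] ti(1-3) fA in simp_all)
      also have "\<dots> = (h (Cod K u) \<cdot> Far B u) \<cdot> \<iota> x"
        using ti(4)[OF u'(1)] u' y h(1-3)[OF u] ti(1-3) fB x by simp
      also have "\<dots> = \<rho> u \<cdot> (s \<cdot> \<iota> x)"
        using s(5)[OF u] by (intro cmp_ext[symmetric]) (use s T[OF u] ti(1-3) x in simp_all)
      finally show "\<rho> u \<cdot> (m \<cdot> a x) = \<rho> u \<cdot> (s \<cdot> \<iota> x)" .
    qed (use m m' s ta(1-3) ti(1-3) x in simp_all)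
    then obtain v where v: "v \<in> Ar C" "Dom C v = Fob B x" "Cod C v = Fob X x" "v \<cdot> \<iota> x = a x" "m \<cdot> v = s"
      using acof_lift[OF \<iota>(4)[rule_format, OF x] m(2), of "a x" s] m s ta(1-3) ti(1-3) x by auto
    have "P h x v"
      unfolding P_def
    proof (intro conjI ballI)
      have "\<pi> x \<cdot> v = l \<cdot> (m \<cdot> v)"
        using m(5) by (intro cmp_ext[symmetric]) (use m m' v R in simp_all)
      then show "\<pi> x \<cdot> v = b x" using v s by simp
      fix u assume u: "u \<in> N x"
      have "Far X u \<cdot> v = \<rho> u \<cdot> (m \<cdot> v)"
        using m(6) u by (intro cmp_ext[symmetric]) (use m m' v T[OF u] in simp_all)
      then show "Far X u \<cdot> v = h (Cod K u) \<cdot> Far B u" using v s(5)[OF u] by simp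
    qed (use v in simp_all)
    then show "\<exists>v. P h x v" ..
  qed
  have h': "h x \<in> Ar C" "Dom C (h x) = Fob B x" "Cod C (h x) = Fob X x" "h x \<cdot> \<iota> x = a x" "\<pi> x \<cdot> h x = b x"
      "\<forall>u \<in> N x. Far X u \<cdot> h x = h (Cod K u) \<cdot> Far B u" if "x \<in> Ob K" for x
    using h[rule_format, OF that, unfolded P_def] by simp_all
  have nat: "natu B (restrict h (Ob K)) X x" if x: "x \<in> Ob K" for x
    by (rule nat_atI[OF x RB(2)[OF x] RX(2)[OF x]]) (use h'[OF x] x nonid_Cod in auto)
  have "RT B (restrict h (Ob K)) X"
    unfolding nat_trans_iff_nat[OF K.category_axioms] using nat RB(1) RX(1) by simp
  then show thesis using that h' by simp
qed

section \<open>Acyclic cofibrations of diagrams and the axioms about them\<close>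

lemma D_acof_of_level:
  assumes \<iota>: "RO A" "RO B" "RT A \<iota> B" "\<forall>x \<in> Ob K. acyclic_cofibration C F (\<iota> x)"
  shows "acyclic_cofibration D RF (A, \<iota>, B)"
proof (rule D.acofI)
  show "(A, \<iota>, B) \<in> Ar D" using \<iota> by (simp add: reedy_Ar)
  fix p u v assume p: "p \<in> RF" and uv: "u \<in> Ar D" "v \<in> Ar D" "Dom D u = Dom D (A, \<iota>, B)" "Cod D u = Dom D p"
    "Dom D v = Cod D (A, \<iota>, B)" "Cod D v = Cod D p" and e: "p \<cdot>\<^bsub>D\<^esub> u = v \<cdot>\<^bsub>D\<^esub> (A, \<iota>, B)"
  obtain X \<pi> Y where p': "p = (X, \<pi>, Y)" by (cases p)
  note \<pi> = p[unfolded p']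
  obtain a where u: "u = (A, a, X)" "RT A a X" using uv p' by (auto simp: D_Ar D_simps)
  obtain b where v: "v = (B, b, Y)" "RT B b Y" using uv p' by (auto simp: D_Ar D_simps)
  have e': "\<pi> x \<cdot> a x = b x \<cdot> \<iota> x" if "x \<in> Ob K" for x
    by (rule D_cmp_level[OF e[unfolded p' u(1) v(1)] that])
  obtain h where h: "RT B h X" "\<And>x. x \<in> Ob K \<Longrightarrow> h x \<cdot> \<iota> x = a x" "\<And>x. x \<in> Ob K \<Longrightarrow> \<pi> x \<cdot> h x = b x"
    using D_lift[OF \<iota> \<pi> u(2) v(2) e'] by blast
  have "(\<lambda>j\<in>Ob K. h j \<cdot> \<iota> j) = a" "(\<lambda>j\<in>Ob K. \<pi> j \<cdot> h j) = b"
    by (rule extensionalityI[of _ "Ob K"]; use h RTD(5)[OF u(2)] RTD(5)[OF v(2)] in simp)+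
  then show "\<exists>h. h \<in> Ar D \<and> Dom D h = Cod D (A, \<iota>, B) \<and> Cod D h = Dom D p \<and> h \<cdot>\<^bsub>D\<^esub> (A, \<iota>, B) = u \<and> p \<cdot>\<^bsub>D\<^esub> h = v"
    using h(1) \<iota>(2) RFD(1)[OF \<pi>] by (intro exI[of _ "(B, h, X)"]) (simp add: D_simps reedy_Ar p' u v)
qed

text \<open>By the retract argument, applied to a factorization with a levelwise acyclic cofibration.\<close>

lemma D_acof_level:
  assumes i: "acyclic_cofibration D RF (A, \<iota>, B)" and x: "x \<in> Ob K"
  shows "acyclic_cofibration C F (\<iota> x)"
proof -
  have AB: "RO A" "RO B" "RT A \<iota> B" using acof_Ar[OF i] by (simp_all add: reedy_Ar)
  obtain Y j \<pi> where Y: "RO Y" "RT A j Y" "(Y, \<pi>, B) \<in> RF" "\<forall>x \<in> Ob K. acyclic_cofibration C F (j x)"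
    "(Y, \<pi>, B) \<cdot>\<^bsub>D\<^esub> (A, j, Y) = (A, \<iota>, B)"
    using D_factor[OF AB] .
  have B: "Ide D B \<in> Ar D" "Dom D (Ide D B) = B" "Cod D (Ide D B) = B" "Ide D B \<cdot>\<^bsub>D\<^esub> (A, \<iota>, B) = (A, \<iota>, B)"
    using D.ide_simps[of B] D.ide_left[OF acof_Ar[OF i], of B] AB(2) by (simp_all add: reedy_Ob D_simps)
  have YA: "(A, j, Y) \<in> Ar D" using AB Y by (simp add: reedy_Ar)
  \<comment> \<open>Lifting against \<open>\<pi>\<close> over the identity of \<open>B\<close>
    exhibits \<open>\<iota>\<close> as a retract of \<open>j\<close>. A filler for \<open>j\<close>
    at \<open>x\<close> then becomes one for \<open>\<iota>\<close> after composition with the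
    component of this lift.\<close>
  obtain s where s: "s \<in> Ar D" "Dom D s = Cod D (A, \<iota>, B)" "Cod D s = Dom D (Y, \<pi>, B)" "s \<cdot>\<^bsub>D\<^esub> (A, \<iota>, B) = (A, j, Y)"
    "(Y, \<pi>, B) \<cdot>\<^bsub>D\<^esub> s = Ide D B"
    by (rule acof_lift[OF i Y(3) YA B(1)]) (use Y(5) B in \<open>simp_all add: D_simps\<close>)
  obtain \<sigma> where \<sigma>: "s = (B, \<sigma>, Y)" "RT B \<sigma> Y" using s(1-3) by (auto simp: D_Ar D_simps)
  have e: "\<pi> x \<cdot> j x = \<iota> x" "\<sigma> x \<cdot> \<iota> x = j x" "\<pi> x \<cdot> \<sigma> x = Ide C (Fob B x)"
    using D_cmp_eq[OF Y(5) x] D_cmp_eq[OF s(4)[unfolded \<sigma>(1)] x] D_cmp_eq[OF s(5)[unfolded \<sigma>(1) D_simps(3)] x] x by simp_all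
  note ti = RTD(1-3)[OF AB(3) x] and tj = RTD(1-3)[OF Y(2) x] and ts = RTD(1-3)[OF \<sigma>(2) x] and tp = RTD(1-3)[OF RFD(3)[OF Y(3)] x]
  show ?thesis
  proof (rule acofI)
    fix q u v assume q: "q \<in> F" "u \<in> Ar C" "v \<in> Ar C" "Dom C u = Dom C (\<iota> x)" "Cod C u = Dom C q" "Dom C v = Cod C (\<iota> x)"
      "Cod C v = Cod C q" "q \<cdot> u = v \<cdot> \<iota> x"
    have "q \<cdot> u = (v \<cdot> \<pi> x) \<cdot> j x" using q ti tj tp e(1) by simp
    then obtain h where h: "h \<in> Ar C" "Dom C h = Cod C (j x)" "Cod C h = Dom C q" "h \<cdot> j x = u" "q \<cdot> h = v \<cdot> \<pi> x"
      using acof_lift[OF Y(4)[rule_format, OF x] q(1,2), of "v \<cdot> \<pi> x"] q ti tj tp by auto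
    have "q \<cdot> (h \<cdot> \<sigma> x) = (v \<cdot> \<pi> x) \<cdot> \<sigma> x"
      using h(5) by (intro cmp_ext) (use h q ts tj in simp_all)
    then have "q \<cdot> (h \<cdot> \<sigma> x) = v" using q tp ts ti e(3) by simp
    moreover have "(h \<cdot> \<sigma> x) \<cdot> \<iota> x = u" using h ts ti tj e(2) by simp
    ultimately show "\<exists>h. h \<in> Ar C \<and> Dom C h = Cod C (\<iota> x) \<and> Cod C h = Dom C q \<and> h \<cdot> \<iota> x = u \<and> q \<cdot> h = v"
      using h ts ti tj by (intro exI[of _ "h \<cdot> \<sigma> x"]) simp
  qed (rule ti(1))
qed

lemma D_factorization:
  assumes "f \<in> Ar D"
  shows "\<exists>i p. acyclic_cofibration D RF i \<and> p \<in> RF \<and> Cod D i = Dom D p \<and> p \<cdot>\<^bsub>D\<^esub> i = f"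
proof -
  obtain A \<phi> B where f: "f = (A, \<phi>, B)" "RO A" "RO B" "RT A \<phi> B" using assms unfolding D_Ar by blast
  obtain Y \<iota> \<pi> where Y: "RO Y" "RT A \<iota> Y" "(Y, \<pi>, B) \<in> RF" "\<forall>x \<in> Ob K. acyclic_cofibration C F (\<iota> x)"
    "(Y, \<pi>, B) \<cdot>\<^bsub>D\<^esub> (A, \<iota>, Y) = (A, \<phi>, B)"
    using D_factor[OF f(2-4)] .
  show ?thesis
    using D_acof_of_level[OF f(2) Y(1,2,4)] Y f
    by (intro exI[of _ "(A, \<iota>, Y)"] exI[of _ "(Y, \<pi>, B)"]) (simp add: D_simps)
qed

text \<open>Acyclic cofibrations and pullbacks along Reedy fibrations are levelwise, so at each
  object the claim is the same axiom of \<open>C\<close>, in its form for arbitrary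
  pullbacks.\<close>

lemma D_acof_pullback:
  assumes a: "a \<in> RF" and b: "b \<in> RF" and ab: "Cod D a = Cod D b"
    and i: "acyclic_cofibration D RF i" "i \<in> hom D (Dom D a) (Dom D b)" "b \<cdot>\<^bsub>D\<^esub> i = a"
    and z: "z \<in> Ar D" "Cod D z = Cod D a"
  shows "acyclic_cofibration D RF (pb_induced D z b (pb_fst D z a) (i \<cdot>\<^bsub>D\<^esub> pb_snd D z a))"
proof -
  obtain A \<alpha> B where a': "a = (A, \<alpha>, B)" by (cases a)
  obtain A' \<beta> where b': "b = (A', \<beta>, B)" using ab by (cases b) (auto simp: a' D_simps)
  obtain \<iota> where i': "i = (A, \<iota>, A')" "RT A \<iota> A'" using i(2) unfolding D_hom a' b' by (auto simp: D_simps)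
  obtain Z \<zeta> where z': "z = (Z, \<zeta>, B)" "RO Z" "RT Z \<zeta> B" using z unfolding D_Ar a' by (auto simp: D_simps)
  have za: "has_pullback D z a" and zb: "has_pullback D z b"
    using D_has_pullback[OF a z] D_has_pullback[OF b z(1)] z(2) ab by simp_all
  note Pa = D.pb_is_pullback[OF za] and Pb = D.pb_is_pullback[OF zb]
  obtain P p q where pq: "pb_fst D z a = (P, p, Z)" "pb_snd D z a = (P, q, A)" "RO P" "RT P p Z" "RT P q A"
    using D_pullback_shape[OF Pa] a' z'(1) by (metis prod.inject)
  obtain Q p' q' where pq': "pb_fst D z b = (Q, p', Z)" "pb_snd D z b = (Q, q', A')" "RO Q" "RT Q p' Z" "RT Q q' A'"
    using D_pullback_shape[OF Pb] b' z'(1) by (metis prod.inject)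
  let ?h = "pb_induced D z b (pb_fst D z a) (i \<cdot>\<^bsub>D\<^esub> pb_snd D z a)"
  note Pa' = D.pullbackD[OF Pa] and Pb' = D.pullbackD[OF Pb]
  have iA: "i \<in> Ar D" "Dom D i = Dom D a" "Cod D i = Dom D b" using i(2) by (auto simp: hom_def)
  have "z \<cdot>\<^bsub>D\<^esub> pb_fst D z a = b \<cdot>\<^bsub>D\<^esub> (i \<cdot>\<^bsub>D\<^esub> pb_snd D z a)"
    using D.cmp_ext[OF i(3) iA(1), of "pb_snd D z a"] Pa' Pb'(2) iA by simp
  then have h: "?h \<in> Ar D" "Dom D ?h = Dom D (pb_fst D z a)" "Cod D ?h = Dom D (pb_fst D z b)"
    "pb_fst D z b \<cdot>\<^bsub>D\<^esub> ?h = pb_fst D z a" "pb_snd D z b \<cdot>\<^bsub>D\<^esub> ?h = i \<cdot>\<^bsub>D\<^esub> pb_snd D z a"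
    using D.pb_induced[OF zb, of "pb_fst D z a" "i \<cdot>\<^bsub>D\<^esub> pb_snd D z a"] Pa' Pb'(2) iA by simp_all
  obtain \<eta> where \<eta>: "?h = (P, \<eta>, Q)" "RT P \<eta> Q"
    using h(1-3) pq pq' by (auto simp: D_Ar D_simps)
  have "acyclic_cofibration C F (\<eta> x)" if x: "x \<in> Ob K" for x
  proof -
    note ta = RTD(1-3)[OF RFD(3)[OF a[unfolded a']] x] and tb = RTD(1-3)[OF RFD(3)[OF b[unfolded b']] x]
      and ti = RTD(1-3)[OF i'(2) x] and tz = RTD(1-3)[OF z'(3) x] and te = RTD(1-3)[OF \<eta>(2) x]
      and tpq = RTD(1-3)[OF pq(4) x] RTD(1-3)[OF pq'(4) x]
    show ?thesis
    proof (rule acof_pullback'[of "\<alpha> x" "\<beta> x" "\<iota> x" "\<zeta> x" "p x" "q x" "p' x" "q' x"])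
      show "\<alpha> x \<in> F" "\<beta> x \<in> F" using RF_level[OF a[unfolded a'] x] RF_level[OF b[unfolded b'] x] .
      show "acyclic_cofibration C F (\<iota> x)" by (rule D_acof_level[OF i(1)[unfolded i'(1)] x])
      show "\<beta> x \<cdot> \<iota> x = \<alpha> x" by (rule D_cmp_eq[OF i(3)[unfolded a' b' i'(1)] x])
      show "is_pullback C (\<zeta> x) (\<alpha> x) (p x) (q x)"
        using D_pullback_level[OF _ a[unfolded a'] x] Pa pq z'(1) a' by simp
      show "is_pullback C (\<zeta> x) (\<beta> x) (p' x) (q' x)"
        using D_pullback_level[OF _ b[unfolded b'] x] Pb pq' z'(1) b' by simp
      show "p' x \<cdot> \<eta> x = p x" by (rule D_cmp_eq[OF h(4)[unfolded \<eta>(1), unfolded pq pq'] x])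
      show "q' x \<cdot> \<eta> x = \<iota> x \<cdot> q x" by (rule D_cmp_level[OF h(5)[unfolded \<eta>(1), unfolded pq pq' i'(1)] x])
    qed (use ta tb ti tz te tpq in simp_all)
  qed
  then show ?thesis
    unfolding \<eta>(1) using D_acof_of_level[OF pq(3) pq'(3) \<eta>(2)] by blast
qed

end

subsection \<open>Dependent products of diagrams\<close>

text \<open>The composition half of the pasting law; it turns a pullback along \<open>kn\<close>
  into one along \<open>\<gamma> x\<close> when a new stage of the dependent product is
  formed.\<close>

lemma (in category) pullback_paste_cmp:
  assumes K: "is_pullback C g b ka kb" and S: "is_pullback C kb t k st"
  shows "is_pullback C g (b \<cdot> t) (ka \<cdot> k) st"
proof -
  note K' = pullbackD[OF K] and S' = pullbackD[OF S]
  show ?thesis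
  proof (rule pullbackI)
    have "g \<cdot> (ka \<cdot> k) = (b \<cdot> kb) \<cdot> k"
      using K'(9) by (intro cmp_ext) (use K' S' in simp_all)
    also have "\<dots> = (b \<cdot> t) \<cdot> st" using K' S' by simp
    finally show "g \<cdot> (ka \<cdot> k) = (b \<cdot> t) \<cdot> st" .
    fix u v assume u: "u \<in> Ar C" "v \<in> Ar C" "Dom C v = Dom C u" "Cod C u = Dom C g"
      "Cod C v = Dom C (b \<cdot> t)" "g \<cdot> u = (b \<cdot> t) \<cdot> v"
    have "g \<cdot> u = b \<cdot> (t \<cdot> v)" using u K' S' by simp
    then obtain h where h: "h \<in> Ar C" "Dom C h = Dom C u" "Cod C h = Dom C ka" "ka \<cdot> h = u" "kb \<cdot> h = t \<cdot> v"
      using pullback_obtain[OF K u(1), of "t \<cdot> v"] u K' S' by auto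
    obtain l where l: "l \<in> Ar C" "Dom C l = Dom C h" "Cod C l = Dom C k" "k \<cdot> l = h" "st \<cdot> l = v"
      using pullback_obtain[OF S h(1) u(2) _ _ _ h(5)] u h K' S' by auto
    show "\<exists>h. h \<in> Ar C \<and> Dom C h = Dom C u \<and> Cod C h = Dom C (ka \<cdot> k) \<and> (ka \<cdot> k) \<cdot> h = u \<and> st \<cdot> h = v"
      using l h K' S' by (intro exI[of _ l]) simp
  next
    fix h h' assume h: "h \<in> Ar C" "h' \<in> Ar C" "Dom C h = Dom C h'" "Cod C h = Dom C (ka \<cdot> k)"
      "Cod C h' = Dom C (ka \<cdot> k)" "(ka \<cdot> k) \<cdot> h = (ka \<cdot> k) \<cdot> h'" "st \<cdot> h = st \<cdot> h'"
    have h': "Cod C h = Dom C k" "Cod C h' = Dom C k" using h K' S' by simp_all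
    have "kb \<cdot> (k \<cdot> h) = t \<cdot> (st \<cdot> h)" "kb \<cdot> (k \<cdot> h') = t \<cdot> (st \<cdot> h')"
      using S'(9)[THEN cmp_ext, of h] S'(9)[THEN cmp_ext, of h'] h h' K' S' by simp_all
    then have 1: "kb \<cdot> (k \<cdot> h) = kb \<cdot> (k \<cdot> h')" using h(7) by simp
    have "ka \<cdot> (k \<cdot> h) = ka \<cdot> (k \<cdot> h')" using h h' K' S' by simp
    then have "k \<cdot> h = k \<cdot> h'"
      using pullback_unique[OF K, of "k \<cdot> h" "k \<cdot> h'"] 1 h h' K' S' by simp
    then show "h = h'"
      using pullback_unique[OF S, of h h'] h h' K' S' by simp
  qed (use K' S' in simp_all)
qed

context inverse_diagrams
begin

type_synonym ('oo, 'jj, 'aa) pstage = "('oo, 'jj, 'aa, 'aa \<times> 'aa \<times> 'aa) stage"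

text \<open>The extra data of a stage: its pullback along the given fibration, with both projections,
  and the evaluation map defined on it.\<close>

abbreviation v_qa :: "('o, 'j, 'a) pstage \<Rightarrow> 'a" where "v_qa v \<equiv> fst (v_ex v)"
abbreviation v_qr :: "('o, 'j, 'a) pstage \<Rightarrow> 'a" where "v_qr v \<equiv> fst (snd (v_ex v))"
abbreviation v_ev :: "('o, 'j, 'a) pstage \<Rightarrow> 'a" where "v_ev v \<equiv> snd (snd (v_ex v))"

context
  fixes A \<gamma> B E \<epsilon>
  assumes g: "(A, \<gamma>, B) \<in> RF" and e: "(E, \<epsilon>, A) \<in> RF"
begin

text \<open>\<open>w\<close> is the pair of \<open>a\<close> and \<open>r\<close> as a map into the
  pullback carried by \<open>v\<close>. It is stated as a relation, because \<open>v\<close> is an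
  arbitrary tuple until \<open>pdata\<close> is known.\<close>

definition over :: "('o, 'j, 'a) pstage \<Rightarrow> 'a \<Rightarrow> 'a \<Rightarrow> 'a \<Rightarrow> bool" where
  "over v a r w \<longleftrightarrow> w \<in> Ar C \<and> Dom C w = Dom C a \<and> Cod C w = Dom C (v_qa v) \<and> v_qa v \<cdot> w = a \<and> v_qr v \<cdot> w = r"

text \<open>Naturality for a prospective transpose. Here \<open>sa\<close> and \<open>st\<close> are
  the projections of the fibre product of \<open>A\<close> at \<open>x\<close> with the source of
  the cone \<open>\<tau>\<close>; moving \<open>m\<close> along \<open>E\<close> must agree with
  moving the pair down and evaluating there.\<close>

definition compat :: "('i \<Rightarrow> ('o, 'j, 'a) pstage) \<Rightarrow> 'i \<Rightarrow> 'a \<Rightarrow> 'a \<Rightarrow> ('j \<Rightarrow> 'a) \<Rightarrow> 'a \<Rightarrow> bool" where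
  "compat G x sa st \<tau> m \<longleftrightarrow> (\<forall>u \<in> N x. \<forall>w. over (G (Cod K u)) (Far A u \<cdot> sa) (\<tau> u \<cdot> st) w \<longrightarrow>
     Far E u \<cdot> m = v_ev (G (Cod K u)) \<cdot> w)"

text \<open>The counterpart of \<open>Pi_map\<close> at a single object, with the legs to the lower
  values prescribed in addition to the leg to \<open>B\<close>.\<close>

definition pmap :: "'i \<Rightarrow> ('o, 'j, 'a) pstage \<Rightarrow> 'o \<Rightarrow> 'a \<Rightarrow> ('j \<Rightarrow> 'a) \<Rightarrow> 'a \<Rightarrow> 'a \<Rightarrow> 'a \<Rightarrow> 'a \<Rightarrow> bool" where
  "pmap x v T b \<tau> sa st m h \<longleftrightarrow> h \<in> Ar C \<and> Dom C h = T \<and> Cod C h = v_ob v \<and> v_tr v \<cdot> h = b \<and>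
     (\<forall>u \<in> N x. v_ar v u \<cdot> h = \<tau> u) \<and> (\<forall>w. over v sa (h \<cdot> st) w \<longrightarrow> v_ev v \<cdot> w = m)"

text \<open>Applied to the projections of the stage itself, \<open>compat\<close> says that the
  evaluation maps will form a transformation of diagrams.\<close>

definition pdata :: "('i \<Rightarrow> ('o, 'j, 'a) pstage) \<Rightarrow> 'i \<Rightarrow> ('o, 'j, 'a) pstage \<Rightarrow> bool" where
  "pdata G x v \<longleftrightarrow> is_pullback C (\<gamma> x) (v_tr v) (v_qa v) (v_qr v) \<and>
     v_ev v \<in> Ar C \<and> Dom C (v_ev v) = Dom C (v_qa v) \<and> Cod C (v_ev v) = Fob E x \<and> \<epsilon> x \<cdot> v_ev v = v_qa v \<and>
     compat G x (v_qa v) (v_qr v) (v_ar v) (v_ev v)"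

text \<open>The universal property of the value at \<^term>\<open>x\<close> against all cones over the values below \<^term>\<open>x\<close>:
  it mentions nothing above \<^term>\<open>x\<close>, so it can be part of the recursion.\<close>

definition puniv :: "('i \<Rightarrow> ('o, 'j, 'a) pstage) \<Rightarrow> 'i \<Rightarrow> ('o, 'j, 'a) pstage \<Rightarrow> bool" where
  "puniv G x v \<longleftrightarrow> (\<forall>T b \<tau> sa st m. rcone C K (dia G) (tra G) B x T b \<tau> \<longrightarrow> is_pullback C (\<gamma> x) b sa st \<longrightarrow>
     m \<in> Ar C \<longrightarrow> Dom C m = Dom C sa \<longrightarrow> Cod C m = Fob E x \<longrightarrow> \<epsilon> x \<cdot> m = sa \<longrightarrow> compat G x sa st \<tau> m \<longrightarrow>
     (\<exists>!h. pmap x v T b \<tau> sa st m h))"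

definition pstep :: "('i \<Rightarrow> ('o, 'j, 'a) pstage) \<Rightarrow> 'i \<Rightarrow> ('o, 'j, 'a) pstage \<Rightarrow> bool" where
  "pstep G x v \<longleftrightarrow> fstep B G x v \<and> pdata G x v \<and> puniv G x v"

lemma overD:
  assumes "over v a r w"
  shows "w \<in> Ar C" "Dom C w = Dom C a" "Cod C w = Dom C (v_qa v)" "v_qa v \<cdot> w = a" "v_qr v \<cdot> w = r"
  using assms unfolding over_def by simp_all

lemma over_unique:
  assumes "is_pullback C (\<gamma> x) t (v_qa v) (v_qr v)" "over v a r w" "over v a r w'"
  shows "w = w'"
  by (rule pullback_unique[OF assms(1)]) (use overD[OF assms(2)] overD[OF assms(3)] in simp_all)

lemma pdataD:
  assumes "pdata G x v"
  shows "is_pullback C (\<gamma> x) (v_tr v) (v_qa v) (v_qr v)"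
     "v_ev v \<in> Ar C" "Dom C (v_ev v) = Dom C (v_qa v)" "Cod C (v_ev v) = Fob E x" "\<epsilon> x \<cdot> v_ev v = v_qa v"
     "compat G x (v_qa v) (v_qr v) (v_ar v) (v_ev v)"
  using assms unfolding pdata_def by simp_all

lemma pstep_cong:
  assumes "\<forall>u \<in> N x. G (Cod K u) = G' (Cod K u)"
  shows "pstep G x v = pstep G' x v"
proof -
  have c: "compat G x = compat G' x"
    unfolding compat_def using assms by (intro ext) (auto cong: ball_cong)
  show ?thesis
    unfolding pstep_def pdata_def puniv_def c fstep_cong[OF assms] rstep_below_cong(2)[OF dia_cong[OF assms]] ..
qed

lemmas RA = ROD[OF RFD(1)[OF g]] and RB = ROD[OF RFD(2)[OF g]] and RE = ROD[OF RFD(1)[OF e]]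
lemmas fA = functor_simps[OF RA(1)] and fB = functor_simps[OF RB(1)] and fE = functor_simps[OF RE(1)]
lemmas tg = RTD[OF RFD(3)[OF g]] and te = RTD[OF RFD(3)[OF e]]

context
  fixes G x
  assumes x: "x \<in> Ob K" and G: "\<And>u. u \<in> N x \<Longrightarrow> pstep G (Cod K u) (G (Cod K u))"
begin

lemma f_below: "u \<in> N x \<Longrightarrow> fstep B G (Cod K u) (G (Cod K u))"
  and d_below: "u \<in> N x \<Longrightarrow> pdata G (Cod K u) (G (Cod K u))"
  using G unfolding pstep_def by blast+

lemma below:
  "good_below (dia G) x" "fibrant_below (dia G) x" "nat_below (dia G) (tra G) B x"
  using fstep_below[OF RFD(2)[OF g] x f_below] by blast+

lemma stage_typed:
  assumes "u \<in> N x"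
  shows "v_tr (G (Cod K u)) \<in> Ar C" "Dom C (v_tr (G (Cod K u))) = v_ob (G (Cod K u))"
    "Cod C (v_tr (G (Cod K u))) = Fob B (Cod K u)"
  using f_below[OF assms] unfolding fstep_def by simp_all

lemma over_exists:
  assumes c: "rcone C K (dia G) (tra G) B x T b \<tau>" and S: "is_pullback C (\<gamma> x) b sa st" and u: "u \<in> N x"
  obtains w where "over (G (Cod K u)) (Far A u \<cdot> sa) (\<tau> u \<cdot> st) w"
proof -
  note u' = nonidD[OF u] and y = nonid_Cod[OF u] and S' = pullbackD[OF S] and R = rconeD[OF c] and T = rcone_below_typed[OF c u]
  note Q = pdataD[OF d_below[OF u]] and st = stage_typed[OF u]
  note Q' = pullbackD[OF Q(1)]
  have T': "Cod C (\<tau> u) = v_ob (G (Cod K u))" using T y by (simp add: dia_simps)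
  have "\<gamma> (Cod K u) \<cdot> (Far A u \<cdot> sa) = (Far B u \<cdot> \<gamma> x) \<cdot> sa"
    using tg(4)[OF u'(1)] u' by (intro cmp_ext) (use u' y x tg(1-3) fA S' in simp_all)
  also have "\<dots> = Far B u \<cdot> (b \<cdot> st)" using u' x tg(1-3) fB S' by simp
  also have "\<dots> = (v_tr (G (Cod K u)) \<cdot> \<tau> u) \<cdot> st"
    using R(5)[OF u] y by (intro cmp_ext) (use u' x fB S' R(2-4) in \<open>simp_all add: dia_simps\<close>)
  also have "\<dots> = v_tr (G (Cod K u)) \<cdot> (\<tau> u \<cdot> st)" using T T' st S' R(2-4) by simp
  finally have eq: "\<gamma> (Cod K u) \<cdot> (Far A u \<cdot> sa) = v_tr (G (Cod K u)) \<cdot> (\<tau> u \<cdot> st)" .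
  obtain w where "w \<in> Ar C" "Dom C w = Dom C (Far A u \<cdot> sa)" "Cod C w = Dom C (v_qa (G (Cod K u)))"
      "v_qa (G (Cod K u)) \<cdot> w = Far A u \<cdot> sa" "v_qr (G (Cod K u)) \<cdot> w = \<tau> u \<cdot> st"
    by (rule pullback_obtain[OF Q(1) _ _ _ _ _ eq]) (use u' y x fA S' T T' st R(2-4) tg(1-3) in simp_all)
  then show thesis using that unfolding over_def by blast
qed

text \<open>Evaluating the lower components of a cone gives a compatible family in \<open>E\<close>.
  For \<open>T\<close> the relative matching object over \<open>B\<close>, this is the map along
  which \<open>E\<close> at \<open>x\<close> is pulled back to form the new value.\<close>

lemma ev_rcone:
  assumes c: "rcone C K (dia G) (tra G) B x T b \<tau>" and S: "is_pullback C (\<gamma> x) b sa st"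
  obtains \<kappa> where "rcone C K E \<epsilon> A x (Dom C sa) sa \<kappa>"
    "\<And>u w. u \<in> N x \<Longrightarrow> over (G (Cod K u)) (Far A u \<cdot> sa) (\<tau> u \<cdot> st) w \<Longrightarrow> \<kappa> u = v_ev (G (Cod K u)) \<cdot> w"
proof -
  note S' = pullbackD[OF S] and R = rconeD[OF c]
  have "\<forall>u. \<exists>w. u \<in> N x \<longrightarrow> over (G (Cod K u)) (Far A u \<cdot> sa) (\<tau> u \<cdot> st) w"
    using over_exists[OF c S] by blast
  then obtain \<theta> where \<theta>: "\<And>u. u \<in> N x \<Longrightarrow> over (G (Cod K u)) (Far A u \<cdot> sa) (\<tau> u \<cdot> st) (\<theta> u)" by metis
  have dom: "Dom C (Far A u \<cdot> sa) = Dom C sa" if "u \<in> N x" for u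
    using nonidD[OF that] fA S' tg(1-3) x by simp
  define \<kappa> where "\<kappa> u = v_ev (G (Cod K u)) \<cdot> \<theta> u" for u
  have "mcone C K E x (Dom C sa) \<kappa>"
    unfolding mcone_def \<kappa>_def
  proof (intro conjI ballI impI)
    fix u assume u: "u \<in> N x"
    note u' = nonidD[OF u] and y = nonid_Cod[OF u] and Q = pdataD[OF d_below[OF u]] and o = overD[OF \<theta>[OF u]]
    note Q' = pullbackD[OF Q(1)] and sy = stage_typed[OF u]
    show "v_ev (G (Cod K u)) \<cdot> \<theta> u \<in> Ar C" "Dom C (v_ev (G (Cod K u)) \<cdot> \<theta> u) = Dom C sa"
      "Cod C (v_ev (G (Cod K u)) \<cdot> \<theta> u) = Fob E (Cod K u)"
      using Q o dom[OF u] by simp_all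
    fix k assume k: "k \<in> Ar K" "Dom K k = Cod K u"
    let ?y = "Cod K u" and ?z = "Cod K (k \<cdot>\<^bsub>K\<^esub> u)"
    show "Far E k \<cdot> (v_ev (G ?y) \<cdot> \<theta> u) = v_ev (G ?z) \<cdot> \<theta> (k \<cdot>\<^bsub>K\<^esub> u)"
    \<comment> \<open>\<open>compat\<close> covers nonidentity arrows only, so the identity is
      treated separately.\<close>
    proof (cases "k = Ide K ?y")
      case True
      then show ?thesis using u' y k fE Q o by simp
    next
      case False
      then have kN: "k \<in> N ?y" using k by (simp add: nonid_def)
      have ku: "k \<cdot>\<^bsub>K\<^esub> u \<in> N x" by (rule nonid_cmp[OF u k])
      have z: "?z = Cod K k" using u' k by simp
      note Qz = pdataD[OF d_below[OF ku], unfolded z] and oz = overD[OF \<theta>[OF ku], unfolded z] and sz = stage_typed[OF ku, unfolded z]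
      note Qz' = pullbackD[OF Qz(1)]
      note Tu = rcone_below_typed[OF c u] and Tz = rcone_below_typed[OF c ku, unfolded z]
      have zO: "Cod K k \<in> Ob K" using k by simp
      have Pk: "Far (dia G) k \<in> Ar C" "Dom C (Far (dia G) k) = v_ob (G ?y)" "Cod C (Far (dia G) k) = v_ob (G (Cod K k))"
        "tra G (Cod K k) \<cdot> Far (dia G) k = Far B k \<cdot> tra G ?y"
        using good_belowD(2-4)[OF below(1) u k] natD(4)[OF below(3)[rule_format, OF u] k] y zO by (simp_all add: dia_simps)
      have kv: "Far (dia G) k = v_ar (G ?y) k" using k by (simp add: dia_simps)
      have eq: "\<gamma> (Cod K k) \<cdot> (Far A k \<cdot> v_qa (G ?y)) = v_tr (G (Cod K k)) \<cdot> (Far (dia G) k \<cdot> v_qr (G ?y))"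
      proof -
        have "\<gamma> (Cod K k) \<cdot> (Far A k \<cdot> v_qa (G ?y)) = (Far B k \<cdot> \<gamma> ?y) \<cdot> v_qa (G ?y)"
          using tg(4)[OF k(1)] k by (intro cmp_ext) (use k y zO tg(1-3) fA Q' in simp_all)
        also have "\<dots> = Far B k \<cdot> (v_tr (G ?y) \<cdot> v_qr (G ?y))"
          using k y tg(1-3) fB Q' by simp
        also have "\<dots> = (v_tr (G (Cod K k)) \<cdot> Far (dia G) k) \<cdot> v_qr (G ?y)"
          using Pk(4) y zO by (intro assoc[symmetric, THEN trans]) (use k y Q' sy fB in \<open>simp_all add: dia_simps\<close>)
        also have "\<dots> = v_tr (G (Cod K k)) \<cdot> (Far (dia G) k \<cdot> v_qr (G ?y))"
          using Pk sz sy Q' by simp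
        finally show ?thesis .
      qed
      \<comment> \<open>\<open>w\<close> is the action of \<open>k\<close> on the stored pullbacks.
        Evaluation commutes with it by \<open>compat\<close> at \<open>?y\<close>, and uniqueness
        shows that it carries \<open>\<theta> u\<close> to the pair at the composite.\<close>
      obtain w where w: "over (G (Cod K k)) (Far A k \<cdot> v_qa (G ?y)) (Far (dia G) k \<cdot> v_qr (G ?y)) w"
        by (rule pullback_obtain[OF Qz(1) _ _ _ _ _ eq, of thesis])
          (use k y zO tg(1-3) fA Q' Pk sy sz in \<open>simp_all add: over_def\<close>)
      note ow = overD[OF w]
      have dw: "Dom C w = Dom C (v_qa (G ?y))" using ow(2) k y tg(1-3) fA Q' by simp
      have 1: "Far E k \<cdot> v_ev (G ?y) = v_ev (G (Cod K k)) \<cdot> w"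
        using Q(6) kN w unfolding compat_def kv by blast
      have 2: "w \<cdot> \<theta> u = \<theta> (k \<cdot>\<^bsub>K\<^esub> u)"
      proof (rule pullback_unique[OF Qz(1)])
        have "v_qa (G (Cod K k)) \<cdot> (w \<cdot> \<theta> u) = (Far A k \<cdot> v_qa (G ?y)) \<cdot> \<theta> u"
          using ow(4) by (intro cmp_ext) (use ow dw o Qz' in simp_all)
        also have "\<dots> = Far A k \<cdot> (Far A u \<cdot> sa)"
          using o k y tg(1-3) fA Q' by simp
        also have "\<dots> = v_qa (G (Cod K k)) \<cdot> \<theta> (k \<cdot>\<^bsub>K\<^esub> u)"
          using oz(4) u' k fA S' tg(1-3) x by simp
        finally show "v_qa (G (Cod K k)) \<cdot> (w \<cdot> \<theta> u) = v_qa (G (Cod K k)) \<cdot> \<theta> (k \<cdot>\<^bsub>K\<^esub> u)" .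
        have "v_qr (G (Cod K k)) \<cdot> (w \<cdot> \<theta> u) = (Far (dia G) k \<cdot> v_qr (G ?y)) \<cdot> \<theta> u"
          using ow(5) by (intro cmp_ext) (use ow dw o Qz' in simp_all)
        also have "\<dots> = Far (dia G) k \<cdot> (\<tau> u \<cdot> st)"
          using o Pk Q' sy by simp
        also have "\<dots> = \<tau> (k \<cdot>\<^bsub>K\<^esub> u) \<cdot> st"
          using mconeD'[OF R(1) u k] by (intro cmp_ext) (use Pk Tu y S' R(2-4) in \<open>simp_all add: dia_simps\<close>)
        also have "\<dots> = v_qr (G (Cod K k)) \<cdot> \<theta> (k \<cdot>\<^bsub>K\<^esub> u)" using oz(5) by simp
        finally show "v_qr (G (Cod K k)) \<cdot> (w \<cdot> \<theta> u) = v_qr (G (Cod K k)) \<cdot> \<theta> (k \<cdot>\<^bsub>K\<^esub> u)" .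
      qed (use ow dw o oz in simp_all)
      have "Far E k \<cdot> (v_ev (G ?y) \<cdot> \<theta> u) = (v_ev (G (Cod K k)) \<cdot> w) \<cdot> \<theta> u"
        using 1 by (intro cmp_ext) (use k y fE Q o in simp_all)
      also have "\<dots> = v_ev (G (Cod K k)) \<cdot> \<theta> (k \<cdot>\<^bsub>K\<^esub> u)"
        using 2 Qz ow dw o by simp
      finally show ?thesis using z by simp
    qed
  qed (use S' in simp)
  then have "rcone C K E \<epsilon> A x (Dom C sa) sa \<kappa>"
    unfolding rcone_def
  proof (intro conjI ballI)
    fix u assume u: "u \<in> N x"
    note u' = nonidD[OF u] and y = nonid_Cod[OF u] and Q = pdataD[OF d_below[OF u]] and o = overD[OF \<theta>[OF u]]
    have "\<epsilon> (Cod K u) \<cdot> \<kappa> u = v_qa (G (Cod K u)) \<cdot> \<theta> u"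
      unfolding \<kappa>_def using Q(5) by (intro cmp_ext) (use Q o y te(1-3) in simp_all)
    then show "Far A u \<cdot> sa = \<epsilon> (Cod K u) \<cdot> \<kappa> u" using o by simp
  qed (use S' tg(2) x in simp_all)
  moreover have "\<kappa> u = v_ev (G (Cod K u)) \<cdot> w" if u: "u \<in> N x" and "over (G (Cod K u)) (Far A u \<cdot> sa) (\<tau> u \<cdot> st) w" for u w
    unfolding \<kappa>_def using over_unique[OF pdataD(1)[OF d_below[OF u]] that(2) \<theta>[OF u]] by simp
  ultimately show thesis using that by blast
qed

text \<open>Below, \<^term>\<open>L\<close> is the relative matching object of the diagram under construction over \<^term>\<open>B\<close>,
  \<^term>\<open>ka\<close> and \<^term>\<open>kn\<close> are the projections of \<open>A\<^sub>x \<times>\<^bsub>B\<^sub>x\<^esub> L\<close>, \<^term>\<open>M\<close> is the relative matching object of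
  \<^term>\<open>E\<close> over \<^term>\<open>A\<close>, and the new value is the dependent product along \<^term>\<open>kn\<close> of the pullback
  \<^term>\<open>r1\<close> of \<open>E\<^sub>x \<rightarrow> M\<close>.\<close>

lemma pstep_exists: "\<exists>v. pstep G x v"
proof -
  have \<gamma>F: "\<gamma> x \<in> F" by (rule RF_level[OF g x])
  obtain L b n where L: "rlim C K (dia G) (tra G) B x L b n"
    using rlim_exists[OF x below(1,2) RB(4,5) RB(2,3)[OF x] below(3)] .
  note R = rconeD[OF rlim_cone[OF L]] and T = rcone_below_typed[OF rlim_cone[OF L]]
  have "has_pullback C (\<gamma> x) b" using fib_has_pullback(2)[OF \<gamma>F] R(2-4) tg(3) x by simp
  then obtain ka kn where Kp: "is_pullback C (\<gamma> x) b ka kn" unfolding has_pullback_def by blast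
  note K' = pullbackD[OF Kp]
  have knF: "kn \<in> F" by (rule fib_pullback_sym[OF \<gamma>F Kp])
  obtain \<kappa> where \<kappa>: "rcone C K E \<epsilon> A x (Dom C ka) ka \<kappa>"
    "\<And>u w. u \<in> N x \<Longrightarrow> over (G (Cod K u)) (Far A u \<cdot> ka) (n u \<cdot> kn) w \<Longrightarrow> \<kappa> u = v_ev (G (Cod K u)) \<cdot> w"
    using ev_rcone[OF rlim_cone[OF L] Kp] by blast
  obtain M l \<rho> me where me: "rlim C K E \<epsilon> A x M l \<rho>" "me \<in> F" "Dom C me = Fob E x" "Cod C me = M"
      "l \<cdot> me = \<epsilon> x" "\<forall>u \<in> N x. \<rho> u \<cdot> me = Far E u" using RFD(4)[OF e x] unfolding rstep_def by blast
  have me': "me \<in> Ar C" using me by simp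
  note Rl = rconeD[OF rlim_cone[OF me(1)]] and Tl = rcone_below_typed[OF rlim_cone[OF me(1)]]
  \<comment> \<open>\<open>c\<close> records what the evaluation maps below already force in
    \<open>M\<close>. Informally, an element of the source of \<open>r1\<close> is an element of the
    source of \<open>ka\<close> together with an element of \<open>E\<close> at \<open>x\<close>
    having these forced values.\<close>
  obtain c where c: "c \<in> Ar C" "Dom C c = Dom C ka" "Cod C c = M" "l \<cdot> c = ka" "\<And>u. u \<in> N x \<Longrightarrow> \<rho> u \<cdot> c = \<kappa> u"
    using rlim_obtain[OF me(1) \<kappa>(1)] by blast
  have "has_pullback C c me" using fib_has_pullback(1)[OF me(2)] c me by simp
  then obtain r1 r2 where Rp: "is_pullback C c me r1 r2" unfolding has_pullback_def by blast
  note R' = pullbackD[OF Rp]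
  have r1F: "r1 \<in> F" by (rule fib_pullback[OF me(2) Rp])
  obtain r ca cr ev0 where r: "r \<in> F" "Cod C r = Cod C kn" and Pi: "is_Pi C kn r1 r ca cr ev0"
    by (rule Pi_obtain[OF knF r1F]) (use R' c K' in simp_all)
  note P = is_PiD[OF Pi]
  note P' = pullbackD[OF P(1)]
  have rL: "Cod C r = L" using r K' R by simp
  note ty = R(2-4) K'(1-8) c(1-3) R'(1-8) P(2-4) P'(1-8) me(3,4) me' rL
  let ?a = "\<lambda>u. if u = Ide K x then Ide C (Dom C r) else n u \<cdot> r"
  \<comment> \<open>The pullback of \<open>\<gamma> x\<close> along \<open>b \<cdot> r\<close> is
    pasted from \<open>Kp\<close> and the pullback carried by the dependent product in
    \<open>C\<close>. Evaluation keeps the component of \<open>ev0\<close> in \<open>E\<close>; the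
    other component is \<open>ca\<close>.\<close>
  define v where "v = (Dom C r, ?a, b \<cdot> r, ka \<cdot> ca, cr, r2 \<cdot> ev0)"
  have v: "v_ob v = Dom C r" "v_tr v = b \<cdot> r" "v_qa v = ka \<cdot> ca" "v_qr v = cr" "v_ev v = r2 \<cdot> ev0"
    by (simp_all add: v_def)
  have va: "v_ar v u = n u \<cdot> r" if "u \<in> N x" for u using that by (simp add: v_def nonid_def)
  have Q: "is_pullback C (\<gamma> x) (v_tr v) (v_qa v) (v_qr v)"
    unfolding v by (rule pullback_paste_cmp[OF Kp P(1)])
  have dca: "Dom C (ka \<cdot> ca) = Dom C ca" using ty by simp
  have ev\<epsilon>: "\<epsilon> x \<cdot> (r2 \<cdot> ev0) = ka \<cdot> ca"
  proof -
    have "\<epsilon> x \<cdot> (r2 \<cdot> ev0) = l \<cdot> (me \<cdot> (r2 \<cdot> ev0))"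
      using me(5) by (intro cmp_ext[symmetric]) (use ty Rl in simp_all)
    also have "\<dots> = l \<cdot> ((c \<cdot> r1) \<cdot> ev0)" using ty R'(9) by simp
    also have "\<dots> = l \<cdot> (c \<cdot> ca)" using ty P(5) by simp
    also have "\<dots> = ka \<cdot> ca" using c(4) by (intro cmp_ext) (use ty Rl in simp_all)
    finally show ?thesis .
  qed
  have "compat G x (v_qa v) (v_qr v) (v_ar v) (v_ev v)"
    unfolding compat_def
  proof (intro ballI allI impI)
    fix u w assume u: "u \<in> N x" and w: "over (G (Cod K u)) (Far A u \<cdot> v_qa v) (v_ar v u \<cdot> v_qr v) w"
    note u' = nonidD[OF u] and y = nonid_Cod[OF u] and Qy = pdataD[OF d_below[OF u]]
    obtain \<theta> where \<theta>: "over (G (Cod K u)) (Far A u \<cdot> ka) (n u \<cdot> kn) \<theta>"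
      using over_exists[OF rlim_cone[OF L] Kp u] .
    note o = overD[OF \<theta>] and Qy' = pullbackD[OF Qy(1)]
    have D\<theta>: "Dom C \<theta> = Dom C ka" using o(2) u' x fA ty tg(2) by simp
    \<comment> \<open>The pair at the new value is the pair \<open>\<theta>\<close> for
      \<open>L\<close> after \<open>ca\<close>, which reduces compatibility to the defining property
      of \<open>c\<close>.\<close>
    have "over (G (Cod K u)) (Far A u \<cdot> v_qa v) (v_ar v u \<cdot> v_qr v) (\<theta> \<cdot> ca)"
      unfolding over_def va[OF u] v
    proof (intro conjI)
      have "v_qa (G (Cod K u)) \<cdot> (\<theta> \<cdot> ca) = (Far A u \<cdot> ka) \<cdot> ca"
        using o(4) by (intro cmp_ext) (use o D\<theta> ty Qy' in simp_all)
      then show "v_qa (G (Cod K u)) \<cdot> (\<theta> \<cdot> ca) = Far A u \<cdot> (ka \<cdot> ca)" using u' x fA ty tg(2) by simp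
      have "v_qr (G (Cod K u)) \<cdot> (\<theta> \<cdot> ca) = (n u \<cdot> kn) \<cdot> ca"
        using o(5) by (intro cmp_ext) (use o D\<theta> ty Qy' in simp_all)
      also have "\<dots> = n u \<cdot> (kn \<cdot> ca)" using T[OF u] ty by simp
      also have "\<dots> = n u \<cdot> (r \<cdot> cr)" using P'(9) by simp
      also have "\<dots> = (n u \<cdot> r) \<cdot> cr" using T[OF u] ty by simp
      finally show "v_qr (G (Cod K u)) \<cdot> (\<theta> \<cdot> ca) = (n u \<cdot> r) \<cdot> cr" .
    qed (use o D\<theta> ty u' x fA tg(2) in simp_all)
    then have w': "w = \<theta> \<cdot> ca" using over_unique[OF Qy(1) w] by blast
    have "Far E u \<cdot> (r2 \<cdot> ev0) = \<rho> u \<cdot> (me \<cdot> (r2 \<cdot> ev0))"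
      using me(6) u by (intro cmp_ext[symmetric]) (use ty Tl[OF u] in simp_all)
    also have "\<dots> = \<rho> u \<cdot> ((c \<cdot> r1) \<cdot> ev0)" using ty R'(9) by simp
    also have "\<dots> = \<rho> u \<cdot> (c \<cdot> ca)" using ty P(5) by simp
    also have "\<dots> = \<kappa> u \<cdot> ca" using c(5)[OF u] by (intro cmp_ext) (use ty Tl[OF u] in simp_all)
    also have "\<dots> = v_ev (G (Cod K u)) \<cdot> (\<theta> \<cdot> ca)"
      using \<kappa>(2)[OF u \<theta>] Qy(2-4) o D\<theta> ty by simp
    finally show "Far E u \<cdot> v_ev v = v_ev (G (Cod K u)) \<cdot> w" unfolding v w' .
  qed
  with Q have d: "pdata G x v"
    unfolding pdata_def using ev\<epsilon> ty dca unfolding v by simp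
  have f: "fstep B G x v"
    unfolding v_def by (rule fstep_of_fib[OF RFD(2)[OF g] x f_below L r(1) rL])
  have "puniv G x v"
    unfolding puniv_def
  proof (intro allI impI)
    fix T b' \<tau> sa st m
    assume cT: "rcone C K (dia G) (tra G) B x T b' \<tau>" and S: "is_pullback C (\<gamma> x) b' sa st"
      and m: "m \<in> Ar C" "Dom C m = Dom C sa" "Cod C m = Fob E x" "\<epsilon> x \<cdot> m = sa" and cm: "compat G x sa st \<tau> m"
    note RT = rconeD[OF cT] and S' = pullbackD[OF S]
    obtain t where t: "t \<in> Ar C" "Dom C t = T" "Cod C t = L" "b \<cdot> t = b'" "\<And>u. u \<in> N x \<Longrightarrow> n u \<cdot> t = \<tau> u"
      using rlim_obtain[OF L cT] by blast
    note ty2 = t(1-3) S'(1-8) m(1-3) RT(2-4)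
    have S2: "is_pullback C (\<gamma> x) (b \<cdot> t) sa st" using S t(4) by simp
    have "\<gamma> x \<cdot> sa = b \<cdot> (t \<cdot> st)" using pullbackD(9)[OF S2] ty ty2 by simp
    then obtain k where k: "k \<in> Ar C" "Dom C k = Dom C sa" "Cod C k = Dom C ka" "ka \<cdot> k = sa" "kn \<cdot> k = t \<cdot> st"
      using pullback_obtain[OF Kp, of sa "t \<cdot> st"] ty ty2 by auto
    \<comment> \<open>The given pullback over \<open>b'\<close> is also the pullback of
      \<open>kn\<close> along \<open>t\<close>, so the universal property of the dependent product
      in \<open>C\<close> applies to \<open>t\<close>.\<close>
    have S3: "is_pullback C kn t k st"
      by (rule pullback_paste[OF Kp S2]) (use k ty ty2 in simp_all)
    \<comment> \<open>The compatibility hypothesis enters here: it says that \<open>m\<close> has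
      the values forced by \<open>c\<close>, so that \<open>m\<close> and \<open>k\<close> combine
      to a map \<open>m'\<close> into the source of \<open>r1\<close>.\<close>
    have ckm: "c \<cdot> k = me \<cdot> m"
    proof (rule rlim_unique[OF me(1) RE(4) RA(2)[OF x] natural_transD(4)[OF RFD(3)[OF e]]])
      have "l \<cdot> (c \<cdot> k) = ka \<cdot> k" using c(4) by (intro cmp_ext) (use ty ty2 k Rl in simp_all)
      also have "\<dots> = \<epsilon> x \<cdot> m" using k m by simp
      also have "\<dots> = l \<cdot> (me \<cdot> m)" using me(5) by (intro cmp_ext[symmetric]) (use ty ty2 Rl in simp_all)
      finally show "l \<cdot> (c \<cdot> k) = l \<cdot> (me \<cdot> m)" .
      fix u assume u: "u \<in> N x"
      note u' = nonidD[OF u] and y = nonid_Cod[OF u] and Qy = pdataD[OF d_below[OF u]]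
      obtain \<theta> where \<theta>: "over (G (Cod K u)) (Far A u \<cdot> ka) (n u \<cdot> kn) \<theta>"
        using over_exists[OF rlim_cone[OF L] Kp u] .
      note o = overD[OF \<theta>] and Qy' = pullbackD[OF Qy(1)]
      have D\<theta>: "Dom C \<theta> = Dom C ka" using o(2) u' x fA ty tg(2) by simp
      have "over (G (Cod K u)) (Far A u \<cdot> sa) (\<tau> u \<cdot> st) (\<theta> \<cdot> k)"
        unfolding over_def
      proof (intro conjI)
        have "v_qa (G (Cod K u)) \<cdot> (\<theta> \<cdot> k) = (Far A u \<cdot> ka) \<cdot> k"
          using o(4) by (intro cmp_ext) (use o D\<theta> ty k Qy' in simp_all)
        then show "v_qa (G (Cod K u)) \<cdot> (\<theta> \<cdot> k) = Far A u \<cdot> sa" using u' x fA ty k tg(2) by simp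
        have "v_qr (G (Cod K u)) \<cdot> (\<theta> \<cdot> k) = (n u \<cdot> kn) \<cdot> k"
          using o(5) by (intro cmp_ext) (use o D\<theta> ty k Qy' in simp_all)
        also have "\<dots> = n u \<cdot> (t \<cdot> st)" using ty2 T[OF u] ty k by simp
        also have "\<dots> = \<tau> u \<cdot> st" using t(5)[OF u] by (intro cmp_ext) (use ty2 T[OF u] ty in simp_all)
        finally show "v_qr (G (Cod K u)) \<cdot> (\<theta> \<cdot> k) = \<tau> u \<cdot> st" .
      qed (use o D\<theta> ty ty2 k u' x fA tg(2) in simp_all)
      then have Eu: "Far E u \<cdot> m = v_ev (G (Cod K u)) \<cdot> (\<theta> \<cdot> k)" using cm u unfolding compat_def by blast
      have "\<rho> u \<cdot> (c \<cdot> k) = \<kappa> u \<cdot> k" using c(5)[OF u] by (intro cmp_ext) (use ty k Tl[OF u] in simp_all)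
      also have "\<dots> = v_ev (G (Cod K u)) \<cdot> (\<theta> \<cdot> k)"
        using \<kappa>(2)[OF u \<theta>] Qy(2-4) o D\<theta> ty k by simp
      also have "\<dots> = \<rho> u \<cdot> (me \<cdot> m)"
        unfolding Eu[symmetric] using me(6) u by (intro cmp_ext[symmetric]) (use ty ty2 Tl[OF u] in simp_all)
      finally show "\<rho> u \<cdot> (c \<cdot> k) = \<rho> u \<cdot> (me \<cdot> m)" .
    qed (use ty ty2 k in simp_all)
    then obtain m' where m': "m' \<in> Ar C" "Dom C m' = Dom C k" "Cod C m' = Dom C r1" "r1 \<cdot> m' = k" "r2 \<cdot> m' = m"
      using pullback_obtain[OF Rp, of k m] ty ty2 k by auto
    have ex: "\<exists>!h. Pi_map C r ca cr ev0 t k st m' h"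
      by (rule P(6)[OF S3 m'(1-4)])
    \<comment> \<open>Having the prescribed legs is the same as lying over \<open>t\<close>, by
      uniqueness for \<open>L\<close>. Evaluating to \<open>m\<close> is the same as evaluating to
      \<open>m'\<close>, because \<open>r1\<close> and \<open>r2\<close> are jointly monic and the
      component under \<open>r1\<close> is fixed.\<close>
    have "pmap x v T b' \<tau> sa st m h \<longleftrightarrow> Pi_map C r ca cr ev0 t k st m' h" for h
    proof (cases "h \<in> Ar C \<and> Dom C h = T \<and> Cod C h = Dom C r")
      case False
      then show ?thesis unfolding pmap_def Pi_map_def v using ty2 by auto
    next
      case True
      then have h: "h \<in> Ar C" "Dom C h = T" "Cod C h = Dom C r" by auto
      have rh: "(b \<cdot> r) \<cdot> h = b' \<and> (\<forall>u\<in>N x. v_ar v u \<cdot> h = \<tau> u) \<longleftrightarrow> r \<cdot> h = t"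
      proof
        assume "r \<cdot> h = t"
        then show "(b \<cdot> r) \<cdot> h = b' \<and> (\<forall>u\<in>N x. v_ar v u \<cdot> h = \<tau> u)"
          using va T ty h t by simp
      next
        assume bh: "(b \<cdot> r) \<cdot> h = b' \<and> (\<forall>u\<in>N x. v_ar v u \<cdot> h = \<tau> u)"
        show "r \<cdot> h = t"
          by (rule rlim_unique[OF L below(1) RB(2)[OF x] below(3)]) (use bh va T ty h t in simp_all)
      qed
      have "(\<forall>w. over v sa (h \<cdot> st) w \<longrightarrow> v_ev v \<cdot> w = m) \<longleftrightarrow>
         (\<forall>w\<in>Ar C. Dom C w = Dom C k \<and> Cod C w = Dom C ca \<and> ca \<cdot> w = k \<and> cr \<cdot> w = h \<cdot> st \<longrightarrow> ev0 \<cdot> w = m')"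
        (is "?X \<longleftrightarrow> ?Y") if rht: "r \<cdot> h = t"
      proof -
        have "kn \<cdot> k = r \<cdot> (h \<cdot> st)" using k(5) rht[THEN cmp_ext, of st] h ty ty2 by simp
        then obtain w0 where w0: "w0 \<in> Ar C" "Dom C w0 = Dom C k" "Cod C w0 = Dom C ca" "ca \<cdot> w0 = k" "cr \<cdot> w0 = h \<cdot> st"
          using pullback_obtain[OF P(1), of k "h \<cdot> st"] h ty ty2 k by auto
        have o0: "over v sa (h \<cdot> st) w0"
          unfolding over_def v using w0 ty ty2 k by simp
        have X: "?X \<longleftrightarrow> (r2 \<cdot> ev0) \<cdot> w0 = m"
          using over_unique[OF Q o0] o0 unfolding v by blast
        have "w = w0" if "w\<in>Ar C" "Dom C w = Dom C k \<and> Cod C w = Dom C ca \<and> ca \<cdot> w = k \<and> cr \<cdot> w = h \<cdot> st" for w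
          by (rule pullback_unique[OF P(1)]) (use that w0 in simp_all)
        then have Y: "?Y \<longleftrightarrow> ev0 \<cdot> w0 = m'" using w0 by blast
        have "r1 \<cdot> (ev0 \<cdot> w0) = ca \<cdot> w0" using P(5) by (intro cmp_ext) (use ty w0 in simp_all)
        then have 1: "r1 \<cdot> (ev0 \<cdot> w0) = r1 \<cdot> m'" using w0 m' by simp
        have "r2 \<cdot> (ev0 \<cdot> w0) = m \<longleftrightarrow> ev0 \<cdot> w0 = m'"
        proof
          assume 2: "r2 \<cdot> (ev0 \<cdot> w0) = m"
          show "ev0 \<cdot> w0 = m'"
            by (rule pullback_unique[OF Rp _ _ _ _ 1]) (use 2 ty w0 m' in simp_all)
        qed (use m' in simp)
        moreover have "(r2 \<cdot> ev0) \<cdot> w0 = r2 \<cdot> (ev0 \<cdot> w0)" using ty w0 by simp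
        ultimately show ?thesis using X Y by simp
      qed
      then show ?thesis
        unfolding pmap_def Pi_map_def using h rh ty2 v(1,2) by auto
    qed
    then show "\<exists>!h. pmap x v T b' \<tau> sa st m h" using ex by simp
  qed
  with d f show ?thesis unfolding pstep_def by blast
qed

end

end

end

section \<open>Transposes for the constructed dependent product\<close>

context inverse_diagrams
begin

context
  fixes A \<gamma> B E \<epsilon>
  assumes g: "(A, \<gamma>, B) \<in> RF" and e: "(E, \<epsilon>, A) \<in> RF"
begin

context
  fixes G Z \<zeta> S a s \<mu>
  assumes G: "\<forall>x \<in> Ob K. pstep A \<gamma> B E \<epsilon> G x (G x)"
    and Z: "RO Z" "RT Z \<zeta> B" and S: "RT S a A" "RT S s Z" "RT S \<mu> E"
    and pb_all: "\<forall>x \<in> Ob K. is_pullback C (\<gamma> x) (\<zeta> x) (a x) (s x)"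
    and \<mu>_all: "\<forall>x \<in> Ob K. \<epsilon> x \<cdot> \<mu> x = a x"
begin

lemmas pb = bspec[OF pb_all] and \<mu> = bspec[OF \<mu>_all]

lemma stage_facts:
  assumes "x \<in> Ob K"
  shows "fstep B G x (G x)" "pdata A \<gamma> E \<epsilon> G x (G x)" "puniv A \<gamma> B E \<epsilon> G x (G x)"
  using G assms unfolding pstep_def[OF g e] by blast+

text \<open>The recursion equation for a transpose from \<open>Z\<close>: naturality forces its leg
  along \<open>u\<close> to be the lower component after the arrow of \<open>Z\<close>.\<close>

definition hmap :: "('i \<Rightarrow> 'a) \<Rightarrow> 'i \<Rightarrow> 'a \<Rightarrow> bool" where
  "hmap h x = pmap x (G x) (Fob Z x) (\<zeta> x) (\<lambda>u. h (Cod K u) \<cdot> Far Z u) (a x) (s x) (\<mu> x)"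

lemmas RZ = ROD[OF Z(1)] and fZ = functor_simps[OF ROD(1)[OF Z(1)]] and tZ = RTD[OF Z(2)]
  and ta = RTD[OF S(1)] and ts = RTD[OF S(2)] and tm = RTD[OF S(3)] and fS = functor_simps[OF RTD(6)[OF S(1)]]

lemmas dia_facts = fstep_all[OF RFD(2)[OF g] stage_facts(1)]

lemma hmapD:
  assumes "hmap h x v"
  shows "v \<in> Ar C" "Dom C v = Fob Z x" "Cod C v = v_ob (G x)" "v_tr (G x) \<cdot> v = \<zeta> x"
    "u \<in> N x \<Longrightarrow> v_ar (G x) u \<cdot> v = h (Cod K u) \<cdot> Far Z u" "over (G x) (a x) (v \<cdot> s x) w \<Longrightarrow> v_ev (G x) \<cdot> w = \<mu> x"
  using assms unfolding hmap_def pmap_def[OF g e] by blast+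

text \<open>This is \<open>puniv\<close> with \<open>T\<close> the value of \<open>Z\<close> at
  \<open>x\<close>. The compatibility it asks for holds because \<open>\<mu>\<close> is natural and
  the components below \<open>x\<close> already evaluate to \<open>\<mu>\<close>.\<close>

lemma hmap_ex1:
  assumes x: "x \<in> Ob K" and h: "\<And>u. u \<in> N x \<Longrightarrow> hmap h (Cod K u) (h (Cod K u))"
  shows "\<exists>!v. hmap h x v"
proof -
  note D = dia_facts
  have nat: "nat_below Z h (dia G) x"
  proof
    fix u assume u: "u \<in> N x"
    note y = nonid_Cod[OF u] and H = hmapD[OF h[OF u]]
    show "natu Z h (dia G) (Cod K u)"
      by (rule nat_atI[OF y RZ(2)[OF y] ROD(2)[OF D(1) y]]) (use H y in \<open>simp_all add: dia_simps Far_dia\<close>)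
  qed
  have c: "rcone C K (dia G) (tra G) B x (Fob Z x) (\<zeta> x) (\<lambda>u. h (Cod K u) \<cdot> Far Z u)"
    unfolding rcone_def
  proof (intro conjI ballI)
    show "mcone C K (dia G) x (Fob Z x) (\<lambda>u. h (Cod K u) \<cdot> Far Z u)"
      by (rule mcone_trans[OF RZ(4) ROD(4)[OF D(1)] nat mcone_good[OF RZ(2)[OF x]]])
    fix u assume u: "u \<in> N x"
    note u' = nonidD[OF u] and y = nonid_Cod[OF u] and H = hmapD[OF h[OF u]]
    have t: "v_tr (G (Cod K u)) \<in> Ar C" "Dom C (v_tr (G (Cod K u))) = v_ob (G (Cod K u))"
      using stage_facts(1)[OF y] unfolding fstep_def by simp_all
    have "v_tr (G (Cod K u)) \<cdot> (h (Cod K u) \<cdot> Far Z u) = \<zeta> (Cod K u) \<cdot> Far Z u"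
      by (rule cmp_ext[OF H(4)]) (use H t u' fZ in simp_all)
    then show "Far B u \<cdot> \<zeta> x = tra G (Cod K u) \<cdot> (h (Cod K u) \<cdot> Far Z u)"
      using tZ(4)[OF u'(1)] u' y by (simp add: dia_simps)
  qed (use tZ(1-3) x in simp_all)
  have "compat A E G x (a x) (s x) (\<lambda>u. h (Cod K u) \<cdot> Far Z u) (\<mu> x)"
    unfolding compat_def[OF g e]
  proof (intro ballI allI impI)
    fix u w assume u: "u \<in> N x" and w: "over (G (Cod K u)) (Far A u \<cdot> a x) ((h (Cod K u) \<cdot> Far Z u) \<cdot> s x) w"
    note u' = nonidD[OF u] and y = nonid_Cod[OF u] and H = hmapD[OF h[OF u]]
    let ?y = "Cod K u"
    note Q = pdataD[OF g e stage_facts(2)[OF y]]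
    note Q' = pullbackD[OF Q(1)] and Py = pullbackD[OF pb[OF y]]
    have t: "v_tr (G ?y) \<in> Ar C" "Dom C (v_tr (G ?y)) = v_ob (G ?y)"
      using stage_facts(1)[OF y] unfolding fstep_def by simp_all
    have "v_tr (G ?y) \<cdot> (h ?y \<cdot> s ?y) = \<zeta> ?y \<cdot> s ?y"
      by (rule cmp_ext[OF H(4)]) (use H t y ts(1-3) in simp_all)
    then have eq: "\<gamma> ?y \<cdot> a ?y = v_tr (G ?y) \<cdot> (h ?y \<cdot> s ?y)" using Py(9) by simp
    obtain w' where w': "w' \<in> Ar C" "Dom C w' = Dom C (a ?y)" "Cod C w' = Dom C (v_qa (G ?y))"
        "v_qa (G ?y) \<cdot> w' = a ?y" "v_qr (G ?y) \<cdot> w' = h ?y \<cdot> s ?y"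
      by (rule pullback_obtain[OF Q(1) _ _ _ _ _ eq]) (use y H t ta(1-3) ts(1-3) Q' Py in simp_all)
    then have ev: "v_ev (G ?y) \<cdot> w' = \<mu> ?y"
      by (intro H(6)) (simp add: over_def[OF g e])
    have Dw': "Dom C w' = Fob S ?y" using w'(2) y ta(2) by simp
    \<comment> \<open>By naturality of the two projections, the pair moved down from
      \<open>x\<close> is the pair \<open>w'\<close> at the target of \<open>u\<close> after the
      arrow of \<open>S\<close>; uniqueness identifies it with \<open>w\<close>.\<close>
    have "over (G ?y) (Far A u \<cdot> a x) ((h ?y \<cdot> Far Z u) \<cdot> s x) (w' \<cdot> Far S u)"
      unfolding over_def[OF g e]
    proof (intro conjI)
      have "v_qa (G ?y) \<cdot> (w' \<cdot> Far S u) = a ?y \<cdot> Far S u"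
        by (rule cmp_ext[OF w'(4)]) (use w' Dw' u' fS Q' in simp_all)
      then show "v_qa (G ?y) \<cdot> (w' \<cdot> Far S u) = Far A u \<cdot> a x" using ta(4)[OF u'(1)] u' by simp
      have "v_qr (G ?y) \<cdot> (w' \<cdot> Far S u) = (h ?y \<cdot> s ?y) \<cdot> Far S u"
        by (rule cmp_ext[OF w'(5)]) (use w' Dw' u' fS Q' in simp_all)
      also have "\<dots> = h ?y \<cdot> (Far Z u \<cdot> s x)" using ts(4)[OF u'(1)] u' y H ts(1-3) fS by simp
      also have "\<dots> = (h ?y \<cdot> Far Z u) \<cdot> s x" using u' x y H ts(1-3) fZ by simp
      finally show "v_qr (G ?y) \<cdot> (w' \<cdot> Far S u) = (h ?y \<cdot> Far Z u) \<cdot> s x" .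
    qed (use w' Dw' u' x fS ta(1-3) functor_simps[OF RTD(7)[OF S(1)]] in simp_all)
    then have "w = w' \<cdot> Far S u" using over_unique[OF g e Q(1) w] by blast
    then have "v_ev (G ?y) \<cdot> w = \<mu> ?y \<cdot> Far S u"
      using cmp_ext[OF ev, of "Far S u"] Q w' Dw' u' fS by simp
    then show "Far E u \<cdot> \<mu> x = v_ev (G ?y) \<cdot> w" using tm(4)[OF u'(1)] u' by simp
  qed
  then show ?thesis
    using stage_facts(3)[OF x] c pb[OF x] \<mu>[OF x] tm(1-3) ta(1-3) x
    unfolding puniv_def[OF g e] hmap_def by simp
qed

lemma hmap_exists:
  obtains h where "\<forall>x \<in> Ob K. hmap h x (h x)"
proof (rule prec_choice[of hmap])
  fix h h' :: "'i \<Rightarrow> 'a" and x v assume "\<forall>u \<in> N x. h (Cod K u) = h' (Cod K u)"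
  then show "hmap h x v = hmap h' x v" unfolding hmap_def pmap_def[OF g e] by (auto cong: ball_cong)
next
  fix h x assume "x \<in> Ob K" "\<And>u. u \<in> N x \<Longrightarrow> hmap h (Cod K u) (h (Cod K u))"
  then show "\<exists>v. hmap h x v" using hmap_ex1 by blast
qed (rule that)

text \<open>The equation at \<open>x\<close> involves only lower components and has a unique
  solution, so two families agree by induction along the order.\<close>

lemma hmap_unique:
  assumes h: "\<forall>x \<in> Ob K. hmap h x (h x)" and h': "\<forall>x \<in> Ob K. hmap h' x (h' x)" and x: "x \<in> Ob K"
  shows "h x = h' x"
  using x
proof (induction x rule: prec_induct)
  case (1 x)
  have eq: "h (Cod K u) = h' (Cod K u)" if "u \<in> N x" for u using 1(1)[OF that nonid_Cod[OF that]] .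
  have "hmap h x = hmap h' x" unfolding hmap_def pmap_def[OF g e] using eq by (intro ext) (auto cong: ball_cong)
  then have "hmap h x (h' x)" using h' 1(2) by simp
  moreover have "\<exists>!v. hmap h x v" using hmap_ex1[OF 1(2)] h nonid_Cod by blast
  ultimately show ?case using h 1(2) by blast
qed

lemma hmap_natural:
  assumes h: "\<forall>x \<in> Ob K. hmap h x (h x)"
  shows "RT Z (restrict h (Ob K)) (dia G)"
proof -
  have "natu Z (restrict h (Ob K)) (dia G) x" if x: "x \<in> Ob K" for x
    by (rule nat_atI[OF x RZ(2)[OF x] ROD(2)[OF dia_facts(1) x]])
      (use hmapD[OF h[rule_format, OF x]] x in \<open>simp_all add: dia_simps Far_dia nonid_Cod\<close>)
  then show ?thesis
    unfolding nat_trans_iff_nat[OF K.category_axioms] using RZ(1) ROD(1)[OF dia_facts(1)] by simp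
qed

end

lemma D_Pi_exists:
  obtains r qa qr ev where "r \<in> RF" "Cod D r = B" "is_Pi D (A, \<gamma>, B) (E, \<epsilon>, A) r qa qr ev"
proof -
  obtain G where G: "\<forall>x \<in> Ob K. pstep A \<gamma> B E \<epsilon> G x (G x)"
  proof (rule prec_choice[of "pstep A \<gamma> B E \<epsilon>"])
    fix G G' :: "'i \<Rightarrow> ('o, 'j, 'a) pstage" and x v assume "\<forall>u \<in> N x. G (Cod K u) = G' (Cod K u)"
    then show "pstep A \<gamma> B E \<epsilon> G x v = pstep A \<gamma> B E \<epsilon> G' x v" by (rule pstep_cong[OF g e])
  next
    fix G :: "'i \<Rightarrow> ('o, 'j, 'a) pstage" and x
    assume "x \<in> Ob K" "\<And>u. u \<in> N x \<Longrightarrow> pstep A \<gamma> B E \<epsilon> G (Cod K u) (G (Cod K u))"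
    then show "\<exists>v. pstep A \<gamma> B E \<epsilon> G x v" by (rule pstep_exists[OF g e])
  qed
  have st: "fstep B G x (G x)" "pdata A \<gamma> E \<epsilon> G x (G x)" if "x \<in> Ob K" for x
    using G that unfolding pstep_def[OF g e] by blast+
  note Y = fstep_all[OF RFD(2)[OF g] st(1)]
  note tY = RTD[OF Y(2)]
  have pb: "is_pullback C (\<gamma> x) (tra G x) (v_qa (G x)) (v_qr (G x))" if "x \<in> Ob K" for x
    using pdataD(1)[OF g e st(2)[OF that]] that by (simp add: dia_simps)
  let ?qa = "\<lambda>x \<in> Ob K. v_qa (G x)" and ?qr = "\<lambda>x \<in> Ob K. v_qr (G x)" and ?ev = "\<lambda>x \<in> Ob K. v_ev (G x)"
  \<comment> \<open>The pullback in \<open>D\<close> is assembled from the recorded levelwise ones,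
    so that the recorded evaluation maps have exactly this diagram as their source.\<close>
  obtain Q where Q: "(Q, ?qa, A) \<in> RF" "RT Q ?qr (dia G)"
    "is_pullback D (A, \<gamma>, B) (dia G, tra G, B) (Q, ?qa, A) (Q, ?qr, dia G)"
    "\<And>x. x \<in> Ob K \<Longrightarrow> Fob Q x = Dom C (v_qa (G x))"
    using D_pullback_construct[OF Y(3) RFD(1)[OF g] RFD(3)[OF g] pb] by blast
  note RQ = ROD[OF RFD(1)[OF Q(1)]] and RE = ROD[OF RFD(1)[OF e]]
  note fQ = functor_simps[OF RQ(1)]
  note tqa = RTD[OF RFD(3)[OF Q(1)]] and tqr = RTD[OF Q(2)]
  have "natu Q ?ev E x" if x: "x \<in> Ob K" for x
  proof (rule nat_atI[OF x RQ(2)[OF x] RE(2)[OF x]])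
    note P = pdataD[OF g e st(2)[OF x]]
    show "\<forall>u\<in>N x. Far E u \<cdot> ?ev x = ?ev (Cod K u) \<cdot> Far Q u"
    proof
      fix u assume u: "u \<in> N x"
      note u' = nonidD[OF u] and y = nonid_Cod[OF u]
      \<comment> \<open>The arrow of \<open>Q\<close> is itself the test map in
        \<open>compat\<close>, which therefore reads as naturality of evaluation.\<close>
      have "over (G (Cod K u)) (Far A u \<cdot> v_qa (G x)) (v_ar (G x) u \<cdot> v_qr (G x)) (Far Q u)"
        unfolding over_def[OF g e]
        using tqa(4)[OF u'(1)] tqr(4)[OF u'(1)] u' x y fQ Q(4) tqa(1-3)[of x] tqa(1-3)[of "Cod K u"]
          functor_simps[OF ROD(1)[OF RFD(1)[OF g]]]
        by (simp add: Far_dia[OF u])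
      then show "Far E u \<cdot> ?ev x = ?ev (Cod K u) \<cdot> Far Q u"
        using P(6) u x y unfolding compat_def[OF g e] by simp
    qed
  qed (use pdataD[OF g e st(2)[OF x]] Q(4) x in simp_all)
  then have ev: "RT Q ?ev E"
    unfolding nat_trans_iff_nat[OF K.category_axioms] using RQ(1) RE(1) by simp
  have "(\<lambda>j \<in> Ob K. \<epsilon> j \<cdot> ?ev j) = ?qa"
    by (rule extensionalityI[of _ "Ob K"]) (use pdataD(5)[OF g e st(2)] in simp_all)
  then have eev: "(E, \<epsilon>, A) \<cdot>\<^bsub>D\<^esub> (Q, ?ev, E) = (Q, ?qa, A)" by (simp add: D_cmp)
  have "is_Pi D (A, \<gamma>, B) (E, \<epsilon>, A) (dia G, tra G, B) (Q, ?qa, A) (Q, ?qr, dia G) (Q, ?ev, E)"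
    unfolding is_Pi_def
  proof (intro conjI allI impI; (elim conjE)?)
    show "(Q, ?ev, E) \<in> Ar D" using ev RFD(1)[OF Q(1)] RFD(1)[OF e] by (simp add: reedy_Ar)
    fix z sa sz m assume zp: "is_pullback D (A, \<gamma>, B) z sa sz"
      and m: "m \<in> Ar D" "Dom D m = Dom D sa" "Cod D m = Dom D (E, \<epsilon>, A)" "(E, \<epsilon>, A) \<cdot>\<^bsub>D\<^esub> m = sa"
    obtain A' \<gamma>' B' Z \<zeta> S a s where "(A, \<gamma>, B) = (A', \<gamma>', B')" "z = (Z, \<zeta>, B')" "sa = (S, a, A')" "sz = (S, s, Z)"
      "RO A'" "RO B'" "RO Z" "RO S" "RT A' \<gamma>' B'" "RT Z \<zeta> B'" "RT S a A'" "RT S s Z"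
      using D_pullback_shape[OF zp] .
    then have zs: "z = (Z, \<zeta>, B)" "sa = (S, a, A)" "sz = (S, s, Z)"
      "RO Z" "RO S" "RT Z \<zeta> B" "RT S a A" "RT S s Z"
      by simp_all
    obtain \<mu> where \<mu>: "m = (S, \<mu>, E)" "RT S \<mu> E"
      using m(1-3) zs by (auto simp: D_Ar D_simps)
    \<comment> \<open>\<open>D_pullback_level\<close> expects the fibration as the second of the two
      maps, hence the flip before and after.\<close>
    have zpb: "\<forall>x \<in> Ob K. is_pullback C (\<gamma> x) (\<zeta> x) (a x) (s x)"
      using pullback_sym[OF D_pullback_level[OF D.pullback_sym[OF zp[unfolded zs]] g]] by blast
    have e\<mu>: "\<forall>x \<in> Ob K. \<epsilon> x \<cdot> \<mu> x = a x"
      using D_cmp_eq[OF m(4)[unfolded \<mu> zs]] by blast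
    note L = G zs(4,6-8) \<mu>(2) zpb e\<mu>
    let ?hm = "hmap G Z \<zeta> a s \<mu>"
    \<comment> \<open>Transposes in \<open>D\<close> are exactly the natural families solving
      \<open>hmap\<close>, so their existence and uniqueness reduce to the recursion.\<close>
    have char: "Pi_map D (dia G, tra G, B) (Q, ?qa, A) (Q, ?qr, dia G) (Q, ?ev, E) z sa sz m H \<longleftrightarrow>
        (\<exists>h. H = (Z, h, dia G) \<and> RT Z h (dia G) \<and> (\<forall>x \<in> Ob K. ?hm h x (h x)))" (is "?P \<longleftrightarrow> ?R") for H
    proof
      assume ?P
      then have H: "H \<in> Ar D" "Dom D H = Dom D z" "Cod D H = Dom D (dia G, tra G, B)" "(dia G, tra G, B) \<cdot>\<^bsub>D\<^esub> H = z"
        and HW: "\<forall>w \<in> Ar D. Dom D w = Dom D sa \<and> Cod D w = Dom D (Q, ?qa, A) \<and> (Q, ?qa, A) \<cdot>\<^bsub>D\<^esub> w = sa \<and>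
        (Q, ?qr, dia G) \<cdot>\<^bsub>D\<^esub> w = H \<cdot>\<^bsub>D\<^esub> sz \<longrightarrow> (Q, ?ev, E) \<cdot>\<^bsub>D\<^esub> w = m"
        unfolding Pi_map_def by blast+
      obtain h where h: "H = (Z, h, dia G)" "RT Z h (dia G)"
        using H(1-3) zs(1) by (auto simp: D_Ar D_simps)
      note th = RTD[OF h(2)]
      have szA: "sz \<in> Ar D" "Dom D sz = S" "Cod D sz = Z" "sa \<in> Ar D" "Dom D sa = S" "Cod D sa = A"
        using D.pullbackD[OF zp] zs by (simp_all add: D_simps)
      have "(dia G, tra G, B) \<cdot>\<^bsub>D\<^esub> (H \<cdot>\<^bsub>D\<^esub> sz) = z \<cdot>\<^bsub>D\<^esub> sz"
        by (rule D.cmp_ext[OF H(4) H(1)]) (use H szA zs Y in \<open>simp_all add: D_simps reedy_Ar RFD(2)[OF g]\<close>)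
      then have eq: "(A, \<gamma>, B) \<cdot>\<^bsub>D\<^esub> sa = (dia G, tra G, B) \<cdot>\<^bsub>D\<^esub> (H \<cdot>\<^bsub>D\<^esub> sz)"
        using D.pullbackD(9)[OF zp] by simp
      have HzA: "H \<cdot>\<^bsub>D\<^esub> sz \<in> Ar D" "Dom D (H \<cdot>\<^bsub>D\<^esub> sz) = S" "Cod D (H \<cdot>\<^bsub>D\<^esub> sz) = dia G"
        using D.cmp_simps[of sz H] H szA zs(1) by (simp_all add: D_simps)
      \<comment> \<open>The hypothesis speaks of maps of diagrams, so the test map is formed in
        \<open>D\<close>; at each level any test map equals its component.\<close>
      obtain W where W: "W \<in> Ar D" "Dom D W = Dom D sa" "Cod D W = Dom D (Q, ?qa, A)" "(Q, ?qa, A) \<cdot>\<^bsub>D\<^esub> W = sa"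
          "(Q, ?qr, dia G) \<cdot>\<^bsub>D\<^esub> W = H \<cdot>\<^bsub>D\<^esub> sz"
        by (rule D.pullback_obtain[OF Q(3) szA(4) HzA(1) _ _ _ eq]) (use szA HzA in \<open>simp_all add: D_simps\<close>)
      have mW: "(Q, ?ev, E) \<cdot>\<^bsub>D\<^esub> W = m" using HW W by blast
      obtain \<omega> where \<omega>: "W = (S, \<omega>, Q)" "RT S \<omega> Q" using W(1-3) zs(2) by (auto simp: D_Ar D_simps)
      have "?hm h x (h x)" if x: "x \<in> Ob K" for x
        unfolding hmap_def[OF L] pmap_def[OF g e]
      proof (intro conjI ballI allI impI)
        show "v_tr (G x) \<cdot> h x = \<zeta> x"
          using D_cmp_eq[OF H(4)[unfolded h(1) zs(1)] x] x by (simp add: dia_simps)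
        show "v_ar (G x) u \<cdot> h x = h (Cod K u) \<cdot> Far Z u" if u: "u \<in> N x" for u
          using th(4)[of u] nonidD[OF u] by (simp add: Far_dia[OF u])
        fix w assume w: "over (G x) (a x) (h x \<cdot> s x) w"
        have "over (G x) (a x) (h x \<cdot> s x) (\<omega> x)"
          unfolding over_def[OF g e]
          using D_cmp_eq[OF W(4)[unfolded \<omega>(1) zs(2)] x] D_cmp_level[OF W(5)[unfolded \<omega>(1) h(1) zs(3)] x] x
            RTD(1-3)[OF \<omega>(2) x] RTD(2)[OF zs(7) x] Q(4)[OF x] by simp
        then have "w = \<omega> x" using over_unique[OF g e pdataD(1)[OF g e st(2)[OF x]] w] by blast
        then show "v_ev (G x) \<cdot> w = \<mu> x"
          using D_cmp_eq[OF mW[unfolded \<omega>(1) \<mu>(1)] x] x by simp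
      qed (use th(1-3)[OF x] x in \<open>simp_all add: dia_simps\<close>)
      then show ?R using h by blast
    next
      assume ?R
      then obtain h where h: "H = (Z, h, dia G)" "RT Z h (dia G)" "\<forall>x \<in> Ob K. ?hm h x (h x)" by blast
      note hD = hmapD[OF L h(3)[rule_format]]
      show ?P
        unfolding Pi_map_def
      proof (intro conjI ballI impI; (elim conjE)?)
        show "H \<in> Ar D" using h zs(4) Y(1) by (simp add: reedy_Ar)
        have "(\<lambda>j \<in> Ob K. tra G j \<cdot> h j) = \<zeta>"
          by (rule extensionalityI[of _ "Ob K"]) (use hD(4) RTD(5)[OF zs(6)] in \<open>simp_all add: dia_simps\<close>)
        then show "(dia G, tra G, B) \<cdot>\<^bsub>D\<^esub> H = z" by (simp add: D_cmp h zs)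
        fix w assume w: "w \<in> Ar D" "Dom D w = Dom D sa" "Cod D w = Dom D (Q, ?qa, A)" "(Q, ?qa, A) \<cdot>\<^bsub>D\<^esub> w = sa"
          "(Q, ?qr, dia G) \<cdot>\<^bsub>D\<^esub> w = H \<cdot>\<^bsub>D\<^esub> sz"
        obtain \<omega> where \<omega>: "w = (S, \<omega>, Q)" "RT S \<omega> Q" using w(1-3) zs(2) by (auto simp: D_Ar D_simps)
        have "v_ev (G x) \<cdot> \<omega> x = \<mu> x" if x: "x \<in> Ob K" for x
        proof (rule hD(6)[OF x])
          show "over (G x) (a x) (h x \<cdot> s x) (\<omega> x)"
            unfolding over_def[OF g e]
            using D_cmp_eq[OF w(4)[unfolded \<omega>(1) zs(2)] x] D_cmp_level[OF w(5)[unfolded \<omega>(1) h(1) zs(3)] x] x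
              RTD(1-3)[OF \<omega>(2) x] RTD(2)[OF zs(7) x] Q(4)[OF x] by simp
        qed
        then have "(\<lambda>j \<in> Ob K. ?ev j \<cdot> \<omega> j) = \<mu>"
          by (intro extensionalityI[of _ "Ob K"]) (use RTD(5)[OF \<mu>(2)] in simp_all)
        then show "(Q, ?ev, E) \<cdot>\<^bsub>D\<^esub> w = m" by (simp add: D_cmp \<omega> \<mu>)
      qed (use h(1) zs(1) in \<open>simp_all add: D_simps\<close>)
    qed
    obtain h where h: "\<forall>x \<in> Ob K. ?hm h x (h x)" using hmap_exists[OF L] .
    \<comment> \<open>Transformations must be \<open>undefined\<close> off the objects. The
      recursion equation involves only components at objects, so restriction preserves it.\<close>
    have hr: "\<forall>x \<in> Ob K. ?hm (restrict h (Ob K)) x (restrict h (Ob K) x)"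
      using h unfolding hmap_def[OF L] pmap_def[OF g e] by (simp add: nonid_Cod)
    show "\<exists>!H. Pi_map D (dia G, tra G, B) (Q, ?qa, A) (Q, ?qr, dia G) (Q, ?ev, E) z sa sz m H"
      unfolding char
    proof (rule ex1I[of _ "(Z, restrict h (Ob K), dia G)"])
      show "\<exists>k. (Z, restrict h (Ob K), dia G) = (Z, k, dia G) \<and> RT Z k (dia G) \<and> (\<forall>x \<in> Ob K. ?hm k x (k x))"
        using hmap_natural[OF L h] hr by blast
      fix H assume "\<exists>k. H = (Z, k, dia G) \<and> RT Z k (dia G) \<and> (\<forall>x \<in> Ob K. ?hm k x (k x))"
      then obtain k where k: "H = (Z, k, dia G)" "RT Z k (dia G)" "\<forall>x \<in> Ob K. ?hm k x (k x)" by blast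
      have "k = restrict h (Ob K)"
        by (rule D_eqI[OF k(2) hmap_natural[OF L h]]) (rule hmap_unique[OF L k(3) hr])
      then show "H = (Z, restrict h (Ob K), dia G)" using k(1) by simp
    qed
  qed (use Q(3) eev in \<open>simp_all add: D_simps\<close>)
  then show thesis using that[OF Y(3)] by (simp add: D_simps)
qed

end

text \<open>The dependent product comes with a pullback of its own, whereas the pullback functor
  uses the chosen one; \<open>is_Pi_change\<close> moves the evaluation map there.\<close>

lemma D_Pi:
  assumes g: "g \<in> RF"
  shows "\<exists>R. partial_right_adjoint (slice D (Cod D g)) (slice D (Dom D g)) (pullback_functor D g)
             {p \<in> RF. Cod D p = Dom D g} R \<and> (\<forall>p \<in> RF. Cod D p = Dom D g \<longrightarrow> R p \<in> RF)"
proof -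
  obtain A \<gamma> B where g': "g = (A, \<gamma>, B)" by (cases g)
  have gA: "g \<in> Ar D" and RFA: "RF \<subseteq> Ar D" using g by (auto simp: reedy_fibrations_def)
  have hp: "has_pullback D g z" if "z \<in> Ar D" "Cod D z = Cod D g" for z
    using D_has_pullback[OF g that] D.pullback_sym unfolding has_pullback_def by blast
  have "\<exists>r. r \<in> RF \<and> Cod D r = Cod D g \<and> (\<exists>ev. is_Pi D g p r (pb_fst D g r) (pb_snd D g r) ev)"
    if p: "p \<in> RF" "Cod D p = Dom D g" for p
  proof -
    obtain E \<epsilon> where p': "p = (E, \<epsilon>, A)" using p(2) by (cases p) (auto simp: g' D_simps)
    obtain r qa qr ev where r: "r \<in> RF" "Cod D r = B" "is_Pi D (A, \<gamma>, B) (E, \<epsilon>, A) r qa qr ev"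
      using D_Pi_exists[OF g[unfolded g'] p(1)[unfolded p']] .
    have "r \<in> Ar D" "Cod D r = Cod D g" "p \<in> Ar D" using r RFA p by (auto simp: g' D_simps)
    then show ?thesis
      using D.is_Pi_change[OF r(3)[folded g' p'] D.pb_is_pullback[OF hp]] r(1) by metis
  qed
  then have "\<forall>p. \<exists>r. p \<in> RF \<and> Cod D p = Dom D g \<longrightarrow> r \<in> RF \<and> Cod D r = Cod D g \<and>
      (\<exists>ev. is_Pi D g p r (pb_fst D g r) (pb_snd D g r) ev)" by blast
  then obtain R where R: "\<And>p. p \<in> RF \<and> Cod D p = Dom D g \<Longrightarrow> R p \<in> RF \<and> Cod D (R p) = Cod D g \<and>
      (\<exists>ev. is_Pi D g p (R p) (pb_fst D g (R p)) (pb_snd D g (R p)) ev)" by metis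
  have "partial_right_adjoint (slice D (Cod D g)) (slice D (Dom D g)) (pullback_functor D g)
             {p \<in> RF. Cod D p = Dom D g} R"
    by (rule D.partial_right_adjoint_of_Pi[OF gA hp]) (use R RFA in auto)
  then show ?thesis using R by blast
qed

lemma reedy_type_theoretic_fibration_category: "type_theoretic_fibration_category D RF"
proof
  show "RF \<subseteq> Ar D" by (auto simp: reedy_fibrations_def)
  show "\<And>f g. f \<in> RF \<Longrightarrow> g \<in> RF \<Longrightarrow> Cod D f = Dom D g \<Longrightarrow> g \<cdot>\<^bsub>D\<^esub> f \<in> RF" by (rule D_fib_cmp)
  show "\<And>x. x \<in> Ob D \<Longrightarrow> Ide D x \<in> RF" by (rule D_iso_fib[OF D.ide_iso])
  show "\<And>f. is_iso D f \<Longrightarrow> f \<in> RF" by (rule D_iso_fib)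
  show "\<exists>t. is_terminal D t \<and> (\<forall>f\<in>Ar D. Cod D f = t \<longrightarrow> f \<in> RF)" by (rule D_terminal)
  show "\<And>g f. g \<in> RF \<Longrightarrow> f \<in> Ar D \<Longrightarrow> Cod D f = Cod D g \<Longrightarrow> has_pullback D f g" by (rule D_has_pullback)
  show "\<And>g f p q. g \<in> RF \<Longrightarrow> is_pullback D f g p q \<Longrightarrow> p \<in> RF" by (rule D_fib_pullback)
  show "\<And>g. g \<in> RF \<Longrightarrow> \<exists>R. partial_right_adjoint (slice D (Cod D g)) (slice D (Dom D g)) (pullback_functor D g)
             {p \<in> RF. Cod D p = Dom D g} R \<and> (\<forall>p \<in> RF. Cod D p = Dom D g \<longrightarrow> R p \<in> RF)" by (rule D_Pi)
  show "\<And>f. f \<in> Ar D \<Longrightarrow> \<exists>i p. acyclic_cofibration D RF i \<and> p \<in> RF \<and> Cod D i = Dom D p \<and> p \<cdot>\<^bsub>D\<^esub> i = f"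
    by (rule D_factorization)
  show "\<And>a b i z. a \<in> RF \<Longrightarrow> b \<in> RF \<Longrightarrow> Cod D a = Cod D b \<Longrightarrow> acyclic_cofibration D RF i \<Longrightarrow>
     i \<in> hom D (Dom D a) (Dom D b) \<Longrightarrow> b \<cdot>\<^bsub>D\<^esub> i = a \<Longrightarrow> z \<in> Ar D \<Longrightarrow> Cod D z = Cod D a \<Longrightarrow>
     acyclic_cofibration D RF (pb_induced D z b (pb_fst D z a) (i \<cdot>\<^bsub>D\<^esub> pb_snd D z a))"
    by (rule D_acof_pullback)
qed

end

theorem theorem11p11:
  fixes C :: "('o, 'a) cat" and F :: "'a set" and I :: "('i, 'j) cat"
  assumes "type_theoretic_fibration_category C F"
    and "inverse_category I"
    and "admissible C F I"
  shows "type_theoretic_fibration_category (reedy_cat C F I) (reedy_fibrations C F I)"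
proof -
  interpret inverse_diagrams C F I
    using assms by (simp add: inverse_diagrams_def inverse_diagrams_axioms_def diagrams_def inverse_category_def)
  show ?thesis by (rule reedy_type_theoretic_fibration_category)
qed

end
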